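(* Let $\mathcal D_+$ be a simply connected quadrature domain whose boundary admits a Schwarz function $\mathcal S$, with mother body $\mathscr L_+$, and let the density $f$ be holomorphic near $\operatorname{cl}(\mathcal D_\pm)$ (setting of the context). Then the coefficient of $z^{-1}$ in the exterior large-$z$ expansion of the solution $M_2$ of the $\bar\partial$-problem of the context coincides with the coefficient of $z^{-1}$ generated by the following Riemann--Hilbert problem on $\Sigma_{\rm mb}=\mathscr L_+\cup\mathscr L_-\cup\mathscr L_+^*\cup\mathscr L_-^*$: $$\widetilde m_+(x,t,z)=\widetilde m_-(x,t,z)\widetilde J(x,t,z),\qquad\widetilde m(x,t,z)=\mathbb I+\mathcal O(z^{-1}),\quad z\to\infty,$$ where $$\widetilde J(x,t,z)=\mathbb I+e^{-i\theta(x,t,z)\sigma_3}\begin{pmatrix}0&\varrho^*(z)\chi_{\mathscr L_+^*\cup\mathscr L_-^*}(z)\\ -\varrho(z)\chi_{\mathscr L_+\cup\mathscr L_-}(z)&0\end{pmatrix}e^{i\theta(x,t,z)\sigma_3}.$$ Consequently, the potential $2i\lim_{z\to\infty}z[\widetilde m(x,t,z)]_{12}$ reconstructed from this Riemann--Hilbert problem agrees with the potential $u(x,t)=2i\lim_{z\to\infty}z[M_2(x,t,z)]_{12}$ reconstructed from the exterior expansion of the $\bar\partial$-problem.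
   Context: $\theta(x,t,z)=z^2x+2z^4t$; $h^*(z)=\overline{h(\bar z)}$; $\sigma_2,\sigma_3$ Pauli matrices; $\chi$ indicator function. $\mathcal D_+$ is a bounded simply connected domain with closure in the open first quadrant; $\mathcal D_-=-\mathcal D_+$, $\mathcal D_\pm^*=\{\bar z:z\in\mathcal D_\pm\}$. The density $f$ on $\mathcal D_\pm$ is the restriction of a function holomorphic in a neighbourhood of $\operatorname{cl}(\mathcal D_\pm)$ with $f(-z)=f(z)$; on the conjugate domains the density is $f^*(z)=\overline{f(\bar z)}$. **$\bar\partial$-problem.** $\partial_{\bar z}M_2=M_2N$ with $$N=\begin{pmatrix}0&-f^*(z)e^{-2i\theta}\chi_{\mathcal D_+^*\cup\mathcal D_-^*}(z)\\ f(z)e^{2i\theta}\chi_{\mathcal D_+\cup\mathcal D_-}(z)&0\end{pmatrix},\qquad M_2=\mathbb I+\mathcal O(z^{-1}),$$ and $M_2(z)=\sigma_2M_2^*(z)\sigma_2=\sigma_3M_2(-z)\sigma_3$. **Schwarz function.** $\mathcal S$ satisfies $\bar z=\mathcal S(z)$ on $\partial\mathcal D_+$; the mother body $\mathscr L_+$ is the singularity set of the analytic continuation of $\mathcal S$ inside $\mathcal D_+$; $\mathscr L_-=-\mathscr L_+$, $\mathscr L_\pm^*=$ complex conjugate of $\mathscr L_\pm$ (with corresponding Schwarz functions and with orientations inherited from the positively oriented boundaries). $\Delta\mathcal S(z)=\mathcal S_-(z)-\mathcal S_+(z)$ is the jump across the oriented mother body. $\varrho(z)=f(z)\Delta\mathcal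 S(z)$ on $\mathscr L_+\cup\mathscr L_-$, and $\varrho^*$ on $\mathscr L_+^*\cup\mathscr L_-^*$ is defined by Schwarz conjugation, $\varrho^*(z)=\overline{\varrho(\bar z)}$.
   Formalization: The mother body is taken to be finitely many C^1 arcs with one-sided values of S and S=o(1/|z-a|) at arc ends, and m is o(1/|z-a|) there; domains whose Schwarz function has poles (e.g. discs) are excluded, since poles give no jump and the claim fails. *)

theory Defs
  imports "HOL-Complex_Analysis.Complex_Analysis" "HOL-Library.Landau_Symbols"
begin

type_synonym cmat2 = "complex^2^2"

definition mat2 :: "complex \<Rightarrow> complex \<Rightarrow> complex \<Rightarrow> complex \<Rightarrow> cmat2" where
  "mat2 a b c d = vector [vector [a, b], vector [c, d]]"

definition sigma2 :: cmat2 where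
  "sigma2 = mat2 0 (-\<i>) \<i> 0"

definition sigma3 :: cmat2 where
  "sigma3 = mat2 1 0 0 (-1)"

(* the matrix exponential of a * sigma3, which is diagonal *)
definition exp_sigma3 :: "complex \<Rightarrow> cmat2" where
  "exp_sigma3 a = mat2 (exp a) 0 0 (exp (- a))"

definition theta :: "real \<Rightarrow> real \<Rightarrow> complex \<Rightarrow> complex" where
  "theta x t z = z^2 * of_real x + 2 * z^4 * of_real t"

definition schwarz_conj :: "(complex \<Rightarrow> complex) \<Rightarrow> complex \<Rightarrow> complex" where
  "schwarz_conj h z = cnj (h (cnj z))"

(* entrywise conjugation, without transposition *)
definition mat_schwarz_conj :: "(complex \<Rightarrow> cmat2) \<Rightarrow> complex \<Rightarrow> cmat2" where
  "mat_schwarz_conj M z = (\<chi> i j. cnj (M (cnj z) $ i $ j))"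

definition first_quadrant :: "complex set" where
  "first_quadrant = {z. Re z > 0 \<and> Im z > 0}"


subsection \<open>Behaviour at infinity\<close>

(* M = I + O(1/z) *)
definition normalized_at_infinity :: "(complex \<Rightarrow> cmat2) \<Rightarrow> bool" where
  "normalized_at_infinity M \<longleftrightarrow>
     (\<forall>i j. (\<lambda>z. M z $ i $ j - (mat 1 :: cmat2) $ i $ j) \<in> O[at_infinity](\<lambda>z. 1 / z))"

(* M = I + A/z + O(1/z^2) *)
definition has_inv_z_coeff :: "(complex \<Rightarrow> cmat2) \<Rightarrow> cmat2 \<Rightarrow> bool" where
  "has_inv_z_coeff M A \<longleftrightarrow>
     (\<forall>i j. (\<lambda>z. M z $ i $ j - (mat 1 :: cmat2) $ i $ j - A $ i $ j / z)
              \<in> O[at_infinity](\<lambda>z. 1 / z^2))"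

definition has_potential :: "(complex \<Rightarrow> cmat2) \<Rightarrow> complex \<Rightarrow> bool" where
  "has_potential M u \<longleftrightarrow>
     (\<exists>l. ((\<lambda>z. z * M z $ 1 $ 2) \<longlongrightarrow> l) at_infinity \<and> u = 2 * \<i> * l)"


subsection \<open>The \<open>\<partial>\<close>-bar problem\<close>

(* Wirtinger derivative of a real-differentiable function *)
definition dbar :: "(complex \<Rightarrow> complex) \<Rightarrow> complex \<Rightarrow> complex" where
  "dbar F z = (frechet_derivative F (at z) 1 + \<i> * frechet_derivative F (at z) \<i>) / 2"

definition dbar_matrix ::
  "complex set \<Rightarrow> (complex \<Rightarrow> complex) \<Rightarrow> real \<Rightarrow> real \<Rightarrow> complex \<Rightarrow> cmat2" where
  "dbar_matrix Dp f x t z = mat2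
     0 (- schwarz_conj f z * exp (- 2 * \<i> * theta x t z)
          * indicator (cnj ` Dp \<union> cnj ` uminus ` Dp) z)
     (f z * exp (2 * \<i> * theta x t z) * indicator (Dp \<union> uminus ` Dp) z) 0"

(* The coefficient matrix is discontinuous across the boundaries of the four
   domains. A solution is continuous on the whole plane and satisfies the equation
   classically off these boundaries; in particular it is holomorphic outside the
   closures of the domains. *)
definition dbar_solution ::
  "complex set \<Rightarrow> (complex \<Rightarrow> complex) \<Rightarrow> real \<Rightarrow> real \<Rightarrow> (complex \<Rightarrow> cmat2) \<Rightarrow> bool" where
  "dbar_solution Dp f x t M \<longleftrightarrow>
     continuous_on UNIV M \<and>
     (\<forall>z. z \<notin> frontier Dp \<union> frontier (uminus ` Dp) \<union>
              frontier (cnj ` Dp) \<union> frontier (cnj ` uminus ` Dp) \<longrightarrow>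
        (\<forall>i j. (\<lambda>w. M w $ i $ j) differentiable (at z) \<and>
               dbar (\<lambda>w. M w $ i $ j) z = (M z ** dbar_matrix Dp f x t z) $ i $ j)) \<and>
     normalized_at_infinity M \<and>
     (\<forall>z. M z = sigma2 ** mat_schwarz_conj M z ** sigma2 \<and>
          M z = sigma3 ** M (- z) ** sigma3)"


subsection \<open>Oriented contours and boundary values\<close>

definition support :: "(real \<Rightarrow> complex) set \<Rightarrow> complex set" where
  "support \<Gamma> = (\<Union>\<gamma>\<in>\<Gamma>. path_image \<gamma>)"

(* finitely many simple oriented arcs, regular and C^1 away from their end points,
   which may meet one another only at end points *)
definition arc_system :: "(real \<Rightarrow> complex) set \<Rightarrow> bool" where
  "arc_system \<Gamma> \<longleftrightarrow> finite \<Gamma> \<and>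
     (\<forall>\<gamma>\<in>\<Gamma>. arc \<gamma> \<and> \<gamma> C1_differentiable_on {0<..<1} \<and>
        (\<forall>s\<in>{0<..<1}. vector_derivative \<gamma> (at s) \<noteq> 0)) \<and>
     (\<forall>\<gamma>\<in>\<Gamma>. \<forall>\<delta>\<in>\<Gamma>. \<gamma> \<noteq> \<delta> \<longrightarrow>
        (\<forall>s\<in>{0..1}. \<forall>r\<in>{0..1}. \<gamma> s = \<delta> r \<longrightarrow> s \<in> {0, 1} \<and> r \<in> {0, 1}))"

(* Boundary values from the left (the + side) and from the right (the - side) at the
   interior point \<gamma> s of an oriented arc. The foot point and the distance along
   the normal vary simultaneously; as the points near a C^1 arc on its left are exactly
   those \<gamma> \<sigma> + \<epsilon> i \<gamma>'(\<sigma>) with small \<epsilon> > 0, this is the full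
   (not merely the normal) limit from that side. *)
definition has_left_value ::
  "(complex \<Rightarrow> 'a::topological_space) \<Rightarrow> (real \<Rightarrow> complex) \<Rightarrow> real \<Rightarrow> 'a \<Rightarrow> bool" where
  "has_left_value F \<gamma> s v \<longleftrightarrow>
     ((\<lambda>(\<sigma>, \<epsilon>). F (\<gamma> \<sigma> + of_real \<epsilon> * \<i> * vector_derivative \<gamma> (at \<sigma>))) \<longlongrightarrow> v)
       (nhds s \<times>\<^sub>F at_right 0)"

definition has_right_value ::
  "(complex \<Rightarrow> 'a::topological_space) \<Rightarrow> (real \<Rightarrow> complex) \<Rightarrow> real \<Rightarrow> 'a \<Rightarrow> bool" where
  "has_right_value F \<gamma> s v \<longleftrightarrow>
     ((\<lambda>(\<sigma>, \<epsilon>). F (\<gamma> \<sigma> + of_real \<epsilon> * \<i> * vector_derivative \<gamma> (at \<sigma>))) \<longlongrightarrow> v)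
       (nhds s \<times>\<^sub>F at_left 0)"

(* Right minus left boundary value; unique at interior points of the arcs of an
   arc_system where both boundary values exist. *)
definition jump_across ::
  "(real \<Rightarrow> complex) set \<Rightarrow> (complex \<Rightarrow> complex) \<Rightarrow> complex \<Rightarrow> complex" where
  "jump_across \<Gamma> F z = (THE d. \<exists>\<gamma>\<in>\<Gamma>. \<exists>s\<in>{0<..<1}. \<exists>l r.
      z = \<gamma> s \<and> has_left_value F \<gamma> s l \<and> has_right_value F \<gamma> s r \<and> d = r - l)"

definition neg_arcs :: "(real \<Rightarrow> complex) set \<Rightarrow> (real \<Rightarrow> complex) set" where
  "neg_arcs \<Gamma> = (\<lambda>\<gamma> s. - \<gamma> s) ` \<Gamma>"

(* Conjugation reverses the positive orientation of a boundary curve, so the orientation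
   inherited from the positively oriented conjugate domain is that of the reversed arc. *)
definition conj_arcs :: "(real \<Rightarrow> complex) set \<Rightarrow> (real \<Rightarrow> complex) set" where
  "conj_arcs \<Gamma> = (\<lambda>\<gamma>. reversepath (cnj \<circ> \<gamma>)) ` \<Gamma>"

definition four_arcs :: "(real \<Rightarrow> complex) set \<Rightarrow> (real \<Rightarrow> complex) set" where
  "four_arcs \<Gamma> = \<Gamma> \<union> neg_arcs \<Gamma> \<union> conj_arcs \<Gamma> \<union> conj_arcs (neg_arcs \<Gamma>)"


subsection \<open>Schwarz function and mother body\<close>

(* S is holomorphic near every point of the closure of D off the mother body
   (analytic_on gives a neighbourhood of each point), and it is the continuation of the
   Schwarz function from the boundary since D minus the mother body is connected. The
   fifth conjunct says that every point of the mother body is a singularity of S. At the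
   end points of the arcs S is o(1/(z-a)), e.g. bounded as at square-root branch points,
   or with integrable power singularities; this excludes poles, which would not be
   visible in the jump of S. *)
definition mother_body ::
  "complex set \<Rightarrow> (complex \<Rightarrow> complex) \<Rightarrow> (real \<Rightarrow> complex) set \<Rightarrow> bool" where
  "mother_body D S \<Gamma> \<longleftrightarrow>
     arc_system \<Gamma> \<and> support \<Gamma> \<subseteq> D \<and> connected (D - support \<Gamma>) \<and>
     S analytic_on (closure D - support \<Gamma>) \<and>
     (\<forall>p\<in>support \<Gamma>. \<not> (\<exists>U g. open U \<and> p \<in> U \<and> g holomorphic_on U \<and>
                               (\<forall>z\<in>U - support \<Gamma>. g z = S z))) \<and>
     (\<forall>\<gamma>\<in>\<Gamma>. \<forall>s\<in>{0<..<1}. (\<exists>v. has_left_value S \<gamma> s v) \<and> (\<exists>v. has_right_value S \<gamma> s v)) \<and>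
     (\<forall>\<gamma>\<in>\<Gamma>. \<forall>a\<in>{\<gamma> 0, \<gamma> 1}. S \<in> o[at a within - support \<Gamma>](\<lambda>z. 1 / (z - a)))"

(* Quadrature domain in the generalised sense: the continuation of the Schwarz function
   into D has a mother body consisting of arcs. *)
definition quadrature_domain ::
  "complex set \<Rightarrow> (complex \<Rightarrow> complex) \<Rightarrow> (real \<Rightarrow> complex) set \<Rightarrow> bool" where
  "quadrature_domain D S \<Gamma> \<longleftrightarrow>
     D \<noteq> {} \<and> open D \<and> connected D \<and> simply_connected D \<and> bounded D \<and>
     (\<forall>z\<in>frontier D. S z = cnj z) \<and> mother_body D S \<Gamma>"


subsection \<open>The Riemann--Hilbert problem on the mother body\<close>

(* The Schwarz function of -D is z \<mapsto> - S (-z). *)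
definition varrho ::
  "(complex \<Rightarrow> complex) \<Rightarrow> (complex \<Rightarrow> complex) \<Rightarrow> (real \<Rightarrow> complex) set \<Rightarrow> complex \<Rightarrow> complex" where
  "varrho f S \<Gamma> z =
     (if z \<in> support \<Gamma> then f z * jump_across \<Gamma> S z
      else if z \<in> support (neg_arcs \<Gamma>) then f z * jump_across (neg_arcs \<Gamma>) (\<lambda>w. - S (- w)) z
      else 0)"

definition jump_matrix ::
  "(complex \<Rightarrow> complex) \<Rightarrow> (complex \<Rightarrow> complex) \<Rightarrow> (real \<Rightarrow> complex) set \<Rightarrow>
   real \<Rightarrow> real \<Rightarrow> complex \<Rightarrow> cmat2" where
  "jump_matrix f S \<Gamma> x t z = mat 1 + exp_sigma3 (- \<i> * theta x t z) **
     mat2 0 (schwarz_conj (varrho f S \<Gamma>) z *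
               indicator (support (conj_arcs \<Gamma>) \<union> support (conj_arcs (neg_arcs \<Gamma>))) z)
          (- varrho f S \<Gamma> z * indicator (support \<Gamma> \<union> support (neg_arcs \<Gamma>)) z) 0
     ** exp_sigma3 (\<i> * theta x t z)"

(* The growth condition at end points of arcs is the usual one under which solutions are
   unique; the values of m on the contour itself are irrelevant. *)
definition rhp_solution ::
  "(real \<Rightarrow> complex) set \<Rightarrow> (complex \<Rightarrow> cmat2) \<Rightarrow> (complex \<Rightarrow> cmat2) \<Rightarrow> bool" where
  "rhp_solution \<Sigma> J m \<longleftrightarrow>
     (\<forall>i j. (\<lambda>z. m z $ i $ j) holomorphic_on (- support \<Sigma>)) \<and>
     (\<forall>\<gamma>\<in>\<Sigma>. \<forall>s\<in>{0<..<1}. \<exists>mp mm. has_left_value m \<gamma> s mp \<and> has_right_value m \<gamma> s mm \<and>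
        mp = mm ** J (\<gamma> s)) \<and>
     (\<forall>\<gamma>\<in>\<Sigma>. \<forall>a\<in>{\<gamma> 0, \<gamma> 1}. \<forall>i j.
        (\<lambda>z. m z $ i $ j) \<in> o[at a within - support \<Sigma>](\<lambda>z. 1 / (z - a))) \<and>
     normalized_at_infinity m"

end

theory Submission
  imports Defs
begin

text \<open>
  In \<open>D\<close>, where \<open>\<partial>\<close>-bar of the first column of \<open>M\<close> is \<open>p\<close> times the second one,
  \<open>p = f * exp (2 * \<i> * \<theta>)\<close>, subtracting \<open>p * (cnj z - S z)\<close> times the second column makes the first
  one holomorphic off the mother body.  As \<open>cnj z = S z\<close> on the boundary, the new matrix continues \<open>M\<close>
  continuously, hence holomorphically, to the outside; its jump on the mother body is the jump of \<open>p * S\<close>.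
  The conjugate domains are treated alike with the columns exchanged.  So \<open>M\<close> coincides near infinity with a
  solution of the Riemann--Hilbert problem.

  That solution is unique: if \<open>m\<close>, \<open>m'\<close> are solutions, every minor formed by a row of \<open>m\<close> and
  a row of \<open>m'\<close> has no jump and extends to an entire function, which Liouville's theorem
  evaluates, and \<open>det m = 1\<close>.  At the end points of the arcs a product of two entries is only \<open>o(1/(z-a)^2)\<close>, but
  since the jump is triangular one column extends holomorphically, and the other one does after
  subtracting \<open>p * S\<close> times the first.
\<close>

subsection \<open>Rectangles and curves of finite length\<close>

text \<open>Two kinds of curve have to be crossed, and each needs its own argument. No regularity of
  the frontier of \<open>D\<close> is assumed, so nothing can be estimated along it; there the
  Schwarz function itself supplies a conformal chart that carries the frontier into a line. On the
  mother body \<open>S\<close> is singular and gives no chart, but the arcs are C^1 inside, hence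
  Lipschitz on compact subarcs, and a continuous function that is holomorphic off a Lipschitz curve
  is holomorphic across it. At the end points the derivative of an arc is not controlled; they are
  reached last, as isolated singularities of a function already extended across the open arcs. In
  the uniqueness part minors replace the product of \<open>m'\<close> with the inverse of
  \<open>m\<close>: they presuppose no invertibility, and the case \<open>m' = m\<close> yields the
  determinant. They have no jump because the jump matrix, common to both solutions, is triangular
  with unit diagonal at each interior point of an arc.\<close>

definition rect_int :: "(complex \<Rightarrow> complex) \<Rightarrow> real \<Rightarrow> real \<Rightarrow> real \<Rightarrow> real \<Rightarrow> complex" where
  "rect_int F a b c d =
     contour_integral (linepath (Complex a c) (Complex b c)) F
   + contour_integral (linepath (Complex b c) (Complex b d)) F
   - contour_integral (linepath (Complex a d) (Complex b d)) F
   - contour_integral (linepath (Complex a c) (Complex a d)) F"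

lemma closed_segment_subset_cbox_complex:
  assumes "p \<in> cbox a b" "q \<in> cbox a (b::complex)"
  shows "closed_segment p q \<subseteq> cbox a b"
  using assms by (simp add: closed_segment_subset convex_box)

lemma contour_integral_rectpath_eq_rect_int:
  assumes "a \<le> b" "c \<le> d" and F: "continuous_on (cbox (Complex a c) (Complex b d)) F"
  shows "contour_integral (rectpath (Complex a c) (Complex b d)) F = rect_int F a b c d"
proof -
  have seg: "continuous_on (closed_segment p q) F"
    if "p \<in> cbox (Complex a c) (Complex b d)" "q \<in> cbox (Complex a c) (Complex b d)" for p q
    using continuous_on_subset[OF F closed_segment_subset_cbox_complex[OF that]] .
  have mem: "Complex a c \<in> cbox (Complex a c) (Complex b d)" "Complex b c \<in> cbox (Complex a c) (Complex b d)"
     "Complex a d \<in> cbox (Complex a c) (Complex b d)" "Complex b d \<in> cbox (Complex a c) (Complex b d)"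
    using assms by (auto simp: in_cbox_complex_iff)
  have ci: "F contour_integrable_on linepath p q"
    if "p \<in> cbox (Complex a c) (Complex b d)" "q \<in> cbox (Complex a c) (Complex b d)" for p q
    using seg[OF that] contour_integrable_continuous_linepath by blast
  have r1: "contour_integral (linepath (Complex b d) (Complex a d)) F
      = - contour_integral (linepath (Complex a d) (Complex b d)) F"
    using contour_integral_reverse_linepath[OF seg] mem by blast
  have r2: "contour_integral (linepath (Complex a d) (Complex a c)) F
      = - contour_integral (linepath (Complex a c) (Complex a d)) F"
    using contour_integral_reverse_linepath[OF seg] mem by blast
  show ?thesis
    unfolding rectpath_def Let_def rect_int_def
    using r1 r2 by (simp add: ci mem contour_integrable_joinI valid_path_join)
qed

lemma contour_integral_linepath_partition:
  fixes p v :: complex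
  assumes "continuous_on (closed_segment p (p + of_nat n * v)) F"
  shows "contour_integral (linepath p (p + of_nat n * v)) F =
         (\<Sum>i<n. contour_integral (linepath (p + of_nat i * v) (p + of_nat (Suc i) * v)) F)"
  using assms
proof (induction n)
  case (Suc n)
  let ?e = "p + of_nat (Suc n) * v"
  \<comment> \<open>The weight n / (n + 1) places the last inner node on the whole segment.\<close>
  have "of_nat n * v = (real n / real (Suc n)) *\<^sub>R (of_nat (Suc n) * v)"
    by (simp add: scaleR_conv_of_real del: of_nat_Suc)
  then have "p + of_nat n * v = (1 - real n / real (Suc n)) *\<^sub>R p + (real n / real (Suc n)) *\<^sub>R ?e"
    by (simp add: algebra_simps del: of_nat_Suc)
  then have mem: "p + of_nat n * v \<in> closed_segment p ?e"
    unfolding in_segment by (intro exI[of _ "real n / real (Suc n)"]) auto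
  have "continuous_on (closed_segment p (p + of_nat n * v)) F"
    using Suc.prems by (rule continuous_on_subset) (use mem in \<open>simp add: subset_closed_segment\<close>)
  from Suc.IH[OF this] contour_integral_split_linepath[OF Suc.prems mem]
  show ?case by simp
qed simp

text \<open>\<open>rect_int\<close> runs through every side rightwards or upwards and puts the
  orientation into the sign, so a side shared by two cells occurs as the same integral with opposite
  signs and the double sum telescopes in both directions.\<close>

lemma rect_int_grid:
  fixes a c h :: real
  assumes h: "h \<ge> 0"
    and F: "continuous_on (cbox (Complex a c) (Complex (a + real n * h) (c + real n * h))) F"
  shows "rect_int F a (a + real n * h) c (c + real n * h) =
    (\<Sum>i<n. \<Sum>j<n. rect_int F (a + real i * h) (a + real (Suc i) * h)
                              (c + real j * h) (c + real (Suc j) * h))"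
proof -
  define H where "H i j = contour_integral
     (linepath (Complex (a + real i * h) (c + real j * h)) (Complex (a + real (Suc i) * h) (c + real j * h))) F" for i j
  define V where "V i j = contour_integral
     (linepath (Complex (a + real i * h) (c + real j * h)) (Complex (a + real i * h) (c + real (Suc j) * h))) F" for i j
  let ?Q = "cbox (Complex a c) (Complex (a + real n * h) (c + real n * h))"
  have mem: "Complex (a + real i * h) (c + real j * h) \<in> ?Q" if "i \<le> n" "j \<le> n" for i j
    using that h by (auto simp: in_cbox_complex_iff mult_right_mono)
  have seg: "continuous_on (closed_segment p q) F" if "p \<in> ?Q" "q \<in> ?Q" for p q
    using continuous_on_subset[OF F closed_segment_subset_cbox_complex[OF that]] .
  have H: "contour_integral (linepath (Complex a (c + real j * h)) (Complex (a + real n * h) (c + real j * h))) F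
      = (\<Sum>i<n. H i j)" if "j \<le> n" for j
  proof -
    have "continuous_on (closed_segment (Complex a (c + real j * h)) (Complex (a + real n * h) (c + real j * h))) F"
      using seg[OF mem[of 0 j] mem[of n j]] that by simp
    moreover have *: "Complex (a + real i * h) (c + real j * h) = Complex a (c + real j * h) + of_nat i * of_real h" for i
      by (simp add: complex_eq_iff)
    ultimately show ?thesis unfolding H_def *
      by (intro contour_integral_linepath_partition) simp
  qed
  have V: "contour_integral (linepath (Complex (a + real i * h) c) (Complex (a + real i * h) (c + real n * h))) F
      = (\<Sum>j<n. V i j)" if "i \<le> n" for i
  proof -
    have "continuous_on (closed_segment (Complex (a + real i * h) c) (Complex (a + real i * h) (c + real n * h))) F"
      using seg[OF mem[of i 0] mem[of i n]] that by simp
    moreover have *: "Complex (a + real i * h) (c + real j * h) = Complex (a + real i * h) c + of_nat j * (\<i> * of_real h)" for j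
      by (simp add: complex_eq_iff)
    ultimately show ?thesis unfolding V_def *
      by (intro contour_integral_linepath_partition) simp
  qed
  have "(\<Sum>i<n. \<Sum>j<n. H i j + V (Suc i) j - H i (Suc j) - V i j) =
        (\<Sum>i<n. \<Sum>j<n. H i j - H i (Suc j)) + (\<Sum>j<n. \<Sum>i<n. V (Suc i) j - V i j)"
    by (subst (2) sum.swap) (simp add: sum.distrib[symmetric] algebra_simps)
  also have "\<dots> = (\<Sum>i<n. H i 0 - H i n) + (\<Sum>j<n. V n j - V 0 j)"
  proof -
    have "(\<Sum>j<n. H i j - H i (Suc j)) = H i 0 - H i n" for i
      by (rule sum_lessThan_telescope')
    moreover have "(\<Sum>i<n. V (Suc i) j - V i j) = V n j - V 0 j" for j
      by (rule sum_lessThan_telescope)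
    ultimately show ?thesis by simp
  qed
  finally show ?thesis
    using H[of 0] H[of n] V[of 0] V[of n]
    by (simp add: rect_int_def H_def V_def sum_subtractf)
qed

lemma rect_int_eq_0:
  assumes "a \<le> b" "c \<le> d" "F holomorphic_on cbox (Complex a c) (Complex b d)"
  shows "rect_int F a b c d = 0"
proof -
  have "(F has_contour_integral 0) (rectpath (Complex a c) (Complex b d))"
    using assms path_image_rectpath_subset_cbox[of "Complex a c" "Complex b d"]
    by (intro Cauchy_theorem_convex_simple[OF assms(3)]) (auto simp: convex_box)
  then show ?thesis
    using contour_integral_rectpath_eq_rect_int[OF assms(1,2) holomorphic_on_imp_continuous_on[OF assms(3)]]
    by (simp add: contour_integral_unique)
qed

text \<open>A constant \<open>k\<close> has integral zero along the closed boundary, so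
  \<open>F\<close> may be replaced by \<open>F - k\<close>, of size at most \<open>e\<close> on a
  boundary of length \<open>4 * h\<close>.\<close>

lemma norm_rect_int_le:
  fixes a c h :: real
  assumes h: "h \<ge> 0" and F: "continuous_on (cbox (Complex a c) (Complex (a+h) (c+h))) F"
    and e: "\<And>z. z \<in> cbox (Complex a c) (Complex (a+h) (c+h)) \<Longrightarrow> norm (F z - k) \<le> e"
  shows "norm (rect_int F a (a+h) c (c+h)) \<le> 4 * h * e"
proof -
  let ?Q = "cbox (Complex a c) (Complex (a+h) (c+h))"
  have seg: "closed_segment p q \<subseteq> ?Q" if "p \<in> ?Q" "q \<in> ?Q" for p q
    using closed_segment_subset_cbox_complex[OF that] .
  have mem: "Complex a c \<in> ?Q" "Complex (a+h) c \<in> ?Q" "Complex a (c+h) \<in> ?Q" "Complex (a+h) (c+h) \<in> ?Q"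
    using h by (auto simp: in_cbox_complex_iff)
  have e0: "e \<ge> 0" using e[OF mem(1)] norm_ge_zero order_trans by blast
  have *: "norm (contour_integral (linepath p q) F - k * (q - p)) \<le> e * norm (q - p)"
    if "p \<in> ?Q" "q \<in> ?Q" for p q
  proof (rule has_contour_integral_bound_linepath[OF _ e0])
    have "F contour_integrable_on linepath p q"
      using continuous_on_subset[OF F seg[OF that]] contour_integrable_continuous_linepath by blast
    then show "((\<lambda>z. F z - k) has_contour_integral contour_integral (linepath p q) F - k * (q - p)) (linepath p q)"
      by (intro has_contour_integral_diff has_contour_integral_integral has_contour_integral_const_linepath)
  qed (use e seg[OF that] in blast)
  have "rect_int F a (a+h) c (c+h) =
     (contour_integral (linepath (Complex a c) (Complex (a+h) c)) F - k * (Complex (a+h) c - Complex a c))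
   + (contour_integral (linepath (Complex (a+h) c) (Complex (a+h) (c+h))) F - k * (Complex (a+h) (c+h) - Complex (a+h) c))
   - (contour_integral (linepath (Complex a (c+h)) (Complex (a+h) (c+h))) F - k * (Complex (a+h) (c+h) - Complex a (c+h)))
   - (contour_integral (linepath (Complex a c) (Complex a (c+h))) F - k * (Complex a (c+h) - Complex a c))"
    unfolding rect_int_def by (simp add: algebra_simps)
  also have "norm \<dots> \<le> e * h + e * h + e * h + e * h"
  proof -
    have nn: "norm (p + q - r - s) \<le> e1 + e2 + e3 + e4"
      if "norm p \<le> e1" "norm q \<le> e2" "norm r \<le> e3" "norm s \<le> e4" for p q r s :: complex and e1 e2 e3 e4
      using that norm_triangle_ineq4[of "p + q - r" s] norm_triangle_ineq4[of "p + q" r] norm_triangle_ineq[of p q]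
      by linarith
    have "norm (Complex (a+h) c - Complex a c) = h" "norm (Complex (a+h) (c+h) - Complex (a+h) c) = h"
      "norm (Complex (a+h) (c+h) - Complex a (c+h)) = h" "norm (Complex a (c+h) - Complex a c) = h"
      using h by (auto simp: cmod_def)
    with *[OF mem(1,2)] *[OF mem(2,4)] *[OF mem(3,4)] *[OF mem(1,3)]
    show ?thesis by (intro nn) simp_all
  qed
  finally show ?thesis by (simp add: algebra_simps)
qed

lemma card_nat_near_le:
  assumes "c \<ge> 0"
  shows "finite {i::nat. \<bar>real i - r\<bar> \<le> c}" "real (card {i::nat. \<bar>real i - r\<bar> \<le> c}) \<le> 2 * c + 1"
proof -
  have sub: "int ` {i::nat. \<bar>real i - r\<bar> \<le> c} \<subseteq> {\<lceil>r - c\<rceil>..\<lfloor>r + c\<rfloor>}"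
    by (auto simp: ceiling_le_iff le_floor_iff abs_le_iff)
  have fin: "finite (int ` {i::nat. \<bar>real i - r\<bar> \<le> c})"
    using sub finite_subset by blast
  then show "finite {i::nat. \<bar>real i - r\<bar> \<le> c}"
    by (simp add: finite_image_iff inj_on_def)
  have "card {i::nat. \<bar>real i - r\<bar> \<le> c} = card (int ` {i::nat. \<bar>real i - r\<bar> \<le> c})"
    by (simp add: card_image)
  also have "\<dots> \<le> nat (\<lfloor>r + c\<rfloor> - \<lceil>r - c\<rceil> + 1)"
    using card_mono[OF _ sub] by simp
  finally have "real (card {i::nat. \<bar>real i - r\<bar> \<le> c}) \<le> real (nat (\<lfloor>r + c\<rfloor> - \<lceil>r - c\<rceil> + 1))"
    by linarith
  also have "\<dots> \<le> 2 * c + 1"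
    using assms by linarith
  finally show "real (card {i::nat. \<bar>real i - r\<bar> \<le> c}) \<le> 2 * c + 1" .
qed

text \<open>The curve is sampled at the n + 1 parameters k / n. Each of its points is within L / n
  of a sample, so a cell meeting it has its lower left corner within h + L / n = (L / l + 1) * h of
  that sample in each coordinate; this leaves at most 2 * (L / l + 1) + 1 rows and as many columns
  per sample.\<close>

lemma card_cells_meeting_lipschitz_image_le:
  fixes g :: "real \<Rightarrow> complex" and a c l :: real
  assumes g: "L-lipschitz_on {0..1} g" and l: "l > 0" and n: "n > 0"
  defines "h \<equiv> l / real n"
  defines "B \<equiv> {(i,j). i < n \<and> j < n \<and>
     cbox (Complex (a + real i * h) (c + real j * h)) (Complex (a + real (Suc i) * h) (c + real (Suc j) * h))
       \<inter> g ` {0..1} \<noteq> {}}"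
  shows "real (card B) \<le> real (n + 1) * (2 * (L / l + 1) + 1)\<^sup>2"
proof -
  have L: "L \<ge> 0" using g lipschitz_on_nonneg by blast
  have h: "h > 0" using l n by (simp add: h_def)
  define K where "K = L / l + 1"
  have K: "K \<ge> 0" using L l by (simp add: K_def)
  define X where "X k = {i::nat. \<bar>real i - (Re (g (real k / n)) - a) / h\<bar> \<le> K}" for k
  define Y where "Y k = {i::nat. \<bar>real i - (Im (g (real k / n)) - c) / h\<bar> \<le> K}" for k
  have near: "\<bar>real i - (y - b) / h\<bar> \<le> K"
    if "b + real i * h \<le> u" "u \<le> b + real (Suc i) * h" "\<bar>u - y\<bar> \<le> L / n" for i b u y
  proof -
    have "\<bar>b + real i * h - y\<bar> \<le> h + L / n"
      using that by (simp add: algebra_simps)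
    also have "\<dots> = K * h" using l n by (simp add: K_def h_def field_simps)
    finally have "\<bar>b + real i * h - y\<bar> / h \<le> K" using h by (simp add: divide_simps)
    moreover have "\<bar>real i - (y - b) / h\<bar> = \<bar>b + real i * h - y\<bar> / h"
      using h by (simp add: divide_simps) 
    ultimately show ?thesis by simp
  qed
  have "B \<subseteq> (\<Union>k\<in>{..n}. X k \<times> Y k)"
  proof clarify
    fix i j assume "(i, j) \<in> B"
    then obtain s where s: "s \<in> {0..1}" and
      gs: "g s \<in> cbox (Complex (a + real i * h) (c + real j * h)) (Complex (a + real (Suc i) * h) (c + real (Suc j) * h))"
      unfolding B_def by blast
    \<comment> \<open>The sample parameter k / n is the last one not exceeding
      \<open>s\<close>.\<close>
    define k where "k = nat \<lfloor>s * n\<rfloor>"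
    have k: "real k \<le> s * n" "s * n < real k + 1"
      using s by (auto simp: k_def)
    have "real k \<le> real n" using k(1) s n by (smt (verit) atLeastAtMost_iff mult_left_le_one_le of_nat_0_le_iff)
    then have kn: "k \<le> n" by simp
    have "\<bar>s - real k / n\<bar> = \<bar>s * n - real k\<bar> / n" using n by (simp add: divide_simps abs_if)
    also have "\<dots> \<le> 1 / n" using k n by (intro divide_right_mono) auto
    finally have "\<bar>s - real k / n\<bar> \<le> 1 / n" .
    moreover have "real k / n \<in> {0..1}" using kn n by simp
    ultimately have "dist (g s) (g (real k / n)) \<le> L * (1 / n)"
      using lipschitz_onD[OF g s] L by (smt (verit) dist_real_def mult_left_mono)
    then have "norm (g s - g (real k / n)) \<le> L / n" by (simp add: dist_norm)
    then have "\<bar>Re (g s) - Re (g (real k / n))\<bar> \<le> L / n" "\<bar>Im (g s) - Im (g (real k / n))\<bar> \<le> L / n"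
      using abs_Re_le_cmod[of "g s - g (real k / n)"] abs_Im_le_cmod[of "g s - g (real k / n)"] by auto
    then have "i \<in> X k" "j \<in> Y k"
      using gs near unfolding X_def Y_def by (auto simp: in_cbox_complex_iff)
    then show "(i, j) \<in> (\<Union>k\<in>{..n}. X k \<times> Y k)" using kn by blast
  qed
  moreover have "finite (\<Union>k\<in>{..n}. X k \<times> Y k)"
    using card_nat_near_le(1)[OF K] by (auto simp: X_def Y_def)
  ultimately have "card B \<le> card (\<Union>k\<in>{..n}. X k \<times> Y k)" by (rule card_mono[rotated])
  also have "\<dots> \<le> (\<Sum>k\<in>{..n}. card (X k \<times> Y k))" by (rule card_UN_le) simp
  finally have "real (card B) \<le> (\<Sum>k\<in>{..n}. real (card (X k)) * real (card (Y k)))"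
    by (simp flip: of_nat_mult of_nat_sum add: card_cartesian_product)
  also have "\<dots> \<le> (\<Sum>k\<in>{..n}. (2 * K + 1) * (2 * K + 1))"
    using card_nat_near_le(2)[OF K] K by (intro sum_mono mult_mono) (auto simp: X_def Y_def)
  finally show ?thesis by (simp add: K_def power2_eq_square)
qed

text \<open>Painleve's argument: in an \<open>n\<close> by \<open>n\<close> grid, the cells missing the curve contribute nothing by
  Cauchy's theorem; only \<open>O(n)\<close> cells meet it, and each contributes \<open>o(1/n)\<close>, since \<open>F\<close> is
  uniformly continuous and constants integrate to zero.\<close>

lemma rect_int_eq_0_lipschitz_image:
  fixes g :: "real \<Rightarrow> complex" and a c l :: real
  assumes l: "l > 0"
  defines "Q \<equiv> cbox (Complex a c) (Complex (a + l) (c + l))"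
  assumes F: "continuous_on Q F" and hol: "F holomorphic_on (Q - g ` {0..1})"
    and g: "L-lipschitz_on {0..1} g"
  shows "rect_int F a (a + l) c (c + l) = 0"
proof -
  define C where "C = (2 * (L / l + 1) + 1)\<^sup>2"
  have C: "C \<ge> 0" by (simp add: C_def)
  have "norm (rect_int F a (a + l) c (c + l)) \<le> (8 * l * C) * e" if e: "e > 0" for e
  proof -
    have "uniformly_continuous_on Q F"
      using F by (intro compact_uniformly_continuous) (auto simp: Q_def)
    then obtain d where d: "d > 0" and ud: "\<And>z w. z \<in> Q \<Longrightarrow> w \<in> Q \<Longrightarrow> dist z w < d \<Longrightarrow> dist (F z) (F w) < e"
      using e unfolding uniformly_continuous_on_def by metis
    \<comment> \<open>Makes 2 * h < d: the sum of the coordinate differences, at most 2 * h, bounds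
      the distance of a point of a cell from the corner.\<close>
    obtain n :: nat where n: "2 * l / d < real n" using reals_Archimedean2 by blast
    have "2 * l / d > 0" using l d by simp
    with n have n0: "n > 0" by (cases n) auto
    define h where "h = l / real n"
    have h: "h > 0" and nh: "real n * h = l" using l n0 by (auto simp: h_def)
    have hd: "2 * h < d" using n d n0 by (simp add: h_def field_simps)
    define cell where "cell i j = cbox (Complex (a + real i * h) (c + real j * h)) (Complex (a + real (Suc i) * h) (c + real (Suc j) * h))" for i j
    define R where "R i j = rect_int F (a + real i * h) (a + real (Suc i) * h) (c + real j * h) (c + real (Suc j) * h)" for i j
    define B where "B = {(i,j). i < n \<and> j < n \<and> cell i j \<inter> g ` {0..1} \<noteq> {}}"
    have cQ: "cell i j \<subseteq> Q" if "i < n" "j < n" for i j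
    proof -
      have "real (Suc i) * h \<le> l" "real (Suc j) * h \<le> l"
        using that h unfolding nh[symmetric] by (intro mult_right_mono; simp)+
      moreover have "real i * h \<ge> 0" "real j * h \<ge> 0" using h by auto
      ultimately show ?thesis unfolding cell_def Q_def
        by (auto simp: in_cbox_complex_iff simp del: of_nat_Suc)
    qed
    have Rgood: "R i j = 0" if "i < n" "j < n" "(i,j) \<notin> B" for i j
    proof -
      have "cell i j \<subseteq> Q - g ` {0..1}" using cQ that by (auto simp: B_def)
      then have "F holomorphic_on cell i j" using hol holomorphic_on_subset by blast
      then show ?thesis unfolding R_def cell_def using h by (intro rect_int_eq_0) auto
    qed
    have Rbad: "norm (R i j) \<le> 4 * h * e" if "i < n" "j < n" for i j
    proof -
      let ?z = "Complex (a + real i * h) (c + real j * h)"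
      have eq: "a + real (Suc i) * h = (a + real i * h) + h" "c + real (Suc j) * h = (c + real j * h) + h"
        by (auto simp: algebra_simps)
      have zc: "?z \<in> cell i j" using h by (auto simp: cell_def in_cbox_complex_iff algebra_simps)
      have cc: "continuous_on (cell i j) F" using F cQ[OF that] continuous_on_subset by blast
      have small: "norm (F z - F ?z) \<le> e" if z: "z \<in> cell i j" for z
      proof -
        have "dist z ?z = cmod (z - ?z)" by (simp add: dist_norm)
        also have "\<dots> \<le> \<bar>Re (z - ?z)\<bar> + \<bar>Im (z - ?z)\<bar>" by (rule cmod_le)
        also have "\<dots> \<le> 2 * h" using z by (auto simp: cell_def in_cbox_complex_iff algebra_simps)
        finally have "dist (F z) (F ?z) < e"
          using hd z zc cQ[OF \<open>i < n\<close> \<open>j < n\<close>] by (intro ud) auto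
        then show ?thesis by (simp add: dist_norm)
      qed
      show ?thesis unfolding R_def eq
        using h cc small by (intro norm_rect_int_le[where k = "F ?z"]) (auto simp: cell_def eq simp del: of_nat_Suc)
    qed
    have finB: "finite B"
      by (rule finite_subset[of _ "{..<n} \<times> {..<n}"]) (auto simp: B_def)
    have "rect_int F a (a + l) c (c + l) = (\<Sum>i<n. \<Sum>j<n. R i j)"
      using rect_int_grid[of h a c n F] h F by (simp add: nh R_def Q_def)
    also have "\<dots> = (\<Sum>(i,j)\<in>{..<n} \<times> {..<n}. R i j)" by (simp add: sum.cartesian_product)
    also have "\<dots> = (\<Sum>(i,j)\<in>B. R i j)"
      using Rgood by (intro sum.mono_neutral_right) (auto simp: B_def)
    also have "norm \<dots> \<le> (\<Sum>(i,j)\<in>B. 4 * h * e)"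
      using Rbad by (intro sum_norm_le) (auto simp: B_def)
    also have "\<dots> = real (card B) * (4 * h * e)" by simp
    also have "real (card B) \<le> real (n + 1) * C"
      using card_cells_meeting_lipschitz_image_le[OF g l n0, of a c]
      unfolding C_def B_def cell_def h_def .
    then have "real (card B) * (4 * h * e) \<le> (real (n + 1) * C) * (4 * h * e)"
      using h e by (intro mult_right_mono) auto
    also have "(real (n + 1) * C) * (4 * h * e) = (4 * C * e) * (real (n+1) * h)" by simp
    \<comment> \<open>The number of cells on the curve grows like \<open>n\<close> while their side
      is l / n, so their total perimeter stays bounded under refinement and the factor
      \<open>e\<close> survives.\<close>
    also have "\<dots> \<le> (4 * C * e) * (2 * l)"
    proof (intro mult_left_mono)
      have "real (n+1) * h \<le> (2 * real n) * h" using n0 h by (intro mult_right_mono) auto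
      then show "real (n+1) * h \<le> 2 * l" using nh by simp
    qed (use C e in simp)
    finally show ?thesis by (simp add: algebra_simps)
  qed
  note bound = this
  define K where "K = 8 * l * C"
  have K: "K \<ge> 0" using C l by (simp add: K_def)
  have "norm (rect_int F a (a + l) c (c + l)) \<le> 0 + e" if "e > 0" for e
  proof -
    have "norm (rect_int F a (a + l) c (c + l)) \<le> K * (e / (K + 1))"
      using bound[of "e / (K + 1)"] K that unfolding K_def by (meson add_nonneg_pos divide_pos_pos zero_less_one)
    also have "\<dots> \<le> e" using K that by (simp add: field_simps)
    finally show ?thesis by simp
  qed
  then have "norm (rect_int F a (a + l) c (c + l)) \<le> 0" by (rule field_le_epsilon)
  then show ?thesis by simp
qed

subsection \<open>Removability of Lipschitz curves\<close>

lemma contour_integrable_continuous_rectpath: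
  assumes "continuous_on (path_image (rectpath p q)) f"
  shows "f contour_integrable_on rectpath p q"
proof -
  define p2 p4 where "p2 = Complex (Re q) (Im p)" and "p4 = Complex (Re p) (Im q)"
  have rect: "rectpath p q = linepath p p2 +++ linepath p2 q +++ linepath q p4 +++ linepath p4 p"
    by (simp add: rectpath_def p2_def p4_def Let_def)
  have "continuous_on (closed_segment p p2) f" "continuous_on (closed_segment p2 q) f"
    "continuous_on (closed_segment q p4) f" "continuous_on (closed_segment p4 p) f"
    using assms unfolding rect by (auto simp: path_image_join intro: continuous_on_subset)
  then show ?thesis
    unfolding rect by (intro contour_integrable_joinI contour_integrable_continuous_linepath) auto
qed

text \<open>\<open>F\<close> is only continuous on the segment; holomorphy in \<open>w\<close> comes
  from differentiating the kernel, with \<open>norm (q - p)\<close> as the bound for the speed of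
  the path.\<close>

lemma Cauchy_transform_linepath_holomorphic:
  assumes "continuous_on (closed_segment p q) F"
  shows "(\<lambda>w. contour_integral (linepath p q) (\<lambda>u. F u / (u - w))) holomorphic_on - closed_segment p q"
proof -
  have "((\<lambda>u. F u / (u - w) ^ 1) has_contour_integral contour_integral (linepath p q) (\<lambda>u. F u / (u - w)))
      (linepath p q)" if "w \<notin> closed_segment p q" for w
    using that assms
    by (auto intro!: has_contour_integral_integral contour_integrable_continuous_linepath continuous_intros)
  then have "\<exists>D. ((\<lambda>w. contour_integral (linepath p q) (\<lambda>u. F u / (u - w))) has_field_derivative D) (at w)"
    if "w \<notin> closed_segment p q" for w
    using Cauchy_next_derivative(2)[of "linepath p q" F "norm (q - p)" UNIV 1
        "\<lambda>w. contour_integral (linepath p q) (\<lambda>u. F u / (u - w))" w] that assms by fastforce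
  then show ?thesis
    by (subst holomorphic_on_open) (auto simp: closed_segment)
qed

lemma Cauchy_transform_rectpath_holomorphic:
  assumes F: "continuous_on (path_image (rectpath p q)) F"
  shows "(\<lambda>w. contour_integral (rectpath p q) (\<lambda>u. F u / (u - w))) holomorphic_on - path_image (rectpath p q)"
proof -
  define p2 p4 where "p2 = Complex (Re q) (Im p)" and "p4 = Complex (Re p) (Im q)"
  have rect: "rectpath p q = linepath p p2 +++ linepath p2 q +++ linepath q p4 +++ linepath p4 p"
    by (simp add: rectpath_def p2_def p4_def Let_def)
  have img: "path_image (rectpath p q) = closed_segment p p2 \<union> closed_segment p2 q \<union> closed_segment q p4 \<union> closed_segment p4 p"
    unfolding rect by (auto simp: path_image_join)
  let ?C = "\<lambda>a b w. contour_integral (linepath a b) (\<lambda>u. F u / (u - w))"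
  have cont: "continuous_on (closed_segment p p2) F" "continuous_on (closed_segment p2 q) F"
    "continuous_on (closed_segment q p4) F" "continuous_on (closed_segment p4 p) F"
    using F unfolding img by (auto intro: continuous_on_subset)
  have "(\<lambda>w. ?C p p2 w + (?C p2 q w + (?C q p4 w + ?C p4 p w))) holomorphic_on - path_image (rectpath p q)"
    using cont unfolding img
    by (intro holomorphic_intros holomorphic_on_subset[OF Cauchy_transform_linepath_holomorphic]) auto
  moreover have "contour_integral (rectpath p q) (\<lambda>u. F u / (u - w)) = ?C p p2 w + (?C p2 q w + (?C q p4 w + ?C p4 p w))"
    if "w \<in> - path_image (rectpath p q)" for w
  proof -
    have "(\<lambda>u. F u / (u - w)) contour_integrable_on linepath a b"
      if "continuous_on (closed_segment a b) F" "w \<notin> closed_segment a b" for a b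
      using that by (intro contour_integrable_continuous_linepath continuous_intros) auto
    with that cont show ?thesis
      unfolding img by (simp add: rect contour_integrable_joinI valid_path_join)
  qed
  ultimately show ?thesis by (metis (no_types, lifting) holomorphic_transform)
qed

text \<open>The parameters are placed on the real axis, a null set of the plane, and
  \<open>g \<circ> Re\<close> is Lipschitz there; Lipschitz maps between spaces of equal dimension
  preserve null sets.\<close>

lemma negligible_lipschitz_image_interval:
  fixes g :: "real \<Rightarrow> complex"
  assumes "L-lipschitz_on X g"
  shows "negligible (g ` X)"
proof -
  let ?S = "of_real ` X :: complex set"
  have "negligible {z. \<i> \<bullet> z = 0}" by (rule negligible_hyperplane) auto
  then have negS: "negligible ?S" by (rule negligible_subset) (auto simp: inner_complex_def)
  have "\<exists>T B. open T \<and> x \<in> T \<and> (\<forall>y\<in>?S \<inter> T. norm ((g \<circ> Re) y - (g \<circ> Re) x) \<le> B * norm (y - x))"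
    if "x \<in> ?S" for x
    using that lipschitz_onD[OF assms]
    by (intro exI[of _ UNIV] exI[of _ L]) (auto simp: dist_norm simp flip: of_real_diff)
  then have "negligible ((g \<circ> Re) ` ?S)"
    by (rule negligible_locally_Lipschitz_image[OF order_refl negS])
  moreover have "(g \<circ> Re) ` ?S = g ` X" by (force simp: image_iff)
  ultimately show ?thesis by simp
qed

lemma negligible_imp_interior_empty:
  fixes S :: "'a::euclidean_space set"
  assumes "negligible S"
  shows "interior S = {}"
  using negligible_subset[OF assms interior_subset] open_not_negligible[OF open_interior] by blast

text \<open>The set where the two functions differ is open and contained in
  \<open>E\<close>.\<close>

lemma continuous_eq_off_nowhere_dense:
  fixes f g :: "complex \<Rightarrow> complex"
  assumes V: "open V" and "continuous_on V f" "continuous_on V g" and E: "interior E = {}"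
    and eq: "\<And>z. z \<in> V - E \<Longrightarrow> f z = g z" and z: "z \<in> V"
  shows "f z = g z"
proof (rule ccontr)
  assume "f z \<noteq> g z"
  moreover have "open (V \<inter> (\<lambda>z. f z - g z) -` (- {0}))"
    using assms by (intro continuous_open_preimage continuous_intros) auto
  moreover have "V \<inter> (\<lambda>z. f z - g z) -` (- {0}) \<subseteq> E" using eq by auto
  ultimately have "V \<inter> (\<lambda>z. f z - g z) -` (- {0}) \<subseteq> interior E" by (intro interior_maximal)
  then show False using E z \<open>f z \<noteq> g z\<close> by auto
qed

text \<open>Cauchy's formula survives the presence of the curve: for \<open>w\<close> off the curve
  the difference quotient of \<open>F\<close> at \<open>w\<close> is again continuous, and
  holomorphic off the curve, so its integral over a small square vanishes. The resulting Cauchy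
  integral is holomorphic inside the square and agrees with \<open>F\<close> off the curve, hence
  everywhere by continuity.\<close>

lemma holomorphic_on_lipschitz_image_removable:
  fixes g :: "real \<Rightarrow> complex"
  assumes U: "open U" and F: "continuous_on U F" and hol: "F holomorphic_on (U - g ` {0..1})"
    and g: "L-lipschitz_on {0..1} g"
  shows "F holomorphic_on U"
proof -
  define E where "E = g ` {0..1}"
  have "compact E" unfolding E_def
    using g lipschitz_on_continuous_on by (intro compact_continuous_image) auto
  then have clE: "closed E" by (rule compact_imp_closed)
  have intE: "interior E = {}"
    unfolding E_def by (intro negligible_imp_interior_empty negligible_lipschitz_image_interval[OF g])
  have oUE: "open (U - E)" using U clE by blast
  have "\<exists>T. open T \<and> z0 \<in> T \<and> F holomorphic_on T" if z0: "z0 \<in> U" for z0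
  proof -
    obtain r where r: "r > 0" "cball z0 r \<subseteq> U" using U z0 open_contains_cball by blast
    \<comment> \<open>Half side r / 2 keeps the square in the disc of radius \<open>r\<close>, since
      the modulus is at most the sum of the moduli of real and imaginary part.\<close>
    define h where "h = r / 2"
    define a c l where "a = Re z0 - h" and "c = Im z0 - h" and "l = 2 * h"
    have h: "h > 0" and l: "l > 0" using r by (auto simp: h_def l_def)
    define Q where "Q = cbox (Complex a c) (Complex (a + l) (c + l))"
    define \<gamma> where "\<gamma> = rectpath (Complex a c) (Complex (a + l) (c + l))"
    define T where "T = box (Complex a c) (Complex (a + l) (c + l))"
    have QU: "Q \<subseteq> U"
    proof
      fix z assume "z \<in> Q"
      then have "\<bar>Re (z - z0)\<bar> + \<bar>Im (z - z0)\<bar> \<le> h + h"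
        by (intro add_mono) (auto simp: Q_def in_cbox_complex_iff a_def c_def l_def abs_le_iff)
      then have "z \<in> cball z0 r"
        using cmod_le[of "z - z0"] by (simp add: h_def dist_norm norm_minus_commute)
      then show "z \<in> U" using r by blast
    qed
    have T: "open T" "z0 \<in> T" "T \<subseteq> Q" "T \<inter> path_image \<gamma> = {}"
      using h l path_image_rectpath_inter_box[of "Complex a c" "Complex (a + l) (c + l)"]
      by (auto simp: T_def Q_def \<gamma>_def in_box_complex_iff in_cbox_complex_iff a_def c_def l_def)
    have imQ: "path_image \<gamma> \<subseteq> Q"
      using path_image_rectpath_subset_cbox l by (auto simp: Q_def \<gamma>_def)
    have FQ: "continuous_on Q F" using F QU continuous_on_subset by blast
    have Fim: "continuous_on (path_image \<gamma>) F" using FQ imQ continuous_on_subset by blast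
    define G where "G w = contour_integral \<gamma> (\<lambda>u. F u / (u - w)) / (2 * pi * \<i>)" for w
    have Ghol: "G holomorphic_on T"
      unfolding G_def using T(4) Fim
      by (intro holomorphic_intros holomorphic_on_subset[OF Cauchy_transform_rectpath_holomorphic[of "Complex a c" "Complex (a + l) (c + l)" F, folded \<gamma>_def]]) auto
    have off: "F w = G w" if w: "w \<in> T - E" for w
    proof -
      define H where "H u = (if u = w then deriv F w else (F u - F w) / (u - w))" for u
      have wU: "w \<in> U - E" using w T QU by blast
      have Hhol: "H holomorphic_on (U - E)"
        unfolding H_def using pole_lemma_open[of F "U - E" w] hol oUE by (simp add: E_def)
      have "continuous_on (U - {w}) (\<lambda>u. (F u - F w) / (u - w))"
        using F by (intro continuous_intros) (auto intro: continuous_on_subset)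
      then have "continuous_on (U - {w}) H"
        by (rule continuous_on_eq) (auto simp: H_def)
      \<comment> \<open>Near \<open>w\<close> continuity comes from holomorphy, \<open>w\<close>
        being off the curve, and elsewhere from the quotient itself; the two open sets cover the
        square.\<close>
      then have "continuous_on ((U - E) \<union> (U - {w})) H"
        using holomorphic_on_imp_continuous_on[OF Hhol] oUE U by (intro continuous_on_open_Un) auto
      then have Hc: "continuous_on Q H"
        by (rule continuous_on_subset) (use QU wU in blast)
      have "rect_int H a (a + l) c (c + l) = 0"
        using Hc Hhol QU unfolding Q_def
        by (intro rect_int_eq_0_lipschitz_image[OF l _ _ g]) (auto simp: E_def intro: holomorphic_on_subset)
      then have "contour_integral \<gamma> H = 0"
        unfolding \<gamma>_def using contour_integral_rectpath_eq_rect_int[of a "a+l" c "c+l" H] Hc l by (simp add: Q_def)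
      moreover have "H contour_integrable_on \<gamma>"
        using Hc imQ unfolding \<gamma>_def by (intro contour_integrable_continuous_rectpath) (auto intro: continuous_on_subset)
      ultimately have "(H has_contour_integral 0) \<gamma>" using has_contour_integral_integral by metis
      moreover have win: "winding_number \<gamma> w = 1"
        using w unfolding \<gamma>_def T_def by (intro winding_number_rectpath) auto
      have wim: "w \<notin> path_image \<gamma>" using w T by blast
      have "((\<lambda>u. F w * (1 / (u - w))) has_contour_integral F w * (2 * pi * \<i>)) \<gamma>"
        using has_contour_integral_lmul[OF has_contour_integral_winding_number[of \<gamma> w], of "F w"] wim
        unfolding win by (simp add: \<gamma>_def)
      ultimately have "((\<lambda>u. H u + F w * (1 / (u - w))) has_contour_integral 0 + F w * (2 * pi * \<i>)) \<gamma>"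
        by (rule has_contour_integral_add)
      then have "((\<lambda>u. F u / (u - w)) has_contour_integral 0 + F w * (2 * pi * \<i>)) \<gamma>"
        by (rule has_contour_integral_eq) (use wim in \<open>auto simp: H_def divide_simps\<close>)
      then show ?thesis unfolding G_def by (simp add: contour_integral_unique)
    qed
    have "F w = G w" if "w \<in> T" for w
    proof (rule continuous_eq_off_nowhere_dense[of T F G E w])
      show "continuous_on T F" using FQ T(3) continuous_on_subset by blast
      show "continuous_on T G" using Ghol by (rule holomorphic_on_imp_continuous_on)
    qed (use T intE that off in auto)
    then have "F holomorphic_on T" using Ghol holomorphic_transform by metis
    then show ?thesis using T by blast
  qed
  then have "F field_differentiable at z" if "z \<in> U" for z
    using that holomorphic_on_imp_differentiable_at by blast
  then show ?thesis by (simp add: holomorphic_on_def field_differentiable_at_within)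
qed

subsection \<open>One-sided boundary values\<close>

lemma arc_derivative:
  assumes "\<gamma> C1_differentiable_on {0<..<1}" "s \<in> {0<..<1::real}"
  shows "(\<gamma> has_vector_derivative vector_derivative \<gamma> (at s)) (at s)"
    and "isCont \<gamma> s" and "isCont (\<lambda>\<sigma>. vector_derivative \<gamma> (at \<sigma>)) s"
proof -
  have *: "\<gamma> differentiable (at s)" "continuous_on {0<..<1} (\<lambda>x. vector_derivative \<gamma> (at x))"
    using assms unfolding C1_differentiable_on_eq by auto
  show "(\<gamma> has_vector_derivative vector_derivative \<gamma> (at s)) (at s)"
    using * vector_derivative_works by blast
  show "isCont \<gamma> s" using * differentiable_imp_continuous_within by blast
  show "isCont (\<lambda>\<sigma>. vector_derivative \<gamma> (at \<sigma>)) s"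
    using * assms continuous_on_eq_continuous_at open_greaterThanLessThan by blast
qed

abbreviation off_arc :: "(real \<Rightarrow> complex) \<Rightarrow> real \<times> real \<Rightarrow> complex" where
  "off_arc \<gamma> \<equiv> \<lambda>(\<sigma>, \<epsilon>). \<gamma> \<sigma> + of_real \<epsilon> * \<i> * vector_derivative \<gamma> (at \<sigma>)"

lemma has_left_value_off_arc:
  "has_left_value F \<gamma> s v \<longleftrightarrow> ((\<lambda>p. F (off_arc \<gamma> p)) \<longlongrightarrow> v) (nhds s \<times>\<^sub>F at_right 0)"
  by (simp add: has_left_value_def case_prod_unfold)

lemma has_right_value_off_arc:
  "has_right_value F \<gamma> s v \<longleftrightarrow> ((\<lambda>p. F (off_arc \<gamma> p)) \<longlongrightarrow> v) (nhds s \<times>\<^sub>F at_left 0)"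
  by (simp add: has_right_value_def case_prod_unfold)

lemma off_arc_tendsto:
  assumes "\<gamma> C1_differentiable_on {0<..<1}" "s \<in> {0<..<1::real}" and G: "G \<le> nhds 0"
  shows "(off_arc \<gamma> \<longlongrightarrow> \<gamma> s) (nhds s \<times>\<^sub>F G)"
proof -
  have f: "filterlim fst (nhds s) (nhds s \<times>\<^sub>F G)" by (rule filterlim_fst)
  have "filterlim snd G (nhds s \<times>\<^sub>F G)" by (rule filterlim_snd)
  then have g: "(snd \<longlongrightarrow> (0::real)) (nhds s \<times>\<^sub>F G)" using G filterlim_mono by blast
  have "((\<lambda>p. \<gamma> (fst p)) \<longlongrightarrow> \<gamma> s) (nhds s \<times>\<^sub>F G)"
    using isCont_tendsto_compose[OF arc_derivative(2)[OF assms(1,2)] f] .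
  moreover have "((\<lambda>p. vector_derivative \<gamma> (at (fst p))) \<longlongrightarrow> vector_derivative \<gamma> (at s)) (nhds s \<times>\<^sub>F G)"
    using isCont_tendsto_compose[OF arc_derivative(3)[OF assms(1,2)] f] .
  ultimately have "((\<lambda>p. \<gamma> (fst p) + of_real (snd p) * \<i> * vector_derivative \<gamma> (at (fst p)))
      \<longlongrightarrow> \<gamma> s + of_real 0 * \<i> * vector_derivative \<gamma> (at s)) (nhds s \<times>\<^sub>F G)"
    using g by (intro tendsto_intros)
  then show ?thesis by (simp add: case_prod_unfold)
qed

lemma at_left_right_le_nhds: "at_right (0::real) \<le> nhds 0" "at_left (0::real) \<le> nhds 0"
  by (simp_all add: at_within_def)

lemma side_value_of_isCont:
  assumes "\<gamma> C1_differentiable_on {0<..<1}" "s \<in> {0<..<1::real}" "isCont F (\<gamma> s)"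
  shows "has_left_value F \<gamma> s (F (\<gamma> s))" "has_right_value F \<gamma> s (F (\<gamma> s))"
  unfolding has_left_value_off_arc has_right_value_off_arc
  by (rule isCont_tendsto_compose[OF assms(3) off_arc_tendsto[OF assms(1,2)]],
      rule at_left_right_le_nhds)+

lemma eventually_off_arc_in_open:
  assumes "\<gamma> C1_differentiable_on {0<..<1}" "s \<in> {0<..<1::real}" "open U" "\<gamma> s \<in> U"
  shows "eventually (\<lambda>p. off_arc \<gamma> p \<in> U) (nhds s \<times>\<^sub>F at_right 0)"
    "eventually (\<lambda>p. off_arc \<gamma> p \<in> U) (nhds s \<times>\<^sub>F at_left 0)"
  using topological_tendstoD[OF off_arc_tendsto[OF assms(1,2)] assms(3,4)] at_left_right_le_nhds by auto

lemma side_value_cong: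
  assumes "\<gamma> C1_differentiable_on {0<..<1}" "s \<in> {0<..<1::real}" "open U" "\<gamma> s \<in> U"
    and "\<And>z. z \<in> U \<Longrightarrow> F z = G z"
  shows "has_left_value F \<gamma> s v \<longleftrightarrow> has_left_value G \<gamma> s v"
    "has_right_value F \<gamma> s v \<longleftrightarrow> has_right_value G \<gamma> s v"
  unfolding has_left_value_off_arc has_right_value_off_arc
  by (rule tendsto_cong, rule eventually_mono[OF eventually_off_arc_in_open(1)[OF assms(1-4)]], simp add: assms(5))
    (rule tendsto_cong, rule eventually_mono[OF eventually_off_arc_in_open(2)[OF assms(1-4)]], simp add: assms(5))

lemma side_filters_nontrivial:
  "nhds s \<times>\<^sub>F at_right (0::real) \<noteq> bot" "nhds s \<times>\<^sub>F at_left (0::real) \<noteq> bot"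
  by (simp_all add: prod_filter_eq_bot)

lemma side_value_unique:
  fixes v :: "'a::t2_space"
  shows "has_left_value F \<gamma> s v \<Longrightarrow> has_left_value F \<gamma> s w \<Longrightarrow> v = w"
    "has_right_value F \<gamma> s v \<Longrightarrow> has_right_value F \<gamma> s w \<Longrightarrow> v = w"
  unfolding has_left_value_off_arc has_right_value_off_arc
  using tendsto_unique side_filters_nontrivial by blast+

lemma complex_perp_imp_multiple:
  fixes w d :: complex
  assumes "w \<bullet> d = 0" "d \<noteq> 0"
  obtains e :: real where "w = of_real e * \<i> * d"
proof
  have n: "(Re d)\<^sup>2 + (Im d)\<^sup>2 \<noteq> 0" using assms(2) by (simp add: complex_eq_iff sum_power2_eq_zero_iff)
  have z: "Re w * Re d = - Im w * Im d" using assms(1) by (simp add: inner_complex_def)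
  let ?e = "(Im w * Re d - Re w * Im d) / ((Re d)\<^sup>2 + (Im d)\<^sup>2)"
  have "Re w * ((Re d)\<^sup>2 + (Im d)\<^sup>2) = - (Im w * Re d - Re w * Im d) * Im d"
    using z by (simp add: power2_eq_square algebra_simps)
  moreover have "Im w * ((Re d)\<^sup>2 + (Im d)\<^sup>2) = (Im w * Re d - Re w * Im d) * Re d"
    using z by (simp add: power2_eq_square algebra_simps)
  ultimately show "w = of_real ?e * \<i> * d"
    using n by (simp add: complex_eq_iff field_simps)
qed

text \<open>A point near the arc and off it lies on the normal through its nearest point of the arc,
  so the two one-sided limits exhaust all approaches.\<close>

lemma tendsto_of_equal_side_values:
  fixes F :: "complex \<Rightarrow> 'a::topological_space"
  assumes arc: "arc \<gamma>" and C1: "\<gamma> C1_differentiable_on {0<..<1}" and s: "s \<in> {0<..<1}"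
    and nz: "vector_derivative \<gamma> (at s) \<noteq> 0"
    and l: "has_left_value F \<gamma> s v" and r: "has_right_value F \<gamma> s v"
  shows "(F \<longlongrightarrow> v) (at (\<gamma> s) within - path_image \<gamma>)"
proof (rule topological_tendstoI)
  fix V assume V: "open V" "v \<in> V"
  let ?d = "\<lambda>\<sigma>. vector_derivative \<gamma> (at \<sigma>)"
  have "eventually (\<lambda>p. F (off_arc \<gamma> p) \<in> V) (nhds s \<times>\<^sub>F at_right 0)"
    using topological_tendstoD[OF l[unfolded has_left_value_off_arc] V] .
  then obtain P1 Q1 where P1: "eventually P1 (nhds s)" and Q1: "eventually Q1 (at_right (0::real))"
    and 1: "\<And>x y. P1 x \<Longrightarrow> Q1 y \<Longrightarrow> F (off_arc \<gamma> (x, y)) \<in> V"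
    unfolding eventually_prod_filter by blast
  have "eventually (\<lambda>p. F (off_arc \<gamma> p) \<in> V) (nhds s \<times>\<^sub>F at_left 0)"
    using topological_tendstoD[OF r[unfolded has_right_value_off_arc] V] .
  then obtain P2 Q2 where P2: "eventually P2 (nhds s)" and Q2: "eventually Q2 (at_left (0::real))"
    and 2: "\<And>x y. P2 x \<Longrightarrow> Q2 y \<Longrightarrow> F (off_arc \<gamma> (x, y)) \<in> V"
    unfolding eventually_prod_filter by blast
  \<comment> \<open>Half the speed at \<open>s\<close> is a lower bound for the speed nearby; it
    turns the distance from the arc into a bound for the normal coordinate \<open>e\<close>.\<close>
  define c where "c = norm (?d s) / 2"
  have c: "c > 0" using nz by (simp add: c_def)
  have "((\<lambda>\<sigma>. norm (?d \<sigma>)) \<longlongrightarrow> norm (?d s)) (nhds s)"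
    by (intro tendsto_norm isCont_tendsto_compose[OF arc_derivative(3)[OF C1 s] filterlim_ident])
  then have "eventually (\<lambda>\<sigma>. norm (?d \<sigma>) > c) (nhds s)"
    using c by (intro order_tendstoD) (auto simp: c_def)
  moreover have "eventually (\<lambda>\<sigma>. \<sigma> \<in> {0<..<1}) (nhds s)"
    using s by (intro eventually_nhds_in_open) auto
  ultimately have "eventually (\<lambda>\<sigma>. P1 \<sigma> \<and> P2 \<sigma> \<and> norm (?d \<sigma>) > c \<and> \<sigma> \<in> {0<..<1}) (nhds s)"
    using P1 P2 by eventually_elim auto
  then obtain h1 where h1: "h1 > 0"
    and near: "\<And>\<sigma>. dist \<sigma> s < h1 \<Longrightarrow> P1 \<sigma> \<and> P2 \<sigma> \<and> norm (?d \<sigma>) > c \<and> \<sigma> \<in> {0<..<1}"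
    unfolding eventually_nhds_metric by blast
  obtain b1 where b1: "b1 > 0" "\<And>y. 0 < y \<Longrightarrow> y < b1 \<Longrightarrow> Q1 y"
    using Q1 by (auto simp: eventually_at_right_field)
  obtain b2 where b2: "b2 < 0" "\<And>y. b2 < y \<Longrightarrow> y < 0 \<Longrightarrow> Q2 y"
    using Q2 by (auto simp: eventually_at_left_field)
  define h where "h = min b1 (- b2)"
  have h: "h > 0" using b1 b2 by (simp add: h_def)
  have cont: "continuous_on {0..1} \<gamma>" and inj: "inj_on \<gamma> {0..1}"
    using arc by (auto simp: arc_def path_def)
  have "compact (\<gamma> ` ({0..1} - ball s h1))"
    by (intro compact_continuous_image compact_diff) (auto intro: continuous_on_subset[OF cont])
  moreover have "\<gamma> s \<notin> \<gamma> ` ({0..1} - ball s h1)"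
    using inj s h1 by (auto dest: inj_onD)
  ultimately obtain \<rho> where \<rho>: "\<rho> > 0" "\<And>\<sigma>. \<sigma> \<in> {0..1} - ball s h1 \<Longrightarrow> \<rho> \<le> dist (\<gamma> s) (\<gamma> \<sigma>)"
    using separate_point_closed[of "\<gamma> ` ({0..1} - ball s h1)" "\<gamma> s"] compact_imp_closed by blast
  \<comment> \<open>The first bound forces the nearest point of the arc to have a parameter within
    \<open>h1\<close> of \<open>s\<close>; the second makes its normal coordinate smaller than
    \<open>h\<close>.\<close>
  define R where "R = min (\<rho> / 2) (c * h)"
  have R: "R > 0" using \<rho> c h by (simp add: R_def)
  have "F z \<in> V" if z: "dist z (\<gamma> s) < R" "z \<notin> path_image \<gamma>" for z
  proof -
    obtain y where y: "y \<in> path_image \<gamma>" and min: "\<And>w. w \<in> path_image \<gamma> \<Longrightarrow> dist z y \<le> dist z w"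
      using distance_attains_inf[of "path_image \<gamma>" z] closed_arc_image[OF arc] by auto
    then obtain \<sigma> where \<sigma>: "\<sigma> \<in> {0..1}" "y = \<gamma> \<sigma>" by (auto simp: path_image_def)
    have "\<gamma> s \<in> path_image \<gamma>" using s by (auto simp: path_image_def)
    then have zs: "dist z (\<gamma> \<sigma>) \<le> dist z (\<gamma> s)" using min \<sigma> by blast
    then have "dist (\<gamma> s) (\<gamma> \<sigma>) < \<rho>"
      using z dist_triangle2[of "\<gamma> s" "\<gamma> \<sigma>" z] by (simp add: R_def dist_commute)
    then have "\<sigma> \<in> ball s h1" using \<rho>(2)[of \<sigma>] \<sigma> by (meson DiffI not_le)
    then have P: "P1 \<sigma>" "P2 \<sigma>" "norm (?d \<sigma>) > c" "\<sigma> \<in> {0<..<1}"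
      using near[of \<sigma>] by (auto simp: dist_commute)
    \<comment> \<open>The squared distance has an interior minimum at \<sigma>, so its derivative
      vanishes there and the connecting vector is perpendicular to the tangent.\<close>
    have "((\<lambda>\<tau>. (z - \<gamma> \<tau>) \<bullet> (z - \<gamma> \<tau>)) has_vector_derivative
        ((z - \<gamma> \<sigma>) \<bullet> (0 - ?d \<sigma>) + (0 - ?d \<sigma>) \<bullet> (z - \<gamma> \<sigma>))) (at \<sigma>)"
      by (rule bounded_bilinear.has_vector_derivative[OF bounded_bilinear_inner])
        (intro derivative_intros arc_derivative(1)[OF C1 P(4)])+
    then have "((\<lambda>\<tau>. (z - \<gamma> \<tau>) \<bullet> (z - \<gamma> \<tau>)) has_real_derivative (- 2 * ((z - \<gamma> \<sigma>) \<bullet> ?d \<sigma>))) (at \<sigma>)"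
      by (simp add: has_real_derivative_iff_has_vector_derivative inner_diff_right inner_diff_left inner_commute algebra_simps)
    moreover have "(z - \<gamma> \<sigma>) \<bullet> (z - \<gamma> \<sigma>) \<le> (z - \<gamma> \<tau>) \<bullet> (z - \<gamma> \<tau>)" if "\<bar>\<sigma> - \<tau>\<bar> < min \<sigma> (1 - \<sigma>)" for \<tau>
    proof -
      have "\<tau> \<in> {0..1}" using that by (auto simp: abs_less_iff)
      then have "\<gamma> \<tau> \<in> path_image \<gamma>" by (auto simp: path_image_def)
      then have "norm (z - \<gamma> \<sigma>) \<le> norm (z - \<gamma> \<tau>)" using min \<sigma> by (simp add: dist_norm)
      then show ?thesis by (simp add: dot_square_norm power_mono)
    qed
    ultimately have "- 2 * ((z - \<gamma> \<sigma>) \<bullet> ?d \<sigma>) = 0"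
      using P(4) by (intro DERIV_local_min[of _ _ \<sigma> "min \<sigma> (1 - \<sigma>)"]) auto
    moreover have "?d \<sigma> \<noteq> 0" using P(3) c by auto
    ultimately obtain e where e: "z - \<gamma> \<sigma> = of_real e * \<i> * ?d \<sigma>"
      using complex_perp_imp_multiple[of "z - \<gamma> \<sigma>" "?d \<sigma>"] by auto
    have "\<bar>e\<bar> * c \<le> \<bar>e\<bar> * norm (?d \<sigma>)" using P(3) by (intro mult_left_mono) auto
    also have "\<dots> = norm (z - \<gamma> \<sigma>)" by (simp add: e norm_mult)
    also have "\<dots> < h * c" using zs z by (simp add: R_def dist_norm mult.commute)
    finally have eh: "\<bar>e\<bar> < h" using c by simp
    have "e \<noteq> 0"
    proof
      assume "e = 0"
      then have "z = \<gamma> \<sigma>" using e by simp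
      then show False using z(2) \<sigma> y by simp
    qed
    then have "Q1 e \<or> Q2 e"
      using eh b1 b2 unfolding h_def by (smt (verit))
    then have "F (off_arc \<gamma> (\<sigma>, e)) \<in> V" using 1 2 P by blast
    moreover have "off_arc \<gamma> (\<sigma>, e) = z" using e by (simp add: algebra_simps)
    ultimately show ?thesis by simp
  qed
  then show "eventually (\<lambda>z. F z \<in> V) (at (\<gamma> s) within - path_image \<gamma>)"
    unfolding eventually_at using R by blast
qed

section \<open>Continuous and holomorphic extension across closed nowhere dense sets\<close>

lemma at_within_Compl_nontrivial:
  fixes z :: "'a::{perfect_space,t1_space}"
  assumes "interior E = {}"
  shows "at z within - E \<noteq> bot"
proof -
  have "\<exists>y\<in>- E. y \<in> T \<and> y \<noteq> z" if T: "z \<in> T" "open T" for T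
  proof (rule ccontr)
    assume "\<not> ?thesis"
    then have "T - {z} \<subseteq> E" by auto
    then have "T - {z} \<subseteq> interior E" using T by (intro interior_maximal) auto
    then have "T = {z}" using assms T by auto
    then show False using T not_open_singleton by metis
  qed
  then have "z islimpt - E" by (auto simp: islimpt_def)
  then show ?thesis by (simp add: trivial_limit_within)
qed

text \<open>Limits at the single points suffice: each value of \<open>G\<close> near
  \<open>z\<close> is itself a limit of values of \<open>F\<close> near \<open>z\<close>, so the
  closed estimate \<open>e / 2\<close> passes to it.\<close>

lemma continuous_extension_nowhere_dense:
  fixes F :: "complex \<Rightarrow> complex"
  assumes U: "open U" and E: "closed E" "interior E = {}" and F: "continuous_on (U - E) F"
    and lim: "\<And>z. z \<in> U \<inter> E \<Longrightarrow> \<exists>v. (F \<longlongrightarrow> v) (at z within - E)"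
  obtains G where "continuous_on U G" "\<And>z. z \<notin> E \<Longrightarrow> G z = F z"
proof
  define G where "G z = (if z \<in> E then Lim (at z within - E) F else F z)" for z
  note nt = at_within_Compl_nontrivial[OF E(2)]
  have oUE: "open (U - E)" using U E by blast
  have FG: "(F \<longlongrightarrow> G z) (at z within - E)" if z: "z \<in> U" for z
  proof (cases "z \<in> E")
    case True
    then obtain v where "(F \<longlongrightarrow> v) (at z within - E)" using lim z by blast
    then show ?thesis using tendsto_Lim[OF nt, of F v z] True by (simp add: G_def)
  next
    case False
    then have "isCont F z" using F oUE z continuous_on_eq_continuous_at by blast
    then have "(F \<longlongrightarrow> F z) (at z)" by (simp add: isCont_def)
    then show ?thesis using False Lim_at_imp_Lim_at_within by (simp add: G_def)
  qed
  show "continuous_on U G"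
  proof (rule continuous_at_imp_continuous_on, rule ballI)
    fix z assume z: "z \<in> U"
    have "\<exists>d>0. \<forall>w. dist w z < d \<longrightarrow> dist (G w) (G z) < e" if e: "e > 0" for e
    proof -
      have "eventually (\<lambda>w. dist (F w) (G z) < e / 2) (at z within - E)"
        using tendstoD[OF FG[OF z], of "e / 2"] e by simp
      then obtain d1 where d1: "d1 > 0" "\<And>w. w \<notin> E \<Longrightarrow> w \<noteq> z \<Longrightarrow> dist w z < d1 \<Longrightarrow> dist (F w) (G z) < e / 2"
        unfolding eventually_at by blast
      have d1': "dist (F w) (G z) < e / 2" if "w \<notin> E" "dist w z < d1" for w
        using d1(2)[of w] that e by (cases "w = z") (auto simp: G_def)
      obtain d2 where d2: "d2 > 0" "ball z d2 \<subseteq> U" using U z open_contains_ball by blast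
      have "dist (G w) (G z) < e" if w: "dist w z < min d1 d2" for w
      proof -
        have wU: "w \<in> U" using w d2 by (auto simp: dist_commute)
        have "open (ball z d1)" "w \<in> ball z d1" using w by (auto simp: dist_commute)
        then have "eventually (\<lambda>u. u \<in> ball z d1) (at w within - E)"
          using eventually_at_topological by blast
        moreover have "eventually (\<lambda>u. u \<in> - E) (at w within - E)"
          by (simp add: eventually_at_filter)
        ultimately have "eventually (\<lambda>u. dist (G z) (F u) \<le> e / 2) (at w within - E)"
          by eventually_elim (use d1' in \<open>auto simp: dist_commute less_imp_le\<close>)
        then have "dist (G z) (G w) \<le> e / 2" using Lim_dist_ubound[OF nt FG[OF wU]] by blast
        then show ?thesis using e by (simp add: dist_commute)
      qed
      then show ?thesis using d1 d2 by (metis min_less_iff_conj)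
    qed
    then show "isCont G z" unfolding continuous_at_eps_delta by simp
  qed
  show "G z = F z" if "z \<notin> E" for z using that by (simp add: G_def)
qed

text \<open>Local extensions across a closed nowhere dense set agree on overlaps, hence glue.\<close>

lemma holomorphic_extension_glue:
  fixes F :: "complex \<Rightarrow> complex"
  assumes X: "open X" and E: "closed E" "interior E = {}" and F: "F holomorphic_on (X - E)"
    and loc: "\<And>z. z \<in> X \<inter> E \<Longrightarrow>
      \<exists>U G. open U \<and> z \<in> U \<and> G holomorphic_on U \<and> (\<forall>w\<in>U - E. G w = F w)"
  obtains G where "G holomorphic_on X" "\<And>z. z \<notin> E \<Longrightarrow> G z = F z"
proof -
  have "\<exists>v. (F \<longlongrightarrow> v) (at z within - E)" if z: "z \<in> X \<inter> E" for z
  proof -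
    obtain U G where U: "open U" "z \<in> U" "G holomorphic_on U" "\<forall>w\<in>U - E. G w = F w"
      using loc[OF z] by blast
    have "(G \<longlongrightarrow> G z) (at z)"
      using U holomorphic_on_imp_continuous_on continuous_on_eq_continuous_at isCont_def by blast
    then have "(G \<longlongrightarrow> G z) (at z within - E)" using tendsto_within_subset by blast
    moreover have "eventually (\<lambda>w. G w = F w) (at z within - E)"
      using U by (auto simp: eventually_at_topological)
    ultimately have "(F \<longlongrightarrow> G z) (at z within - E)"
      by (rule Lim_transform_eventually)
    then show ?thesis by blast
  qed
  then obtain G where G: "continuous_on X G" "\<And>z. z \<notin> E \<Longrightarrow> G z = F z"
    using continuous_extension_nowhere_dense[OF X E holomorphic_on_imp_continuous_on[OF F]] by metis
  have "G field_differentiable at z" if z: "z \<in> X" for z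
  proof (cases "z \<in> E")
    case True
    then obtain U H where U: "open U" "z \<in> U" "H holomorphic_on U" "\<forall>w\<in>U - E. H w = F w"
      using loc[of z] z by blast
    have "H w = G w" if "w \<in> U \<inter> X" for w
      using U X G E that
      by (intro continuous_eq_off_nowhere_dense[of "U \<inter> X" H G E w])
        (auto intro: continuous_on_subset holomorphic_on_imp_continuous_on)
    then have "G holomorphic_on (U \<inter> X)"
      using U(3) by (metis Int_lower1 holomorphic_on_subset holomorphic_transform)
    then show ?thesis using U X z holomorphic_on_imp_differentiable_at[of G "U \<inter> X" z] by blast
  next
    case False
    have "G holomorphic_on (X - E)" using F by (rule holomorphic_transform) (simp add: G)
    then show ?thesis using holomorphic_on_imp_differentiable_at[of G "X - E" z] X E z False by blast
  qed
  then have "G holomorphic_on X" by (simp add: holomorphic_on_def field_differentiable_at_within)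
  then show ?thesis using that G by blast
qed

subsection \<open>Extension across arcs without jump\<close>

text \<open>The derivative is not controlled at the ends of the open interval, hence the restriction
  to a compact subinterval.\<close>

lemma C1_lipschitz_on:
  fixes \<gamma> :: "real \<Rightarrow> complex"
  assumes "\<gamma> C1_differentiable_on {0<..<1}" "{a..b} \<subseteq> {0<..<1}"
  obtains L where "L-lipschitz_on {a..b} \<gamma>"
proof -
  have "continuous_on {0<..<1} (\<lambda>x. vector_derivative \<gamma> (at x))"
    using assms(1) unfolding C1_differentiable_on_eq by auto
  then have "compact ((\<lambda>x. vector_derivative \<gamma> (at x)) ` {a..b})"
    using assms(2) by (intro compact_continuous_image) (auto intro: continuous_on_subset)
  then have "bounded ((\<lambda>x. vector_derivative \<gamma> (at x)) ` {a..b})" by (rule compact_imp_bounded)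
  then obtain B where B: "B > 0" "\<And>x. x \<in> {a..b} \<Longrightarrow> norm (vector_derivative \<gamma> (at x)) \<le> B"
    by (auto simp: bounded_pos)
  have "B-lipschitz_on {a..b} \<gamma>"
  proof (rule bounded_derivative_imp_lipschitz)
    show "(\<gamma> has_derivative (\<lambda>h. h *\<^sub>R vector_derivative \<gamma> (at x))) (at x within {a..b})" if "x \<in> {a..b}" for x
      using arc_derivative(1)[OF assms(1), of x] that assms(2)
      unfolding has_vector_derivative_def by (blast intro: has_derivative_at_withinI)
    show "onorm (\<lambda>h. h *\<^sub>R vector_derivative \<gamma> (at x)) \<le> B" if "x \<in> {a..b}" for x
      using B(2)[OF that] by (intro onorm_bound) (auto simp: mult.commute[of _ "\<bar>_\<bar>"] B(1) less_imp_le mult_left_mono)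
  qed (use B in auto)
  then show thesis by (rule that)
qed

lemma arc_systemD:
  assumes "arc_system \<Gamma>" "\<gamma> \<in> \<Gamma>"
  shows "arc \<gamma>" "\<gamma> C1_differentiable_on {0<..<1}" "s \<in> {0<..<1} \<Longrightarrow> vector_derivative \<gamma> (at s) \<noteq> 0"
  using assms by (auto simp: arc_system_def)

lemma arc_system_meet:
  assumes "arc_system \<Gamma>" "\<gamma> \<in> \<Gamma>" "\<delta> \<in> \<Gamma>" "s \<in> {0<..<1}" "r \<in> {0..1}" "\<gamma> s = \<delta> r"
  shows "\<delta> = \<gamma>" "r = s"
proof -
  show 1: "\<delta> = \<gamma>"
  proof (rule ccontr)
    assume "\<delta> \<noteq> \<gamma>"
    then have "\<forall>s\<in>{0..1}. \<forall>r\<in>{0..1}. \<gamma> s = \<delta> r \<longrightarrow> s \<in> {0, 1} \<and> r \<in> {0, 1}"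
      using assms(1-3) unfolding arc_system_def by (blast dest: not_sym)
    moreover have "s \<in> {0..1}" using assms(4) by auto
    ultimately have "s \<in> {0, 1}" using assms(5,6) by blast
    then show False using assms by auto
  qed
  then show "r = s" using arc_systemD(1)[OF assms(1,2)] assms by (auto simp: arc_def dest: inj_onD)
qed

lemma compact_support: "arc_system \<Gamma> \<Longrightarrow> compact (support \<Gamma>)"
  unfolding support_def arc_system_def by (intro compact_UN) (auto simp: compact_arc_image)

lemma closed_support: "arc_system \<Gamma> \<Longrightarrow> closed (support \<Gamma>)"
  by (simp add: compact_support compact_imp_closed)

text \<open>An open arc is a differentiable image of a one-dimensional set and hence null; the two
  end points, where no derivative is given, are added separately.\<close>

lemma interior_support:
  assumes "arc_system \<Gamma>"
  shows "interior (support \<Gamma>) = {}"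
proof -
  have "negligible (path_image \<gamma>)" if "\<gamma> \<in> \<Gamma>" for \<gamma>
  proof -
    have "negligible (\<gamma> ` {0<..<1})"
      using arc_systemD(2)[OF assms that]
      by (intro negligible_differentiable_image_lowdim)
        (auto simp: C1_differentiable_on_eq differentiable_on_def differentiable_at_withinI)
    then have "negligible (\<gamma> ` {0<..<1} \<union> \<gamma> ` {0, 1})" by (simp add: negligible_Un_eq)
    then show ?thesis 
    proof (rule negligible_subset, intro subsetI)
      fix z assume "z \<in> path_image \<gamma>"
      then obtain r where "r \<in> {0..1}" "z = \<gamma> r" by (auto simp: path_image_def)
      then show "z \<in> \<gamma> ` {0<..<1} \<union> \<gamma> ` {0, 1}" by (cases "r = 0 \<or> r = 1") auto
    qed
  qed
  then have "negligible (support \<Gamma>)"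
    using assms unfolding support_def arc_system_def by (intro negligible_Union) auto
  then show ?thesis by (rule negligible_imp_interior_empty)
qed

text \<open>Near an interior point the contour is part of a compact subarc, on which \<gamma> is
  Lipschitz. Equal boundary values extend \<open>F\<close> continuously over it, and the
  removability of Lipschitz curves does the rest.\<close>

lemma arc_removable_at_interior_point:
  assumes \<Gamma>: "arc_system \<Gamma>" and \<gamma>: "\<gamma> \<in> \<Gamma>" and D: "open D" and s: "s \<in> {0<..<1}" and sD: "\<gamma> s \<in> D"
    and F: "F holomorphic_on (D - support \<Gamma>)"
    and sides: "\<And>\<sigma>. \<sigma> \<in> {0<..<1} \<Longrightarrow> \<exists>v::complex. has_left_value F \<gamma> \<sigma> v \<and> has_right_value F \<gamma> \<sigma> v"
  shows "\<exists>U G. open U \<and> \<gamma> s \<in> U \<and> G holomorphic_on U \<and> (\<forall>z\<in>U - support \<Gamma>. G z = F z)"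
proof -
  note A = arc_systemD[OF \<Gamma> \<gamma>]
  note clS = closed_support[OF \<Gamma>]
  have cont: "continuous_on {0..1} \<gamma>" using A(1) by (auto simp: arc_def path_def)
  define d where "d = min s (1 - s) / 2"
  have d: "d > 0" "{s - d..s + d} \<subseteq> {0<..<1}" using s by (auto simp: d_def min_def field_simps split: if_splits)
  \<comment> \<open>All of the contour outside the parameter window around \<open>s\<close>. It
    misses the point in question because an arc is injective and different arcs meet only at end
    points.\<close>
  define K where "K = \<gamma> ` ({0..1} - {s - d<..<s + d}) \<union> support (\<Gamma> - {\<gamma>})"
  have "closed (support (\<Gamma> - {\<gamma>}))"
    unfolding support_def using \<Gamma> by (intro closed_UN) (auto simp: arc_system_def closed_arc_image)
  moreover have "closed (\<gamma> ` ({0..1} - {s - d<..<s + d}))"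
    by (intro compact_imp_closed compact_continuous_image compact_diff)
      (auto intro: continuous_on_subset[OF cont])
  ultimately have clK: "closed K" unfolding K_def by blast
  have "\<gamma> s \<notin> K"
  proof
    assume "\<gamma> s \<in> K"
    then consider r where "r \<in> {0..1}" "r \<notin> {s - d<..<s + d}" "\<gamma> s = \<gamma> r"
      | \<delta> r where "\<delta> \<in> \<Gamma>" "\<delta> \<noteq> \<gamma>" "r \<in> {0..1}" "\<gamma> s = \<delta> r"
      unfolding K_def support_def path_image_def by blast
    then show False
    proof cases
      case 1
      then show False using arc_system_meet(2)[OF \<Gamma> \<gamma> \<gamma> s] d(1) by force
    next
      case 2
      then show False using arc_system_meet(1)[OF \<Gamma> \<gamma> _ s] by blast
    qed
  qed
  define U where "U = D - K"
  have U: "open U" "\<gamma> s \<in> U" using D clK sD \<open>\<gamma> s \<notin> K\<close> by (auto simp: U_def)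
  have US: "U \<inter> support \<Gamma> \<subseteq> \<gamma> ` {s - d..s + d}"
  proof
    fix z assume z: "z \<in> U \<inter> support \<Gamma>"
    then have "z \<in> path_image \<gamma>" by (auto simp: U_def K_def support_def)
    then obtain \<sigma> where "\<sigma> \<in> {0..1}" "z = \<gamma> \<sigma>" by (auto simp: path_image_def)
    moreover from this have "\<sigma> \<in> {s - d<..<s + d}" using z by (auto simp: U_def K_def)
    ultimately show "z \<in> \<gamma> ` {s - d..s + d}" by auto
  qed
  have lim: "\<exists>v. (F \<longlongrightarrow> v) (at z within - support \<Gamma>)" if z: "z \<in> U \<inter> support \<Gamma>" for z
  proof -
    obtain \<sigma> where \<sigma>: "z = \<gamma> \<sigma>" "\<sigma> \<in> {0<..<1}" using US z d(2) by blast
    obtain v where "has_left_value F \<gamma> \<sigma> v" "has_right_value F \<gamma> \<sigma> v" using sides \<sigma> by blast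
    then have "(F \<longlongrightarrow> v) (at z within - path_image \<gamma>)"
      unfolding \<sigma>(1) using tendsto_of_equal_side_values[OF A(1,2) \<sigma>(2) A(3)] \<sigma>(2) by blast
    then show ?thesis using \<gamma> by (intro exI) (rule tendsto_within_subset, auto simp: support_def)
  qed
  have FU: "F holomorphic_on (U - support \<Gamma>)" using F by (rule holomorphic_on_subset) (auto simp: U_def)
  obtain G where G: "continuous_on U G" "\<And>z. z \<notin> support \<Gamma> \<Longrightarrow> G z = F z"
    using continuous_extension_nowhere_dense[OF U(1) clS interior_support[OF \<Gamma>]
        holomorphic_on_imp_continuous_on[OF FU] lim] by metis
  obtain L where L: "L-lipschitz_on {s - d..s + d} \<gamma>" using C1_lipschitz_on[OF A(2) d(2)] .
  \<comment> \<open>The subarc rescaled to the unit interval, the form in which removability is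
    stated.\<close>
  define g where "g = \<gamma> \<circ> (\<lambda>u. s - d + 2 * d * u)"
  have lin: "(\<lambda>u. s - d + 2 * d * u) ` {0..1} = {s - d..s + d}"
    using image_affinity_atLeastAtMost[of "2*d" "s - d" 0 1] d(1) by (simp add: algebra_simps)
  have "(2 * d)-lipschitz_on {0..1} (\<lambda>u. s - d + 2 * d * u)"
    using d(1) by (intro lipschitz_onI) (auto simp: dist_real_def abs_mult simp flip: right_diff_distrib)
  then have "(L * (2 * d))-lipschitz_on {0..1} g"
    unfolding g_def using L by (intro lipschitz_on_compose) (auto simp: lin)
  moreover have "G holomorphic_on (U - g ` {0..1})"
  proof -
    have "g ` {0..1} = \<gamma> ` {s - d..s + d}" unfolding g_def image_comp[symmetric] lin ..
    moreover have "G holomorphic_on (U - support \<Gamma>)"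
      using FU by (rule holomorphic_transform) (simp add: G)
    ultimately show ?thesis using US by (auto intro: holomorphic_on_subset)
  qed
  ultimately have "G holomorphic_on U"
    using holomorphic_on_lipschitz_image_removable[OF U(1) G(1)] by blast
  then show ?thesis using U G by (intro exI[of _ U] exI[of _ G]) auto
qed

text \<open>Across the open arcs the extension is local. The finitely many end points are then
  isolated singularities of the extended function, and growth \<open>o(1/(z-a))\<close> makes them
  removable.\<close>

lemma holomorphic_extension_no_jump:
  assumes \<Gamma>: "arc_system \<Gamma>" and D: "open D" "support \<Gamma> \<subseteq> D"
    and F: "F holomorphic_on (D - support \<Gamma>)"
    and sides: "\<And>\<gamma> s. \<gamma> \<in> \<Gamma> \<Longrightarrow> s \<in> {0<..<1} \<Longrightarrow>
                  \<exists>v::complex. has_left_value F \<gamma> s v \<and> has_right_value F \<gamma> s v"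
    and ends: "\<And>\<gamma> a. \<gamma> \<in> \<Gamma> \<Longrightarrow> a \<in> {\<gamma> 0, \<gamma> 1} \<Longrightarrow> F \<in> o[at a within - support \<Gamma>](\<lambda>z. 1 / (z - a))"
  shows "\<exists>G. G holomorphic_on D \<and> (\<forall>z. z \<notin> support \<Gamma> \<longrightarrow> G z = F z)"
proof -
  let ?E = "support \<Gamma>"
  note E = closed_support[OF \<Gamma>] interior_support[OF \<Gamma>]
  define P where "P = (\<Union>\<gamma>\<in>\<Gamma>. {\<gamma> 0, \<gamma> 1})"
  have finP: "finite P" using \<Gamma> by (auto simp: P_def arc_system_def)
  have PE: "P \<subseteq> ?E" by (force simp: P_def support_def path_image_def)
  define X where "X = D - P"
  have X: "open X" using D finP by (simp add: X_def open_Diff finite_imp_closed)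
  have FX: "F holomorphic_on (X - ?E)" using F by (rule holomorphic_on_subset) (auto simp: X_def)
  have int: "\<exists>U G. open U \<and> z \<in> U \<and> G holomorphic_on U \<and> (\<forall>w\<in>U - ?E. G w = F w)" if z: "z \<in> X \<inter> ?E" for z
  proof -
    obtain \<gamma> s where \<gamma>: "\<gamma> \<in> \<Gamma>" "s \<in> {0..1}" "z = \<gamma> s" using z by (auto simp: support_def path_image_def)
    then have s: "s \<in> {0<..<1}" using z by (cases "s = 0 \<or> s = 1") (auto simp: X_def P_def)
    show ?thesis
      using arc_removable_at_interior_point[OF \<Gamma> \<gamma>(1) D(1) s _ F sides[OF \<gamma>(1)]] z \<gamma> by (auto simp: X_def)
  qed
  obtain G0 where G0: "G0 holomorphic_on X" "\<And>z. z \<notin> ?E \<Longrightarrow> G0 z = F z"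
    using holomorphic_extension_glue[OF X E FX int] by blast
  have "\<exists>U G. open U \<and> a \<in> U \<and> G holomorphic_on U \<and> (\<forall>w\<in>U - ?E. G w = F w)" if a: "a \<in> P" for a
  proof -
    have "open (D - (P - {a}))" using D finP by (simp add: open_Diff finite_imp_closed)
    moreover have "a \<in> D - (P - {a})" using a PE D by auto
    ultimately obtain r where r: "r > 0" "ball a r \<subseteq> D - (P - {a})" using open_contains_ball by blast
    let ?B = "ball a r"
    have G0B: "G0 holomorphic_on (?B - {a})"
      using G0(1) by (rule holomorphic_on_subset) (use r in \<open>auto simp: X_def\<close>)
    \<comment> \<open>The growth condition speaks of points off the contour only, while
      \<open>G0\<close> also has values on the open arcs. There the bound follows by continuity: the
      set where it fails is open and would be contained in the contour.\<close>
    have "((\<lambda>z. (z - a) * G0 z) \<longlongrightarrow> 0) (at a)"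
    proof (rule tendstoI)
      fix e :: real assume e: "e > 0"
      have "F \<in> o[at a within - ?E](\<lambda>z. 1 / (z - a))" using ends a by (auto simp: P_def)
      then have "eventually (\<lambda>z. norm (F z) \<le> e / 2 * norm (1 / (z - a))) (at a within - ?E)"
        using e by (intro landau_o.smallD) auto
      then obtain d where d: "d > 0" "\<And>z. z \<notin> ?E \<Longrightarrow> z \<noteq> a \<Longrightarrow> dist z a < d \<Longrightarrow>
          norm (F z) \<le> e / 2 * norm (1 / (z - a))"
        unfolding eventually_at by blast
      define V where "V = ball a (min d r) - {a}"
      have V: "open V" by (auto simp: V_def)
      have cV: "continuous_on V (\<lambda>z. (z - a) * G0 z)"
        using holomorphic_on_imp_continuous_on[OF G0B]
        by (intro continuous_intros) (auto simp: V_def intro: continuous_on_subset)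
      have "norm ((z - a) * G0 z) \<le> e / 2" if z: "z \<in> V" for z
      proof (rule ccontr)
        assume n: "\<not> norm ((z - a) * G0 z) \<le> e / 2"
        let ?W = "V \<inter> (\<lambda>z. (z - a) * G0 z) -` (- cball 0 (e / 2))"
        have "open ?W" using cV V by (intro continuous_open_preimage) auto
        moreover have "?W \<subseteq> ?E"
        proof
          fix w assume w: "w \<in> ?W"
          show "w \<in> ?E"
          proof (rule ccontr)
            assume "w \<notin> ?E"
            then have "norm (G0 w) \<le> e / 2 * norm (1 / (w - a))"
              using d(2)[of w] w G0(2)[of w] by (auto simp: V_def dist_commute)
            then have "norm (w - a) * norm (G0 w) \<le> e / 2"
              using w by (simp add: norm_divide V_def field_simps)
            then show False using w by (simp add: norm_mult)
          qed
        qed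
        ultimately have "?W \<subseteq> interior ?E" by (rule interior_maximal[rotated])
        then show False using E(2) z n by auto
      qed
      then have "\<forall>z. z \<noteq> a \<and> dist z a < min d r \<longrightarrow> dist ((z - a) * G0 z) 0 < e"
        using e by (fastforce simp: V_def dist_commute)
      then show "eventually (\<lambda>z. dist ((z - a) * G0 z) 0 < e) (at a)"
        unfolding eventually_at using d r by (intro exI[of _ "min d r"]) auto
    qed
    then obtain g where g: "g holomorphic_on ?B" "\<forall>z\<in>?B - {a}. g z = G0 z"
      using holomorphic_on_extend_lim[OF G0B, of] r by auto
    have "g w = F w" if "w \<in> ?B - ?E" for w
    proof -
      have "w \<noteq> a" using that a PE by blast
      then show ?thesis using that g(2) G0(2)[of w] by simp
    qed
    then show ?thesis using g r by (intro exI[of _ ?B] exI[of _ g]) auto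
  qed
  then have "\<exists>U G. open U \<and> z \<in> U \<and> G holomorphic_on U \<and> (\<forall>w\<in>U - ?E. G w = F w)" if "z \<in> D \<inter> ?E" for z
    using int[of z] that by (cases "z \<in> P") (auto simp: X_def)
  then show ?thesis using holomorphic_extension_glue[OF D(1) E F] by blast
qed

subsection \<open>Uniqueness for the Riemann--Hilbert problem\<close>

lemma side_values_mat:
  fixes m :: "complex \<Rightarrow> cmat2"
  shows "has_left_value m \<gamma> s v \<longleftrightarrow> (\<forall>i j. has_left_value (\<lambda>z. m z $ i $ j) \<gamma> s (v $ i $ j))"
    and "has_right_value m \<gamma> s v \<longleftrightarrow> (\<forall>i j. has_right_value (\<lambda>z. m z $ i $ j) \<gamma> s (v $ i $ j))"
  unfolding has_left_value_off_arc has_right_value_off_arc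
  by (auto intro: tendsto_vec_nth vec_tendstoI)

lemma mat2_mult_nth:
  fixes A B :: cmat2 and c c' i j :: 2
  assumes "c \<noteq> c'"
  shows "(A ** B) $ i $ j = A $ i $ c * B $ c $ j + A $ i $ c' * B $ c' $ j"
proof -
  have "(UNIV :: 2 set) = {c, c'}" using assms exhaust_2 by (auto, metis)
  then have "(A ** B) $ i $ j = (\<Sum>k\<in>{c, c'}. A $ i $ k * B $ k $ j)"
    by (simp add: matrix_matrix_mult_def del: UNIV_2)
  then show ?thesis using assms by simp
qed

lemma isCont_imp_bigo_1:
  fixes f :: "complex \<Rightarrow> complex"
  assumes "isCont f a"
  shows "f \<in> O[at a within T](\<lambda>_. 1)"
proof -
  have "(f \<longlongrightarrow> f a) (at a within T)" using assms Lim_at_imp_Lim_at_within by (auto simp: isCont_def)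
  then have "eventually (\<lambda>z. dist (f z) (f a) < 1) (at a within T)" by (rule tendstoD) simp
  then have "eventually (\<lambda>z. norm (f z) \<le> (norm (f a) + 1) * norm (1::complex)) (at a within T)"
  proof eventually_elim
    case (elim z)
    then show ?case using norm_triangle_ineq2[of "f z" "f a"] by (simp add: dist_norm)
  qed
  then show ?thesis by (rule bigoI)
qed

lemma one_smallo_inverse: "(\<lambda>_. 1) \<in> o[at a within T](\<lambda>z. 1 / (z - a :: complex))"
proof (rule landau_o.smallI)
  fix c :: real assume c: "c > 0"
  have "eventually (\<lambda>z. dist z a < c \<and> z \<noteq> a) (at a within T)"
    unfolding eventually_at using c by auto
  then show "eventually (\<lambda>z. norm (1::complex) \<le> c * norm (1 / (z - a))) (at a within T)"
    by eventually_elim (simp add: dist_norm norm_divide field_simps)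
qed

lemma isCont_imp_smallo_inverse:
  fixes f :: "complex \<Rightarrow> complex"
  assumes "isCont f a"
  shows "f \<in> o[at a within T](\<lambda>z. 1 / (z - a))"
  using landau_o.big_small_trans[OF isCont_imp_bigo_1[OF assms] one_smallo_inverse] .

lemma isCont_mult_smallo:
  fixes f g :: "complex \<Rightarrow> complex"
  assumes "isCont f a" "g \<in> o[at a within T](h)"
  shows "(\<lambda>z. f z * g z) \<in> o[at a within T](h)"
  using landau_o.big_small_mult[OF isCont_imp_bigo_1[OF assms(1)] assms(2)] by simp

lemma holomorphic_isCont:
  "f holomorphic_on D \<Longrightarrow> open D \<Longrightarrow> z \<in> D \<Longrightarrow> isCont f z"
  using holomorphic_on_imp_continuous_on continuous_on_eq_continuous_at by blast

text \<open>One domain with the arcs inside it. Column \<open>c\<close> is the one that jumps and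
  \<open>c'\<close> the one that does not; both orders occur, as the jump is lower triangular on one
  pair of domains and upper triangular on the conjugate pair. The factor \<open>l - r\<close> is
  minus the jump of \<open>S\<close>, which is taken right minus left.\<close>

locale jump_piece =
  fixes \<Sigma> \<Gamma> :: "(real \<Rightarrow> complex) set" and J :: "complex \<Rightarrow> cmat2" and D :: "complex set"
    and S p :: "complex \<Rightarrow> complex" and c c' :: 2
  assumes open_D: "open D" and \<Gamma>: "arc_system \<Gamma>" "\<Gamma> \<subseteq> \<Sigma>" and D_\<Sigma>: "D \<inter> support \<Sigma> = support \<Gamma>"
    and S_hol: "S holomorphic_on (D - support \<Gamma>)" and p_hol: "p holomorphic_on D"
    and S_ends: "\<And>\<gamma> a. \<gamma> \<in> \<Gamma> \<Longrightarrow> a \<in> {\<gamma> 0, \<gamma> 1} \<Longrightarrow> S \<in> o[at a within - support \<Gamma>](\<lambda>z. 1 / (z - a))"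
    and cols: "c \<noteq> c'"
    and J: "\<And>\<gamma> s. \<gamma> \<in> \<Gamma> \<Longrightarrow> s \<in> {0<..<1} \<Longrightarrow> \<exists>l r. has_left_value S \<gamma> s l \<and> has_right_value S \<gamma> s r \<and>
      J (\<gamma> s) $ c $ c = 1 \<and> J (\<gamma> s) $ c' $ c' = 1 \<and> J (\<gamma> s) $ c $ c' = 0 \<and>
      J (\<gamma> s) $ c' $ c = p (\<gamma> s) * (l - r)"
begin

lemma support_D: "support \<Gamma> \<subseteq> D"
  using D_\<Sigma> by blast

lemma interior_point_D: "\<gamma> \<in> \<Gamma> \<Longrightarrow> s \<in> {0..1} \<Longrightarrow> \<gamma> s \<in> D"
  using support_D unfolding support_def path_image_def by blast

lemma end_point_D: "\<gamma> \<in> \<Gamma> \<Longrightarrow> a \<in> {\<gamma> 0, \<gamma> 1} \<Longrightarrow> a \<in> D"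
  using interior_point_D[of \<gamma> 0] interior_point_D[of \<gamma> 1] by auto

lemma at_end_point: "a \<in> D \<Longrightarrow> at a within - support \<Sigma> = at a within - support \<Gamma>"
  by (rule at_within_nhd[of _ D]) (use open_D D_\<Sigma> in auto)

text \<open>The column without a jump extends to \<open>g\<close>; subtracting \<open>p * S * g\<close> removes the jump of the
  other column.  The removal keeps the singularities \<open>o(1/(z-a))\<close>, because \<open>g\<close> is bounded.\<close>

lemma undress:
  fixes m :: "complex \<Rightarrow> cmat2" and i :: 2
  assumes m: "rhp_solution \<Sigma> J m"
  obtains g h where "g holomorphic_on D" "h holomorphic_on D"
    "\<And>z. z \<in> D - support \<Sigma> \<Longrightarrow> m z $ i $ c' = g z \<and> m z $ i $ c = h z + p z * S z * g z"
proof -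
  let ?E = "support \<Gamma>"
  have hol: "(\<lambda>z. m z $ i $ j) holomorphic_on (D - ?E)" for j :: 2
    using m D_\<Sigma> unfolding rhp_solution_def by (blast intro: holomorphic_on_subset)
  have ends: "(\<lambda>z. m z $ i $ j) \<in> o[at a within - ?E](\<lambda>z. 1 / (z - a))"
    if "\<gamma> \<in> \<Gamma>" "a \<in> {\<gamma> 0, \<gamma> 1}" for \<gamma> a and j :: 2
  proof -
    have "\<gamma> \<in> \<Sigma>" using that \<Gamma>(2) by blast
    then have "(\<lambda>z. m z $ i $ j) \<in> o[at a within - support \<Sigma>](\<lambda>z. 1 / (z - a))"
      using m that(2) unfolding rhp_solution_def by blast
    then show ?thesis by (simp add: at_end_point[OF end_point_D[OF that]])
  qed
  have jump: "\<exists>mp mm l r. has_left_value m \<gamma> s mp \<and> has_right_value m \<gamma> s mm \<and>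
      has_left_value S \<gamma> s l \<and> has_right_value S \<gamma> s r \<and>
      mp $ i $ c' = mm $ i $ c' \<and> mp $ i $ c = mm $ i $ c + mm $ i $ c' * (p (\<gamma> s) * (l - r))"
    if \<gamma>: "\<gamma> \<in> \<Gamma>" "s \<in> {0<..<1}" for \<gamma> s
  proof -
    have "\<gamma> \<in> \<Sigma>" using \<gamma> \<Gamma>(2) by blast
    then have "\<exists>mp mm. has_left_value m \<gamma> s mp \<and> has_right_value m \<gamma> s mm \<and> mp = mm ** J (\<gamma> s)"
      using m \<gamma>(2) unfolding rhp_solution_def by blast
    then obtain mp mm where "has_left_value m \<gamma> s mp" "has_right_value m \<gamma> s mm" "mp = mm ** J (\<gamma> s)"
      by (elim exE conjE)
    moreover obtain l r where "has_left_value S \<gamma> s l" "has_right_value S \<gamma> s r"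
      "J (\<gamma> s) $ c $ c = 1" "J (\<gamma> s) $ c' $ c' = 1" "J (\<gamma> s) $ c $ c' = 0" "J (\<gamma> s) $ c' $ c = p (\<gamma> s) * (l - r)"
      using J[OF \<gamma>] by (elim exE conjE)
    ultimately show ?thesis
      by (intro exI[of _ mp] exI[of _ mm] exI[of _ l] exI[of _ r]) (simp add: mat2_mult_nth[OF cols])
  qed
  have sides: "\<exists>v. has_left_value (\<lambda>z. m z $ i $ c') \<gamma> s v \<and> has_right_value (\<lambda>z. m z $ i $ c') \<gamma> s v"
    if "\<gamma> \<in> \<Gamma>" "s \<in> {0<..<1}" for \<gamma> s
    using jump[OF that] unfolding side_values_mat by metis
  have "\<exists>g. g holomorphic_on D \<and> (\<forall>z. z \<notin> ?E \<longrightarrow> g z = m z $ i $ c')"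
    by (rule holomorphic_extension_no_jump[OF \<Gamma>(1) open_D support_D hol]) (erule (1) sides, erule (1) ends)
  then obtain g where g: "g holomorphic_on D" "\<And>z. z \<notin> ?E \<Longrightarrow> g z = m z $ i $ c'"
    by blast
  define F where "F z = m z $ i $ c - p z * g z * S z" for z
  have F_hol: "F holomorphic_on (D - ?E)"
    unfolding F_def using g(1) p_hol
    by (intro holomorphic_intros hol S_hol) (auto intro: holomorphic_on_subset)
  have F_sides: "\<exists>v. has_left_value F \<gamma> s v \<and> has_right_value F \<gamma> s v"
    if \<gamma>: "\<gamma> \<in> \<Gamma>" "s \<in> {0<..<1}" for \<gamma> s
  proof -
    note A = arc_systemD[OF \<Gamma>(1) \<gamma>(1)]
    obtain mp mm l r where jm: "has_left_value m \<gamma> s mp" "has_right_value m \<gamma> s mm"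
      "has_left_value S \<gamma> s l" "has_right_value S \<gamma> s r"
      "mp $ i $ c' = mm $ i $ c'" "mp $ i $ c = mm $ i $ c + mm $ i $ c' * (p (\<gamma> s) * (l - r))"
      using jump[OF \<gamma>] by blast
    have \<gamma>D: "\<gamma> s \<in> D" using interior_point_D \<gamma> by auto
    have nt: "at (\<gamma> s) within - ?E \<noteq> bot"
      using at_within_Compl_nontrivial[OF interior_support[OF \<Gamma>(1)]] .
    \<comment> \<open>\<open>g\<close> is tied to \<open>m\<close> only off the contour. Its value
      on the arc is identified with the common boundary value of column \<open>c'\<close> by
      computing the limit off the contour in two ways.\<close>
    have "((\<lambda>z. m z $ i $ c') \<longlongrightarrow> mm $ i $ c') (at (\<gamma> s) within - path_image \<gamma>)"
      using jm A \<gamma> by (intro tendsto_of_equal_side_values) (auto simp: side_values_mat, metis)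
    then have "((\<lambda>z. m z $ i $ c') \<longlongrightarrow> mm $ i $ c') (at (\<gamma> s) within - ?E)"
      by (rule tendsto_within_subset) (use \<gamma> in \<open>auto simp: support_def\<close>)
    then have "(g \<longlongrightarrow> mm $ i $ c') (at (\<gamma> s) within - ?E)"
      by (rule Lim_transform_eventually) (simp add: eventually_at_filter g)
    moreover have "(g \<longlongrightarrow> g (\<gamma> s)) (at (\<gamma> s) within - ?E)"
      using holomorphic_isCont[OF g(1) open_D \<gamma>D] Lim_at_imp_Lim_at_within by (auto simp: isCont_def)
    ultimately have gm: "mm $ i $ c' = g (\<gamma> s)" using tendsto_unique[OF nt] by blast
    note side_g = side_value_of_isCont[OF A(2) \<gamma>(2) holomorphic_isCont[OF g(1) open_D \<gamma>D]]
    note side_p = side_value_of_isCont[OF A(2) \<gamma>(2) holomorphic_isCont[OF p_hol open_D \<gamma>D]]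
    have "has_left_value F \<gamma> s (mp $ i $ c - p (\<gamma> s) * g (\<gamma> s) * l)"
      using jm(1,3) side_g(1) side_p(1) unfolding F_def has_left_value_off_arc
      by (intro tendsto_intros)
    moreover have "has_right_value F \<gamma> s (mm $ i $ c - p (\<gamma> s) * g (\<gamma> s) * r)"
      using jm(2,4) side_g(2) side_p(2) unfolding F_def has_right_value_off_arc
      by (intro tendsto_intros)
    moreover have "mp $ i $ c - p (\<gamma> s) * g (\<gamma> s) * l = mm $ i $ c - p (\<gamma> s) * g (\<gamma> s) * r"
      unfolding jm(6) gm by (simp add: algebra_simps)
    ultimately show ?thesis by auto
  qed
  have F_ends: "F \<in> o[at a within - ?E](\<lambda>z. 1 / (z - a))" if "\<gamma> \<in> \<Gamma>" "a \<in> {\<gamma> 0, \<gamma> 1}" for \<gamma> a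
  proof -
    have "isCont (\<lambda>z. p z * g z) a"
      using holomorphic_isCont[OF _ open_D end_point_D[OF that]] g(1) p_hol by (intro continuous_intros)
    then show ?thesis unfolding F_def
      by (intro sum_in_smallo ends[OF that] isCont_mult_smallo S_ends[OF that])
  qed
  have "\<exists>h. h holomorphic_on D \<and> (\<forall>z. z \<notin> ?E \<longrightarrow> h z = F z)"
    by (rule holomorphic_extension_no_jump[OF \<Gamma>(1) open_D support_D F_hol])
      (erule (1) F_sides, erule (1) F_ends)
  then obtain h where h: "h holomorphic_on D" "\<And>z. z \<notin> ?E \<Longrightarrow> h z = F z"
    by blast
  show thesis
    by (rule that[OF g(1) h(1)]) (use g(2) h(2) D_\<Sigma> in \<open>auto simp: F_def algebra_simps\<close>)
qed

text \<open>The terms with \<open>p * S\<close> cancel in the minor; what remains is built from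
  holomorphic functions, so the growth of a product of two entries at an end point never has to be
  estimated.\<close>

lemma minor_extends:
  fixes m m' :: "complex \<Rightarrow> cmat2" and i j :: 2
  assumes m: "rhp_solution \<Sigma> J m" and m': "rhp_solution \<Sigma> J m'"
  shows "\<exists>G. G holomorphic_on D \<and>
    (\<forall>z\<in>D - support \<Sigma>. G z = m z $ i $ 1 * m' z $ j $ 2 - m z $ i $ 2 * m' z $ j $ 1)"
proof -
  obtain g h where g: "g holomorphic_on D" "h holomorphic_on D"
    "\<And>z. z \<in> D - support \<Sigma> \<Longrightarrow> m z $ i $ c' = g z \<and> m z $ i $ c = h z + p z * S z * g z"
    using undress[OF m, of i] by blast
  obtain g' h' where g': "g' holomorphic_on D" "h' holomorphic_on D"
    "\<And>z. z \<in> D - support \<Sigma> \<Longrightarrow> m' z $ j $ c' = g' z \<and> m' z $ j $ c = h' z + p z * S z * g' z"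
    using undress[OF m', of j] by blast
  have *: "m z $ i $ c * m' z $ j $ c' - m z $ i $ c' * m' z $ j $ c = h z * g' z - g z * h' z"
    if "z \<in> D - support \<Sigma>" for z
    using g(3)[OF that] g'(3)[OF that] by (simp add: algebra_simps)
  have hol: "(\<lambda>z. h z * g' z - g z * h' z) holomorphic_on D"
    using g g' by (intro holomorphic_intros)
  have "c = 1 \<and> c' = 2 \<or> c = 2 \<and> c' = 1" using cols exhaust_2[of c] exhaust_2[of c'] by auto
  then show ?thesis
  proof (elim disjE conjE)
    assume "c = 1" "c' = 2"
    then show ?thesis using * hol by (intro exI[of _ "\<lambda>z. h z * g' z - g z * h' z"]) auto
  next
    assume "c = 2" "c' = 1"
    then show ?thesis using * holomorphic_on_minus[OF hol]
      by (intro exI[of _ "\<lambda>z. - (h z * g' z - g z * h' z)"] conjI) (auto simp: algebra_simps)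
  qed
qed

end

lemma normalized_at_infinity_tendsto:
  fixes m :: "complex \<Rightarrow> cmat2" and i j :: 2
  assumes "normalized_at_infinity m"
  shows "((\<lambda>z. m z $ i $ j) \<longlongrightarrow> (mat 1 :: cmat2) $ i $ j) at_infinity"
proof -
  have "((\<lambda>z. 1 / z) \<longlongrightarrow> (0::complex)) at_infinity"
    by (rule tendsto_divide_0[OF tendsto_const filterlim_ident])
  then have lim: "((\<lambda>z. C * norm (1 / z :: complex)) \<longlongrightarrow> 0) at_infinity" for C
    by (intro tendsto_mult_right_zero tendsto_norm_zero)
  have "(\<lambda>z. m z $ i $ j - (mat 1 :: cmat2) $ i $ j) \<in> O[at_infinity](\<lambda>z. 1 / z)"
    using assms by (simp add: normalized_at_infinity_def)
  then obtain C where "eventually (\<lambda>z. norm (m z $ i $ j - (mat 1 :: cmat2) $ i $ j) \<le> C * norm (1 / z)) at_infinity"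
    by (elim landau_o.bigE)
  then have "((\<lambda>z. m z $ i $ j - (mat 1 :: cmat2) $ i $ j) \<longlongrightarrow> 0) at_infinity"
    using lim by (rule Lim_null_comparison)
  then show ?thesis by (rule Lim_null[THEN iffD2])
qed

lemma rhp_unique:
  assumes E: "closed (support \<Sigma>)" "compact (support \<Sigma>)" "interior (support \<Sigma>) = {}"
    and pieces: "\<And>z. z \<in> support \<Sigma> \<Longrightarrow> \<exists>\<Gamma> D S p c c'. z \<in> D \<and> jump_piece \<Sigma> \<Gamma> J D S p c c'"
    and m: "rhp_solution \<Sigma> J m" and m': "rhp_solution \<Sigma> J m'" and z: "z \<notin> support \<Sigma>"
  shows "m' z = m z"
proof -
  let ?E = "support \<Sigma>"
  have nt: "eventually (\<lambda>z. z \<notin> ?E) at_infinity"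
  proof -
    obtain B where B: "\<And>z. z \<in> ?E \<Longrightarrow> norm z \<le> B"
      using compact_imp_bounded[OF E(2)] by (auto simp: bounded_iff)
    have "z \<notin> ?E" if "B + 1 \<le> norm z" for z
      using B[of z] that by linarith
    then show ?thesis unfolding eventually_at_infinity by (intro exI[of _ "B + 1"] allI impI)
  qed
  \<comment> \<open>The same minor formed from the identity matrix, hence the limit at
    infinity.\<close>
  define k :: "2 \<Rightarrow> 2 \<Rightarrow> complex" where
    "k i j = (mat 1 :: cmat2) $ i $ 1 * (mat 1 :: cmat2) $ j $ 2 - (mat 1 :: cmat2) $ i $ 2 * (mat 1 :: cmat2) $ j $ 1" for i j
  have minor: "n z $ i $ 1 * n' z $ j $ 2 - n z $ i $ 2 * n' z $ j $ 1 = k i j"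
    if n: "rhp_solution \<Sigma> J n" and n': "rhp_solution \<Sigma> J n'" for n n' :: "complex \<Rightarrow> cmat2" and i j :: 2
  proof -
    let ?W = "\<lambda>z. n z $ i $ 1 * n' z $ j $ 2 - n z $ i $ 2 * n' z $ j $ 1"
    have W: "?W holomorphic_on (UNIV - ?E)"
      using n n' unfolding rhp_solution_def by (intro holomorphic_intros) (auto simp: Compl_eq_Diff_UNIV)
    have loc: "\<exists>U G. open U \<and> w \<in> U \<and> G holomorphic_on U \<and> (\<forall>u\<in>U - ?E. G u = ?W u)"
      if w: "w \<in> UNIV \<inter> ?E" for w
    proof -
      have "w \<in> ?E" using w by simp
      from pieces[OF this] obtain \<Gamma> D S p c c' where "w \<in> D" and P: "jump_piece \<Sigma> \<Gamma> J D S p c c'"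
        by (elim exE conjE)
      obtain H where H: "H holomorphic_on D" "\<forall>u\<in>D - ?E. H u = ?W u"
        using jump_piece.minor_extends[OF P n n', of i j] by (elim exE conjE)
      show ?thesis
        using jump_piece.open_D[OF P] \<open>w \<in> D\<close> H by (intro exI[of _ D] exI[of _ H] conjI)
    qed
    obtain G where G: "G holomorphic_on UNIV" "\<And>z. z \<notin> ?E \<Longrightarrow> G z = ?W z"
      using holomorphic_extension_glue[OF open_UNIV E(1,3) W loc] by blast
    have "(?W \<longlongrightarrow> k i j) at_infinity"
      unfolding k_def using n n' by (intro tendsto_intros normalized_at_infinity_tendsto) (auto simp: rhp_solution_def)
    then have "(G \<longlongrightarrow> k i j) at_infinity"
      by (rule Lim_transform_eventually) (use nt G in \<open>auto elim: eventually_mono\<close>)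
    then have "((\<lambda>z. G z - k i j) \<longlongrightarrow> 0) at_infinity" using Lim_null by blast
    then have "G z - k i j = 0"
      using G(1) by (intro Liouville_weak_0[of "\<lambda>z. G z - k i j"]) (auto intro!: holomorphic_intros)
    then show ?thesis using G(2)[OF z] by simp
  qed
  have "m' z $ i $ l = m z $ i $ l" for i l :: 2
  proof -
    \<comment> \<open>A row of \<open>m' - m\<close> has zero minor with both rows of
      \<open>m\<close>, because the minors of \<open>m'\<close> with \<open>m\<close> equal those of
      \<open>m\<close> with itself. Cramer's rule with determinant 1 then shows that this row is
      zero.\<close>
    define a b where "a = m' z $ i $ 1 - m z $ i $ 1" and "b = m' z $ i $ 2 - m z $ i $ 2"
    have ab: "a * m z $ j $ 2 - b * m z $ j $ 1 = 0" for j :: 2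
      using minor[OF m' m, of i j] minor[OF m m, of i j] by (simp add: a_def b_def algebra_simps)
    have det: "m z $ 1 $ 1 * m z $ 2 $ 2 - m z $ 1 $ 2 * m z $ 2 $ 1 = 1"
      using minor[OF m m, of 1 2] by (simp add: k_def mat_def)
    have "a = a * (m z $ 1 $ 1 * m z $ 2 $ 2 - m z $ 1 $ 2 * m z $ 2 $ 1)" using det by simp
    also have "\<dots> = m z $ 1 $ 1 * (a * m z $ 2 $ 2 - b * m z $ 2 $ 1) - m z $ 2 $ 1 * (a * m z $ 1 $ 2 - b * m z $ 1 $ 1)"
      by (simp add: algebra_simps)
    finally have "a = 0" using ab by simp
    have "b = b * (m z $ 1 $ 1 * m z $ 2 $ 2 - m z $ 1 $ 2 * m z $ 2 $ 1)" using det by simp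
    also have "\<dots> = m z $ 1 $ 2 * (a * m z $ 2 $ 2 - b * m z $ 2 $ 1) - m z $ 2 $ 2 * (a * m z $ 1 $ 2 - b * m z $ 1 $ 1)"
      by (simp add: algebra_simps)
    finally have "b = 0" using ab by simp
    show ?thesis using \<open>a = 0\<close> \<open>b = 0\<close> exhaust_2[of l] by (auto simp: a_def b_def)
  qed
  then show ?thesis by (simp add: vec_eq_iff)
qed

subsection \<open>Transformation of the \<open>\<partial>\<close>-bar solution\<close>

text \<open>The map \<open>\<phi> z = \<alpha> * (z - p) + cnj \<alpha> * (S z - S p)\<close> is conformal near \<open>p\<close> for \<open>\<alpha> = 1\<close> or \<open>\<alpha> = \<i>\<close>,
  and real wherever \<open>S z = cnj z\<close>; it straightens the boundary into a line.\<close>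

lemma holomorphic_on_paste_across_schwarz:
  fixes F S :: "complex \<Rightarrow> complex"
  assumes U: "open U" and S: "S holomorphic_on U" and E: "\<And>z. z \<in> U \<inter> E \<Longrightarrow> S z = cnj z"
    and F: "continuous_on U F" and diff: "\<And>z. z \<in> U - E \<Longrightarrow> F field_differentiable at z"
  shows "F holomorphic_on U"
proof -
  have "F field_differentiable at p" if p: "p \<in> U" for p
  proof (cases "p \<in> E")
    case True
    \<comment> \<open>The derivative of \<phi> at \<open>p\<close> is
      \<open>\<alpha> + cnj \<alpha> * deriv S p\<close>. For \<alpha> = 1 it vanishes only if
      \<open>deriv S p = -1\<close>, and in that case \<alpha> = \<i> gives 2 * \<i>.\<close>
    define \<alpha> where "\<alpha> = (if deriv S p = -1 then \<i> else 1)"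
    define \<phi> where "\<phi> z = \<alpha> * (z - p) + cnj \<alpha> * (S z - S p)" for z
    have \<phi>: "\<phi> holomorphic_on U" unfolding \<phi>_def using S by (intro holomorphic_intros)
    have "(S has_field_derivative deriv S p) (at p)"
      using S U p holomorphic_derivI by blast
    then have "(\<phi> has_field_derivative (\<alpha> * 1 + cnj \<alpha> * deriv S p)) (at p)"
      unfolding \<phi>_def by (auto intro!: derivative_eq_intros)
    then have "deriv \<phi> p = \<alpha> + cnj \<alpha> * deriv S p" by (simp add: DERIV_imp_deriv)
    moreover have "\<alpha> + cnj \<alpha> * deriv S p \<noteq> 0"
      by (auto simp: \<alpha>_def complex_eq_iff)
    ultimately have d\<phi>: "deriv \<phi> p \<noteq> 0" by simp
    obtain r where r: "r > 0" "ball p r \<subseteq> U" "inj_on \<phi> (ball p r)"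
      using has_complex_derivative_locally_injective[OF \<phi> p U d\<phi>] by metis
    let ?V = "ball p r"
    have \<phi>V: "\<phi> holomorphic_on ?V" using \<phi> r(2) holomorphic_on_subset by blast
    obtain \<psi> where \<psi>: "\<psi> holomorphic_on (\<phi> ` ?V)" "\<And>z. z \<in> ?V \<Longrightarrow> \<psi> (\<phi> z) = z"
      using holomorphic_has_inverse[OF \<phi>V open_ball r(3)] by metis
    have o\<phi>: "open (\<phi> ` ?V)" using open_mapping_thm3[OF \<phi>V open_ball r(3)] .
    have \<psi>V: "\<psi> ` (\<phi> ` ?V) \<subseteq> ?V" using \<psi>(2) by auto
    have FV: "continuous_on ?V F" using F r(2) continuous_on_subset by blast
    have cont: "continuous_on (\<phi> ` ?V) (F \<circ> \<psi>)"
      using \<psi>V by (intro continuous_on_compose holomorphic_on_imp_continuous_on[OF \<psi>(1)] continuous_on_subset[OF FV])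
    have off: "(F \<circ> \<psi>) field_differentiable at w" if w: "w \<in> \<phi> ` ?V" "Im w \<noteq> 0" for w
    proof -
      obtain z where z: "z \<in> ?V" "w = \<phi> z" using w by blast
      have "z \<notin> E"
      proof
        assume "z \<in> E"
        then have "S z = cnj z" "S p = cnj p" using E z r(2) True p by auto
        then have "Im w = 0" unfolding z(2) \<phi>_def by (auto simp: \<alpha>_def)
        then show False using w(2) by simp
      qed
      then have "F field_differentiable at (\<psi> w)" using diff z r(2) \<psi>(2) by auto
      moreover have "\<psi> field_differentiable at w"
        using holomorphic_on_imp_differentiable_at[OF \<psi>(1) o\<phi> w(1)] .
      ultimately show ?thesis by (intro field_differentiable_compose)
    qed
    have off_hol: "(F \<circ> \<psi>) holomorphic_on T" if T: "T \<subseteq> \<phi> ` ?V \<inter> {w. Im w \<noteq> 0}" for T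
    proof -
      have "(F \<circ> \<psi>) field_differentiable at w within T" if w: "w \<in> T" for w
        by (rule field_differentiable_at_within, rule off) (use T w in auto)
      then show ?thesis unfolding holomorphic_on_def by (rule ballI)
    qed
    have "(F \<circ> \<psi>) holomorphic_on (\<phi> ` ?V)"
    proof (rule holomorphic_on_paste_across_line[OF o\<phi>, of \<i> _ 0])
      show "(F \<circ> \<psi>) holomorphic_on \<phi> ` ?V \<inter> {z. \<i> \<bullet> z < 0}" "(F \<circ> \<psi>) holomorphic_on \<phi> ` ?V \<inter> {z. 0 < \<i> \<bullet> z}"
        by (rule off_hol; auto simp: inner_complex_def)+
    qed (use cont in auto)
    then have "((F \<circ> \<psi>) \<circ> \<phi>) holomorphic_on ?V" by (rule holomorphic_on_compose[OF \<phi>V])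
    then have "F holomorphic_on ?V" by (rule holomorphic_transform) (simp add: \<psi>(2))
    then show ?thesis using r(1) holomorphic_on_imp_differentiable_at[of F ?V p] by simp
  next
    case False
    then show ?thesis using diff p by blast
  qed
  then show ?thesis by (simp add: holomorphic_on_def field_differentiable_at_within)
qed

section \<open>The Wirtinger derivative and the dressed column\<close>

lemma dbar_has_derivative:
  assumes "F differentiable (at z)"
  obtains q where "(F has_derivative (\<lambda>h. q * h + dbar F z * cnj h)) (at z)"
proof
  define A where "A = frechet_derivative F (at z)"
  have FA: "(F has_derivative A) (at z)" using assms frechet_derivative_works unfolding A_def by blast
  have lin: "A (a *\<^sub>R x + b *\<^sub>R y) = a *\<^sub>R A x + b *\<^sub>R A y" for a b x y
    using has_derivative_linear[OF FA] by (simp add: linear_add linear_scale)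
  have "A h = (A 1 - \<i> * A \<i>) / 2 * h + dbar F z * cnj h" for h
  proof -
    have "A h = Re h *\<^sub>R A 1 + Im h *\<^sub>R A \<i>"
      using lin[of "Re h" 1 "Im h" \<i>] by (simp add: complex_eq[symmetric] scaleR_conv_of_real mult.commute[of _ \<i>])
    also have "\<dots> = (A 1 - \<i> * A \<i>) / 2 * h + (A 1 + \<i> * A \<i>) / 2 * cnj h"
      by (subst (3 4) complex_eq) (simp add: scaleR_conv_of_real algebra_simps add_divide_distrib diff_divide_distrib)
    finally show ?thesis by (simp add: dbar_def A_def)
  qed
  then have "A = (\<lambda>h. (A 1 - \<i> * A \<i>) / 2 * h + dbar F z * cnj h)" by (rule ext)
  then show "(F has_derivative (\<lambda>h. (A 1 - \<i> * A \<i>) / 2 * h + dbar F z * cnj h)) (at z)"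
    using FA by simp
qed

lemma dbar_eq_0_imp_field_differentiable:
  assumes "F differentiable (at z)" "dbar F z = 0"
  shows "F field_differentiable at z"
proof -
  obtain q where "(F has_derivative (\<lambda>h. q * h + dbar F z * cnj h)) (at z)"
    using dbar_has_derivative[OF assms(1)] .
  then have "(F has_derivative (*) q) (at z)" using assms(2) by simp
  then show ?thesis unfolding field_differentiable_def has_field_derivative_def by blast
qed

text \<open>The antilinear part \<open>p z * b z * cnj h\<close> of the derivative of
  \<open>a\<close> is cancelled by that of \<open>p w * cnj w * b w\<close>; all other factors are
  complex differentiable.\<close>

lemma dressed_field_differentiable:
  assumes a: "(a has_derivative (\<lambda>h. q * h + p z * b z * cnj h)) (at z)"
    and b: "b field_differentiable at z" and p: "p field_differentiable at z" and S: "S field_differentiable at z"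
  shows "(\<lambda>w. a w - p w * (cnj w - S w) * b w) field_differentiable at z"
proof -
  obtain b' p' S' where *: "(b has_derivative (*) b') (at z)" "(p has_derivative (*) p') (at z)" "(S has_derivative (*) S') (at z)"
    using b p S unfolding field_differentiable_def has_field_derivative_def by blast
  have c: "(cnj has_derivative cnj) (at z)" by (rule bounded_linear_imp_has_derivative[OF bounded_linear_cnj])
  let ?C = "q - p' * (cnj z - S z) * b z + p z * S' * b z - p z * (cnj z - S z) * b'"
  have "((\<lambda>w. a w - p w * (cnj w - S w) * b w) has_derivative (*) ?C) (at z)"
    by (rule derivative_eq_intros a * c refl | simp add: algebra_simps fun_eq_iff)+
  then show ?thesis unfolding field_differentiable_def has_field_derivative_def by blast
qed

lemma field_differentiable_cong_open:
  assumes "f field_differentiable at z" "open U" "z \<in> U" "\<And>w. w \<in> U \<Longrightarrow> f w = g w"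
  shows "g field_differentiable at z"
  using assms unfolding field_differentiable_def
  by (blast intro: has_field_derivative_transform_within_open)

lemma side_values_dressed:
  assumes "\<gamma> C1_differentiable_on {0<..<1}" "s \<in> {0<..<1}" "isCont a (\<gamma> s)" "isCont b (\<gamma> s)" "isCont p (\<gamma> s)"
  shows "has_left_value S \<gamma> s l \<Longrightarrow> has_left_value (\<lambda>z. a z - p z * (cnj z - S z) * b z) \<gamma> s
           (a (\<gamma> s) - p (\<gamma> s) * (cnj (\<gamma> s) - l) * b (\<gamma> s))"
    and "has_right_value S \<gamma> s l \<Longrightarrow> has_right_value (\<lambda>z. a z - p z * (cnj z - S z) * b z) \<gamma> s
           (a (\<gamma> s) - p (\<gamma> s) * (cnj (\<gamma> s) - l) * b (\<gamma> s))"
proof -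
  have "isCont cnj (\<gamma> s)" by (intro continuous_intros)
  then have "isCont (\<lambda>z. a z - p z * cnj z * b z) (\<gamma> s)" "isCont (\<lambda>z. p z * b z) (\<gamma> s)"
    using assms(3-5) by (auto intro!: continuous_intros)
  note sides = side_value_of_isCont[OF assms(1,2) this(1)] side_value_of_isCont[OF assms(1,2) this(2)]
  \<comment> \<open>Isolates \<open>S\<close> as the only factor whose two boundary values may
    differ.\<close>
  have alg: "a z - p z * (cnj z - x) * b z = (a z - p z * cnj z * b z) + (p z * b z) * x" for x z
    by (simp add: algebra_simps)
  show "has_left_value (\<lambda>z. a z - p z * (cnj z - S z) * b z) \<gamma> s
           (a (\<gamma> s) - p (\<gamma> s) * (cnj (\<gamma> s) - l) * b (\<gamma> s))" if "has_left_value S \<gamma> s l"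
    using tendsto_add[OF sides(1)[unfolded has_left_value_off_arc]
        tendsto_mult[OF sides(3)[unfolded has_left_value_off_arc] that[unfolded has_left_value_off_arc]]]
    unfolding alg has_left_value_off_arc .
  show "has_right_value (\<lambda>z. a z - p z * (cnj z - S z) * b z) \<gamma> s
           (a (\<gamma> s) - p (\<gamma> s) * (cnj (\<gamma> s) - l) * b (\<gamma> s))" if "has_right_value S \<gamma> s l"
    using tendsto_add[OF sides(2)[unfolded has_right_value_off_arc]
        tendsto_mult[OF sides(4)[unfolded has_right_value_off_arc] that[unfolded has_right_value_off_arc]]]
    unfolding alg has_right_value_off_arc .
qed

text \<open>\<open>W\<close> contains a neighbourhood of the frontier of \<open>D\<close>. The
  equation for \<open>M\<close> is not imposed on the frontier itself, so the assumptions on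
  derivatives stop short of it and holomorphy across it has to be recovered from continuity.\<close>

locale dressed_piece = jump_piece +
  fixes W :: "complex set" and M m :: "complex \<Rightarrow> cmat2"
  assumes open_W: "open W" and DW: "closure D \<subseteq> W"
    and p_an: "p analytic_on closure D" and S_an: "S analytic_on (closure D - support \<Gamma>)"
    and S_frontier: "\<And>z. z \<in> frontier D \<Longrightarrow> S z = cnj z"
    and M_cont: "continuous_on UNIV M"
    and M_c': "\<And>z i. z \<in> W - frontier D \<Longrightarrow> (\<lambda>w. M w $ i $ c') field_differentiable at z"
    and M_out: "\<And>z i. z \<in> W - closure D \<Longrightarrow> (\<lambda>w. M w $ i $ c) field_differentiable at z"
    and M_in: "\<And>z i. z \<in> D \<Longrightarrow> \<exists>q. ((\<lambda>w. M w $ i $ c) has_derivative (\<lambda>h. q * h + p z * M z $ i $ c' * cnj h)) (at z)"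
    and m_c': "\<And>z i. z \<in> W \<Longrightarrow> m z $ i $ c' = M z $ i $ c'"
    and m_in: "\<And>z i. z \<in> D \<Longrightarrow> m z $ i $ c = M z $ i $ c - p z * (cnj z - S z) * M z $ i $ c'"
    and m_out: "\<And>z i. z \<in> W - D \<Longrightarrow> m z $ i $ c = M z $ i $ c"
begin

lemma D_subset_W: "D \<subseteq> W"
  using DW closure_subset by blast

lemma D_disjoint_frontier: "D \<inter> frontier D = {}"
  using open_D frontier_disjoint_eq by blast

lemma isCont_M: "isCont (\<lambda>w. M w $ i $ j) z" for i j :: 2
  using M_cont continuous_on_eq_continuous_at[of UNIV M] by (intro continuous_intros) auto

lemma column_cases: "j = c \<or> j = c'" for j :: 2
  using cols exhaust_2[of j] exhaust_2[of c] exhaust_2[of c'] by metis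

lemma dressed_in_D:
  fixes i :: 2
  assumes z: "z \<in> D - support \<Gamma>"
  shows "(\<lambda>w. M w $ i $ c - p w * (cnj w - S w) * M w $ i $ c') field_differentiable at z"
proof -
  have "open (D - support \<Gamma>)" using open_D closed_support[OF \<Gamma>(1)] by blast
  then have "S field_differentiable at z" using S_hol z holomorphic_on_imp_differentiable_at by blast
  moreover have "p field_differentiable at z" using p_hol open_D z holomorphic_on_imp_differentiable_at by blast
  moreover have "(\<lambda>w. M w $ i $ c') field_differentiable at z"
    using M_c' z D_subset_W D_disjoint_frontier by blast
  ultimately show ?thesis using M_in[of z i] z by (auto intro: dressed_field_differentiable)
qed

text \<open>On the frontier \<open>cnj z - S z\<close> vanishes, so the two formulas for column
  \<open>c\<close> of \<open>m\<close> match there continuously; near such a point \<open>S\<close>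
  is holomorphic and allows pasting. Column \<open>c'\<close> of \<open>M\<close> is pasted without
  any correction.\<close>

lemma m_c_field_differentiable_frontier:
  fixes i :: 2
  assumes z: "z \<in> frontier D"
  shows "(\<lambda>w. m w $ i $ c) field_differentiable at z" "(\<lambda>w. M w $ i $ c') field_differentiable at z"
proof -
  have zc: "z \<in> closure D" "z \<notin> D" using z D_disjoint_frontier by (auto simp: frontier_def)
  then have zE: "z \<notin> support \<Gamma>" using support_D by blast
  obtain U1 where U1: "open U1" "z \<in> U1" "S holomorphic_on U1"
    using analytic_on_subset[OF S_an, of "{z}"] zc zE by (auto simp: analytic_at)
  obtain U2 where U2: "open U2" "z \<in> U2" "p holomorphic_on U2"
    using analytic_on_subset[OF p_an, of "{z}"] zc by (auto simp: analytic_at)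
  \<comment> \<open>\<open>S\<close> and \<open>p\<close> are holomorphic on \<open>U\<close>; the
    mother body, which does not meet the frontier, is cut out so that \<open>dressed_in_D\<close>
    applies at every point of \<open>U\<close> inside \<open>D\<close>.\<close>
  define U where "U = U1 \<inter> U2 \<inter> W - support \<Gamma>"
  have U: "open U" "z \<in> U" using U1 U2 open_W DW zc zE closed_support[OF \<Gamma>(1)] by (auto simp: U_def)
  have SU: "S holomorphic_on U" and pU: "p holomorphic_on U"
    using U1 U2 by (auto simp: U_def intro: holomorphic_on_subset)
  have Mc: "continuous_on T (\<lambda>w. M w $ i $ j)" for T and j :: 2
    using isCont_M by (simp add: continuous_at_imp_continuous_on)
  have S_fr: "S w = cnj w" if "w \<in> U \<inter> frontier D" for w using S_frontier that by blast
  have "(\<lambda>w. M w $ i $ c') holomorphic_on U"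
    using M_c' by (intro holomorphic_on_paste_across_schwarz[OF U(1) SU S_fr Mc]) (auto simp: U_def)
  then show "(\<lambda>w. M w $ i $ c') field_differentiable at z"
    using holomorphic_on_imp_differentiable_at U by blast
  let ?d = "\<lambda>w. M w $ i $ c - p w * (cnj w - S w) * M w $ i $ c'"
  have "U \<subseteq> W" by (auto simp: U_def)
  have cd: "continuous_on U ?d"
    using holomorphic_on_imp_continuous_on[OF SU] holomorphic_on_imp_continuous_on[OF pU]
    by (intro continuous_intros Mc)
  have "continuous_on ((U \<inter> closure D) \<union> (U - D)) (\<lambda>w. if w \<in> D then ?d w else M w $ i $ c)"
  proof (rule continuous_on_cases_local)
    have UU: "(U \<inter> closure D) \<union> (U - D) = U" using closure_subset by blast
    show "closedin (top_of_set ((U \<inter> closure D) \<union> (U - D))) (U \<inter> closure D)"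
      unfolding UU by (intro closedin_closed_Int) auto
    show "closedin (top_of_set ((U \<inter> closure D) \<union> (U - D))) (U - D)"
      unfolding UU using closedin_closed_Int[of "- D" U] open_D by (simp add: Diff_eq closed_Compl)
    show "?d w = M w $ i $ c" if "w \<in> U \<inter> closure D \<and> w \<notin> D \<or> w \<in> U - D \<and> w \<in> D" for w
    proof -
      have "w \<in> frontier D" using that open_D by (auto simp: frontier_def interior_open)
      then show ?thesis using S_frontier by simp
    qed
  qed (use cd Mc in \<open>auto intro: continuous_on_subset\<close>)
  moreover have UU: "(U \<inter> closure D) \<union> (U - D) = U" using closure_subset by blast
  ultimately have "continuous_on U (\<lambda>w. if w \<in> D then ?d w else M w $ i $ c)" by simp
  then have "continuous_on U (\<lambda>w. m w $ i $ c)"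
    by (rule continuous_on_eq) (use m_in m_out \<open>U \<subseteq> W\<close> in auto)
  moreover have "(\<lambda>w. m w $ i $ c) field_differentiable at w" if w: "w \<in> U - frontier D" for w
  proof (cases "w \<in> D")
    case True
    then have "w \<in> D - support \<Gamma>" using w by (auto simp: U_def)
    from dressed_in_D[OF this, of i] show ?thesis
      by (rule field_differentiable_cong_open[OF _ open_D True]) (simp add: m_in)
  next
    case False
    then have wW: "w \<in> W - closure D" using w open_D \<open>U \<subseteq> W\<close> by (auto simp: frontier_def interior_open)
    from M_out[OF this, of i] show ?thesis
      by (rule field_differentiable_cong_open[where U = "W - closure D"])
        (use wW open_W closure_subset[of D] in \<open>auto intro!: m_out[symmetric]\<close>)
  qed
  ultimately have "(\<lambda>w. m w $ i $ c) holomorphic_on U"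
    by (intro holomorphic_on_paste_across_schwarz[OF U(1) SU S_fr])
  then show "(\<lambda>w. m w $ i $ c) field_differentiable at z"
    using holomorphic_on_imp_differentiable_at U by blast
qed

lemma m_field_differentiable:
  fixes i j :: 2
  assumes z: "z \<in> W - support \<Gamma>"
  shows "(\<lambda>w. m w $ i $ j) field_differentiable at z"
proof (cases "j = c'")
  case True
  have "(\<lambda>w. M w $ i $ c') field_differentiable at z"
  proof (cases "z \<in> frontier D")
    case True
    then show ?thesis by (rule m_c_field_differentiable_frontier)
  next
    case False
    then show ?thesis using z by (intro M_c') auto
  qed
  then show ?thesis unfolding True
    by (rule field_differentiable_cong_open[OF _ open_W]) (use z in \<open>auto simp: m_c'\<close>)
next
  case False
  then have j: "j = c" using column_cases[of j] False by simp
  consider "z \<in> D" | "z \<in> frontier D" | "z \<in> W - closure D"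
    using z by (auto simp: frontier_def interior_open[OF open_D])
  then have "(\<lambda>w. m w $ i $ c) field_differentiable at z"
  proof cases
    case 1
    then have "z \<in> D - support \<Gamma>" using z by blast
    from dressed_in_D[OF this, of i] show ?thesis
      by (rule field_differentiable_cong_open[OF _ open_D 1]) (simp add: m_in)
  next
    case 2
    then show ?thesis by (rule m_c_field_differentiable_frontier)
  next
    case 3
    from M_out[OF this, of i] show ?thesis
      by (rule field_differentiable_cong_open[where U = "W - closure D"])
        (use 3 open_W closure_subset[of D] in \<open>auto intro!: m_out[symmetric]\<close>)
  qed
  then show ?thesis by (simp add: j)
qed

text \<open>\<open>M\<close>, \<open>p\<close> and \<open>cnj\<close> are continuous at the arc, so
  only the boundary values of \<open>S\<close> distinguish the two sides.\<close>

lemma m_jump: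
  assumes \<gamma>: "\<gamma> \<in> \<Gamma>" "s \<in> {0<..<1}"
  shows "\<exists>mp mm. has_left_value m \<gamma> s mp \<and> has_right_value m \<gamma> s mm \<and> mp = mm ** J (\<gamma> s)"
proof -
  note A = arc_systemD[OF \<Gamma>(1) \<gamma>(1)]
  have \<gamma>D: "\<gamma> s \<in> D" using interior_point_D \<gamma> by auto
  obtain l r where lr: "has_left_value S \<gamma> s l" "has_right_value S \<gamma> s r"
    and Jg: "J (\<gamma> s) $ c $ c = 1" "J (\<gamma> s) $ c' $ c' = 1" "J (\<gamma> s) $ c $ c' = 0" "J (\<gamma> s) $ c' $ c = p (\<gamma> s) * (l - r)"
    using J[OF \<gamma>] by (elim exE conjE)
  \<comment> \<open>The boundary value of \<open>m\<close> on the side where \<open>S\<close> has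
    boundary value \<open>x\<close>.\<close>
  define V where "V x = (\<chi> i j. if j = c then M (\<gamma> s) $ i $ c - p (\<gamma> s) * (cnj (\<gamma> s) - x) * M (\<gamma> s) $ i $ c'
     else M (\<gamma> s) $ i $ c')" for x
  note side_M = side_value_of_isCont[OF A(2) \<gamma>(2) isCont_M]
  note dressed = side_values_dressed[OF A(2) \<gamma>(2) isCont_M isCont_M holomorphic_isCont[OF p_hol open_D \<gamma>D]]
  have L: "has_left_value m \<gamma> s (V l)"
    unfolding side_values_mat
  proof (intro allI)
    fix i j :: 2
    have "has_left_value (\<lambda>z. M z $ i $ c - p z * (cnj z - S z) * M z $ i $ c') \<gamma> s
       (M (\<gamma> s) $ i $ c - p (\<gamma> s) * (cnj (\<gamma> s) - l) * M (\<gamma> s) $ i $ c')"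
      by (rule dressed(1)[OF lr(1)])
    moreover have "has_left_value (\<lambda>z. M z $ i $ c') \<gamma> s (M (\<gamma> s) $ i $ c')" by (rule side_M)
    ultimately show "has_left_value (\<lambda>z. m z $ i $ j) \<gamma> s (V l $ i $ j)"
      using column_cases[of j] cols D_subset_W
      by (subst side_value_cong(1)[OF A(2) \<gamma>(2) open_D \<gamma>D, where
            G = "\<lambda>z. if j = c then M z $ i $ c - p z * (cnj z - S z) * M z $ i $ c' else M z $ i $ c'"])
        (auto simp: V_def m_in m_c' subset_iff)
  qed
  have R: "has_right_value m \<gamma> s (V r)"
    unfolding side_values_mat
  proof (intro allI)
    fix i j :: 2
    have "has_right_value (\<lambda>z. M z $ i $ c - p z * (cnj z - S z) * M z $ i $ c') \<gamma> s
       (M (\<gamma> s) $ i $ c - p (\<gamma> s) * (cnj (\<gamma> s) - r) * M (\<gamma> s) $ i $ c')"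
      by (rule dressed(2)[OF lr(2)])
    moreover have "has_right_value (\<lambda>z. M z $ i $ c') \<gamma> s (M (\<gamma> s) $ i $ c')" by (rule side_M)
    ultimately show "has_right_value (\<lambda>z. m z $ i $ j) \<gamma> s (V r $ i $ j)"
      using column_cases[of j] cols D_subset_W
      by (subst side_value_cong(2)[OF A(2) \<gamma>(2) open_D \<gamma>D, where
            G = "\<lambda>z. if j = c then M z $ i $ c - p z * (cnj z - S z) * M z $ i $ c' else M z $ i $ c'"])
        (auto simp: V_def m_in m_c' subset_iff)
  qed
  have "V l $ i $ j = (V r ** J (\<gamma> s)) $ i $ j" for i j :: 2
    using column_cases[of j] cols by (auto simp: mat2_mult_nth[OF cols] Jg V_def algebra_simps)
  then have "V l = V r ** J (\<gamma> s)" by (simp add: vec_eq_iff)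
  then show ?thesis using L R by blast
qed

text \<open>Near an end point \<open>S\<close> is \<open>o(1/(z-a))\<close> and all the other
  factors are bounded.\<close>

lemma m_ends:
  fixes i j :: 2
  assumes "\<gamma> \<in> \<Gamma>" "a \<in> {\<gamma> 0, \<gamma> 1}"
  shows "(\<lambda>z. m z $ i $ j) \<in> o[at a within - support \<Sigma>](\<lambda>z. 1 / (z - a))"
proof -
  have aD: "a \<in> D" using end_point_D[OF assms] .
  have ev: "eventually (\<lambda>z. z \<in> D) (at a within - support \<Sigma>)"
    using open_D aD eventually_at_topological by blast
  let ?f = "\<lambda>z. M z $ i $ c - p z * cnj z * M z $ i $ c'"
  have "isCont p a" using holomorphic_isCont[OF p_hol open_D aD] .
  then have "isCont ?f a" "isCont (\<lambda>z. p z * M z $ i $ c') a"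
    using M_cont by (auto intro!: continuous_intros simp: continuous_on_eq_continuous_at)
  moreover have "S \<in> o[at a within - support \<Sigma>](\<lambda>z. 1 / (z - a))"
    using S_ends[OF assms] at_end_point[OF aD] by simp
  ultimately have "(\<lambda>z. ?f z + p z * M z $ i $ c' * S z) \<in> o[at a within - support \<Sigma>](\<lambda>z. 1 / (z - a))"
    by (rule sum_in_smallo(1)[OF isCont_imp_smallo_inverse isCont_mult_smallo])
  then have c: "(\<lambda>z. m z $ i $ c) \<in> o[at a within - support \<Sigma>](\<lambda>z. 1 / (z - a))"
    by (rule landau_o.small.in_cong[THEN iffD1, rotated])
      (use ev in eventually_elim, simp add: m_in algebra_simps)
  have "(\<lambda>z. M z $ i $ c') \<in> o[at a within - support \<Sigma>](\<lambda>z. 1 / (z - a))"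
    by (intro isCont_imp_smallo_inverse isCont_M)
  then have c': "(\<lambda>z. m z $ i $ c') \<in> o[at a within - support \<Sigma>](\<lambda>z. 1 / (z - a))"
    by (rule landau_o.small.in_cong[THEN iffD1, rotated])
      (use ev in eventually_elim, use D_subset_W in \<open>auto simp: m_c' subset_iff\<close>)
  show ?thesis using c c' column_cases[of j] by auto
qed

end

subsection \<open>Reflected Schwarz functions\<close>

text \<open>A collection of properties stable under the reflections below, so that the four domains
  become instances of one statement.\<close>

definition schwarz_data :: "complex set \<Rightarrow> (complex \<Rightarrow> complex) \<Rightarrow> (real \<Rightarrow> complex) set \<Rightarrow> bool" where
  "schwarz_data D S \<Gamma> \<longleftrightarrow>
     open D \<and> arc_system \<Gamma> \<and> support \<Gamma> \<subseteq> D \<and> S analytic_on (closure D - support \<Gamma>) \<and>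
     (\<forall>z\<in>frontier D. S z = cnj z) \<and>
     (\<forall>\<gamma>\<in>\<Gamma>. \<forall>s\<in>{0<..<1}. (\<exists>v. has_left_value S \<gamma> s v) \<and> (\<exists>v. has_right_value S \<gamma> s v)) \<and>
     (\<forall>\<gamma>\<in>\<Gamma>. \<forall>a\<in>{\<gamma> 0, \<gamma> 1}. S \<in> o[at a within - support \<Gamma>](\<lambda>z. 1 / (z - a)))"

text \<open>An isometry \<open>T\<close> of order two together with a reparametrisation \<open>r\<close> of speed \<open>\<kappa>\<close>, chosen so that
  \<open>T \<circ> \<gamma> \<circ> r\<close> has the image of the left side of \<open>\<gamma>\<close> on its left.\<close>

locale plane_symmetry =
  fixes T :: "complex \<Rightarrow> complex" and r :: "real \<Rightarrow> real" and \<kappa> :: real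
  assumes T_linear: "bounded_linear T" and T_T [simp]: "T (T z) = z" and norm_T [simp]: "norm (T z) = norm z"
    and T_normal: "\<i> * (\<kappa> *\<^sub>R T d) = T (\<i> * d)"
    and T_cnj: "T (cnj z) = cnj (T z)"
    and T_hol: "\<And>F U. F holomorphic_on U \<Longrightarrow> open U \<Longrightarrow> (\<lambda>z. T (F (T z))) holomorphic_on T ` U"
    and r_cases: "r = (\<lambda>s. s) \<and> \<kappa> = 1 \<or> r = (\<lambda>s. 1 - s) \<and> \<kappa> = - 1"
begin

abbreviation arcs :: "(real \<Rightarrow> complex) set \<Rightarrow> (real \<Rightarrow> complex) set" where
  "arcs \<Gamma> \<equiv> (\<lambda>\<gamma> s. T (\<gamma> (r s))) ` \<Gamma>"

abbreviation conjugate :: "(complex \<Rightarrow> complex) \<Rightarrow> complex \<Rightarrow> complex" where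
  "conjugate F \<equiv> (\<lambda>z. T (F (T z)))"

lemma T_add: "T (z + w) = T z + T w" and T_diff: "T (z - w) = T z - T w" and T_scale: "T (of_real a * z) = of_real a * T z"
  using T_linear linear_add linear_diff linear_scale bounded_linear.linear
  by (metis scaleR_conv_of_real)+

lemma T_inj: "T z = T w \<longleftrightarrow> z = w"
  by (metis T_T)

lemma mem_T_image: "z \<in> T ` A \<longleftrightarrow> T z \<in> A"
  by (metis T_T image_iff)

lemma isCont_T: "isCont T z"
  using T_linear linear_continuous_at by blast

lemma open_T_image: "open U \<Longrightarrow> open (T ` U)"
proof -
  assume "open U"
  moreover have "T ` U = T -` U" by (auto simp: mem_T_image)
  ultimately show ?thesis using isCont_T by (metis continuous_at_imp_continuous_on continuous_on_open_vimage open_UNIV Int_UNIV_right)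
qed

lemma closure_T_image: "closure (T ` A) = T ` closure A"
  using T_linear T_inj by (intro closure_injective_linear_image[symmetric]) (auto simp: inj_def bounded_linear.linear)

lemma frontier_T_image: "frontier (T ` A) = T ` frontier A"
proof -
  have "- (T ` A) = T ` (- A)" by (rule set_eqI) (simp add: mem_T_image)
  then have "closure (- (T ` A)) = T ` closure (- A)" by (simp add: closure_T_image)
  then show ?thesis
    unfolding frontier_closures closure_T_image by (intro set_eqI) (simp add: mem_T_image)
qed

lemma r_r: "r (r s) = s" and r_unit: "r s \<in> {0..1} \<longleftrightarrow> s \<in> {0..1}" "r s \<in> {0<..<1} \<longleftrightarrow> s \<in> {0<..<1}"
  and r_ends: "r s \<in> {0, 1} \<longleftrightarrow> s \<in> {0, 1}"
  using r_cases by auto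

lemma r_image: "r ` {0..1} = {0..1}"
proof
  show "r ` {0..1} \<subseteq> {0..1}" using r_cases by auto
  show "{0..1} \<subseteq> r ` {0..1}"
  proof
    fix s :: real assume "s \<in> {0..1}"
    then show "s \<in> r ` {0..1}" using r_r[of s] r_unit(1)[of s] by (metis image_eqI)
  qed
qed

lemma support_arcs: "support (arcs \<Gamma>) = T ` support \<Gamma>"
proof -
  have "(\<lambda>s. T (\<gamma> (r s))) ` {0..1} = T ` \<gamma> ` {0..1}" for \<gamma>
    by (subst (2) r_image[symmetric]) (simp add: image_image)
  then show ?thesis by (simp add: support_def path_image_def image_UN)
qed

lemma r_tendsto: "(r \<longlongrightarrow> r s) (nhds s)"
  using r_cases by (auto intro!: tendsto_intros filterlim_ident)

lemma has_vector_derivative_arc: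
  assumes "\<gamma> C1_differentiable_on {0<..<1}" "s \<in> {0<..<1}"
  shows "((\<lambda>s. T (\<gamma> (r s))) has_vector_derivative \<kappa> *\<^sub>R T (vector_derivative \<gamma> (at (r s)))) (at s)"
proof -
  have "(r has_real_derivative \<kappa>) (at s)"
    using r_cases by (auto intro!: derivative_eq_intros)
  then have r': "(r has_vector_derivative \<kappa>) (at s)"
    by (simp add: has_real_derivative_iff_has_vector_derivative)
  have "(\<gamma> has_vector_derivative vector_derivative \<gamma> (at (r s))) (at (r s))"
    using arc_derivative(1) assms r_unit(2) by blast
  then have "(\<gamma> \<circ> r has_vector_derivative \<kappa> *\<^sub>R vector_derivative \<gamma> (at (r s))) (at s)"
    using vector_diff_chain_at[OF r'] by blast
  then have "((\<lambda>s. T ((\<gamma> \<circ> r) s)) has_vector_derivative T (\<kappa> *\<^sub>R vector_derivative \<gamma> (at (r s)))) (at s)"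
    by (rule bounded_linear.has_vector_derivative[OF T_linear])
  then show ?thesis by (simp add: T_scale scaleR_conv_of_real)
qed

lemma vector_derivative_arc:
  assumes "\<gamma> C1_differentiable_on {0<..<1}" "s \<in> {0<..<1}"
  shows "vector_derivative (\<lambda>s. T (\<gamma> (r s))) (at s) = \<kappa> *\<^sub>R T (vector_derivative \<gamma> (at (r s)))"
  using has_vector_derivative_arc[OF assms] by (rule vector_derivative_at)

lemma off_arc_T:
  assumes "\<gamma> C1_differentiable_on {0<..<1}" "s \<in> {0<..<1}"
  shows "off_arc (\<lambda>s. T (\<gamma> (r s))) (s, e) = T (off_arc \<gamma> (r s, e))"
proof -
  have "of_real e * \<i> * (\<kappa> *\<^sub>R T (vector_derivative \<gamma> (at (r s)))) = of_real e * T (\<i> * vector_derivative \<gamma> (at (r s)))"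
    by (simp only: mult.assoc T_normal)
  then show ?thesis by (simp add: vector_derivative_arc[OF assms] T_add T_scale mult.assoc)
qed

lemma side_values_T:
  assumes C1: "\<gamma> C1_differentiable_on {0<..<1}" and s: "s \<in> {0<..<1}"
  shows "has_left_value F \<gamma> (r s) v \<Longrightarrow> has_left_value (conjugate F) (\<lambda>s. T (\<gamma> (r s))) s (T v)"
    and "has_right_value F \<gamma> (r s) v \<Longrightarrow> has_right_value (conjugate F) (\<lambda>s. T (\<gamma> (r s))) s (T v)"
proof -
  have *: "((\<lambda>p. conjugate F (off_arc (\<lambda>s. T (\<gamma> (r s))) p)) \<longlongrightarrow> T v) (nhds s \<times>\<^sub>F G)"
    if lim: "((\<lambda>p. F (off_arc \<gamma> p)) \<longlongrightarrow> v) (nhds (r s) \<times>\<^sub>F G)" for G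
  proof -
    have "filterlim (\<lambda>p. (r (fst p), snd p)) (nhds (r s) \<times>\<^sub>F G) (nhds s \<times>\<^sub>F G)"
      by (intro filterlim_Pair filterlim_snd filterlim_compose[OF r_tendsto filterlim_fst])
    then have "((\<lambda>p. F (off_arc \<gamma> (r (fst p), snd p))) \<longlongrightarrow> v) (nhds s \<times>\<^sub>F G)"
      by (rule filterlim_compose[OF lim])
    then have "((\<lambda>p. T (F (off_arc \<gamma> (r (fst p), snd p)))) \<longlongrightarrow> T v) (nhds s \<times>\<^sub>F G)"
      by (rule isCont_tendsto_compose[OF isCont_T])
    \<comment> \<open>\<open>off_arc_T\<close> holds for foot points in the open interval only, so
      the two functions are compared for parameters near \<open>s\<close>.\<close>
    moreover have "eventually (\<lambda>p. fst p \<in> {0<..<1}) (nhds s \<times>\<^sub>F G)"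
      using filterlim_fst[of "nhds s" G, unfolded filterlim_iff, rule_format,
          OF eventually_nhds_in_open[of "{0<..<1}" s]] s by simp
    then have "eventually (\<lambda>p. T (F (off_arc \<gamma> (r (fst p), snd p))) = conjugate F (off_arc (\<lambda>s. T (\<gamma> (r s))) p)) (nhds s \<times>\<^sub>F G)"
    proof eventually_elim
      case (elim p)
      then show ?case using off_arc_T[OF C1, of "fst p" "snd p"] by simp
    qed
    ultimately show ?thesis by (rule Lim_transform_eventually)
  qed
  show "has_left_value F \<gamma> (r s) v \<Longrightarrow> has_left_value (conjugate F) (\<lambda>s. T (\<gamma> (r s))) s (T v)"
    and "has_right_value F \<gamma> (r s) v \<Longrightarrow> has_right_value (conjugate F) (\<lambda>s. T (\<gamma> (r s))) s (T v)"
    unfolding has_left_value_off_arc has_right_value_off_arc by (erule *)+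
qed

lemma smallo_T:
  assumes "F \<in> o[at a within - E](\<lambda>z. 1 / (z - a))"
  shows "conjugate F \<in> o[at (T a) within - (T ` E)](\<lambda>z. 1 / (z - T a))"
proof (rule landau_o.smallI)
  fix c :: real assume "c > 0"
  then have "eventually (\<lambda>z. norm (F z) \<le> c * norm (1 / (z - a))) (at a within - E)"
    using assms by (intro landau_o.smallD)
  then obtain d where d: "d > 0" "\<forall>z\<in>- E. z \<noteq> a \<and> dist z a < d \<longrightarrow> norm (F z) \<le> c * norm (1 / (z - a))"
    unfolding eventually_at by blast
  have iso: "norm (T z - a) = norm (z - T a)" for z
  proof -
    have "norm (T z - a) = norm (T (T z - a))" by simp
    then show ?thesis by (simp add: T_diff)
  qed
  have "norm (conjugate F z) \<le> c * norm (1 / (z - T a))"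
    if z: "z \<in> - (T ` E)" "z \<noteq> T a" "dist z (T a) < d" for z
  proof -
    have "T z \<in> - E" "T z \<noteq> a" using z by (auto simp: mem_T_image)
    moreover have "dist (T z) a < d" using z(3) iso by (simp add: dist_norm)
    ultimately have "norm (F (T z)) \<le> c * norm (1 / (T z - a))" using d(2) by blast
    then show ?thesis by (simp add: norm_divide iso)
  qed
  then show "eventually (\<lambda>z. norm (conjugate F z) \<le> c * norm (1 / (z - T a))) (at (T a) within - (T ` E))"
    unfolding eventually_at using d(1) by (intro exI[of _ d]) simp
qed

lemma arc_system_T:
  assumes \<Gamma>: "arc_system \<Gamma>"
  shows "arc_system (arcs \<Gamma>)"
  unfolding arc_system_def
proof (intro conjI ballI impI)
  show "finite (arcs \<Gamma>)" using \<Gamma> by (auto simp: arc_system_def)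
next
  fix \<delta> assume "\<delta> \<in> arcs \<Gamma>"
  then obtain \<gamma> where \<gamma>: "\<gamma> \<in> \<Gamma>" and \<delta>: "\<delta> = (\<lambda>s. T (\<gamma> (r s)))" by blast
  note A = arc_systemD[OF \<Gamma> \<gamma>]
  have cr: "continuous_on X r" for X using r_cases by (auto intro!: continuous_intros)
  have "continuous_on {0..1} \<gamma>" using A(1) by (simp add: arc_def path_def)
  then have "continuous_on {0..1} (\<lambda>s. \<gamma> (r s))"
    by (rule continuous_on_compose2[OF _ cr]) (simp add: r_image)
  moreover have "continuous_on UNIV T" using isCont_T by (simp add: continuous_at_imp_continuous_on)
  ultimately have "continuous_on {0..1} \<delta>"
    unfolding \<delta> using continuous_on_compose2[of UNIV T "{0..1}" "\<lambda>s. \<gamma> (r s)"] by simp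
  moreover have "inj_on \<delta> {0..1}"
  proof (rule inj_onI)
    fix x y assume "x \<in> {0..1}" "y \<in> {0..1}" "\<delta> x = \<delta> y"
    then have "\<gamma> (r x) = \<gamma> (r y)" "r x \<in> {0..1}" "r y \<in> {0..1}"
      using r_unit(1)[of x] r_unit(1)[of y] by (simp_all add: \<delta> T_inj)
    then have "r x = r y" using A(1) by (auto simp: arc_def dest: inj_onD)
    then show "x = y" by (metis r_r)
  qed
  ultimately show "arc \<delta>" by (simp add: arc_def path_def)
  have "continuous_on {0<..<1} (\<lambda>s. \<kappa> *\<^sub>R T (vector_derivative \<gamma> (at (r s))))"
  proof (intro continuous_at_imp_continuous_on ballI)
    fix s :: real assume "s \<in> {0<..<1}"
    then have "isCont (\<lambda>s. vector_derivative \<gamma> (at s)) (r s)" using arc_derivative(3)[OF A(2)] r_unit(2) by blast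
    then have "isCont (\<lambda>s. vector_derivative \<gamma> (at (r s))) s"
      using isCont_o2[of s r] cr[of UNIV] by (simp add: continuous_on_eq_continuous_at)
    then show "isCont (\<lambda>s. \<kappa> *\<^sub>R T (vector_derivative \<gamma> (at (r s)))) s"
      by (intro continuous_intros isCont_o2[OF _ isCont_T])
  qed
  then show "\<delta> C1_differentiable_on {0<..<1}"
    unfolding C1_differentiable_on_def \<delta>
    by (intro exI[of _ "\<lambda>s. \<kappa> *\<^sub>R T (vector_derivative \<gamma> (at (r s)))"] conjI ballI)
      (rule has_vector_derivative_arc[OF A(2)])
  show "vector_derivative \<delta> (at s) \<noteq> 0" if "s \<in> {0<..<1}" for s
  proof -
    have "vector_derivative \<gamma> (at (r s)) \<noteq> 0" using A(3) r_unit(2) that by blast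
    then have "T (vector_derivative \<gamma> (at (r s))) \<noteq> 0" by (metis norm_T norm_eq_zero)
    then show ?thesis unfolding \<delta> vector_derivative_arc[OF A(2) that] using r_cases by auto
  qed
next
  fix \<delta>1 \<delta>2 s t
  assume \<delta>: "\<delta>1 \<in> arcs \<Gamma>" "\<delta>2 \<in> arcs \<Gamma>" "\<delta>1 \<noteq> \<delta>2" and st: "s \<in> {0..1}" "t \<in> {0..1}" "\<delta>1 s = \<delta>2 t"
  then obtain \<gamma>1 \<gamma>2 where g: "\<gamma>1 \<in> \<Gamma>" "\<gamma>2 \<in> \<Gamma>" "\<gamma>1 \<noteq> \<gamma>2"
    and d: "\<delta>1 = (\<lambda>s. T (\<gamma>1 (r s)))" "\<delta>2 = (\<lambda>s. T (\<gamma>2 (r s)))" by blast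
  have m: "\<forall>s\<in>{0..1}. \<forall>r\<in>{0..1}. \<gamma>1 s = \<gamma>2 r \<longrightarrow> s \<in> {0, 1} \<and> r \<in> {0, 1}"
    using \<Gamma> g unfolding arc_system_def by blast
  have "\<gamma>1 (r s) = \<gamma>2 (r t)" "r s \<in> {0..1}" "r t \<in> {0..1}"
    using st(3) st(1,2) r_unit(1) unfolding d T_inj by blast+
  with m have "r s \<in> {0, 1}" "r t \<in> {0, 1}" by blast+
  then show "s \<in> {0, 1}" "t \<in> {0, 1}" using r_ends by blast+
qed

text \<open>\<open>T\<close> commutes with conjugation, so \<open>T (S (T z)) = cnj z\<close> on the
  reflected frontier: the conjugated function is the Schwarz function there.\<close>

lemma schwarz_data_T:
  assumes "schwarz_data D S \<Gamma>"
  shows "schwarz_data (T ` D) (conjugate S) (arcs \<Gamma>)"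
proof -
  have D: "open D" and \<Gamma>: "arc_system \<Gamma>" and sD: "support \<Gamma> \<subseteq> D" and S: "S analytic_on (closure D - support \<Gamma>)"
    and fr: "\<And>z. z \<in> frontier D \<Longrightarrow> S z = cnj z"
    and sides: "\<And>\<gamma> s. \<gamma> \<in> \<Gamma> \<Longrightarrow> s \<in> {0<..<1} \<Longrightarrow> (\<exists>v. has_left_value S \<gamma> s v) \<and> (\<exists>v. has_right_value S \<gamma> s v)"
    and ends: "\<And>\<gamma> a. \<gamma> \<in> \<Gamma> \<Longrightarrow> a \<in> {\<gamma> 0, \<gamma> 1} \<Longrightarrow> S \<in> o[at a within - support \<Gamma>](\<lambda>z. 1 / (z - a))"
    using assms unfolding schwarz_data_def by auto
  obtain U where U: "open U" "closure D - support \<Gamma> \<subseteq> U" "S holomorphic_on U"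
    using S unfolding analytic_on_holomorphic by blast
  have "closure (T ` D) - support (arcs \<Gamma>) \<subseteq> T ` U"
    using U(2) unfolding closure_T_image support_arcs by (auto simp: mem_T_image)
  then have "conjugate S analytic_on (closure (T ` D) - support (arcs \<Gamma>))"
    unfolding analytic_on_holomorphic using T_hol[OF U(3,1)] open_T_image[OF U(1)] by blast
  moreover have "conjugate S z = cnj z" if "z \<in> frontier (T ` D)" for z
  proof -
    have "S (T z) = cnj (T z)" using that fr by (simp add: frontier_T_image mem_T_image)
    then show ?thesis using T_cnj[of "T z"] by simp
  qed
  moreover have "(\<exists>v. has_left_value (conjugate S) \<delta> s v) \<and> (\<exists>v. has_right_value (conjugate S) \<delta> s v)"
    if \<delta>: "\<delta> \<in> arcs \<Gamma>" and s: "s \<in> {0<..<1}" for \<delta> s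
  proof -
    obtain \<gamma> where \<gamma>: "\<gamma> \<in> \<Gamma>" "\<delta> = (\<lambda>s. T (\<gamma> (r s)))" using \<delta> by blast
    obtain v w where "has_left_value S \<gamma> (r s) v" "has_right_value S \<gamma> (r s) w"
      using sides[OF \<gamma>(1)] r_unit(2)[of s] s by blast
    then show ?thesis unfolding \<gamma>(2) using side_values_T[OF arc_systemD(2)[OF \<Gamma> \<gamma>(1)] s] by blast
  qed
  moreover have "conjugate S \<in> o[at a within - support (arcs \<Gamma>)](\<lambda>z. 1 / (z - a))"
    if \<delta>: "\<delta> \<in> arcs \<Gamma>" and a: "a \<in> {\<delta> 0, \<delta> 1}" for \<delta> a
  proof -
    obtain \<gamma> where \<gamma>: "\<gamma> \<in> \<Gamma>" "\<delta> = (\<lambda>s. T (\<gamma> (r s)))" using \<delta> by blast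
    have "T a \<in> {\<gamma> 0, \<gamma> 1}" using a r_cases unfolding \<gamma>(2) by auto
    from smallo_T[OF ends[OF \<gamma>(1) this]] show ?thesis by (simp add: support_arcs)
  qed
  moreover have "support (arcs \<Gamma>) \<subseteq> T ` D" using sD by (auto simp: support_arcs)
  ultimately show ?thesis
    unfolding schwarz_data_def using open_T_image[OF D] arc_system_T[OF \<Gamma>] by blast
qed

end

interpretation neg: plane_symmetry uminus "\<lambda>s. s" 1
proof (rule plane_symmetry.intro)
  show "(\<lambda>z. - F (- z)) holomorphic_on uminus ` U" if "F holomorphic_on U" "open U" for F and U :: "complex set"
  proof -
    have "(F \<circ> uminus) holomorphic_on uminus ` U"
      using that by (intro holomorphic_on_compose) (auto intro!: holomorphic_intros simp: image_image)
    then have "(\<lambda>z. - (F \<circ> uminus) z) holomorphic_on uminus ` U" by (rule holomorphic_on_minus)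
    then show ?thesis by (simp add: o_def)
  qed
  show "bounded_linear (uminus :: complex \<Rightarrow> complex)"
    using bounded_linear_minus[OF bounded_linear_ident] by simp
qed auto

text \<open>Conjugation sends \<open>\<i> * d\<close> to \<open>- \<i> * cnj d\<close>; the reversal
  with speed -1 restores the sign and reproduces the arcs of \<open>conj_arcs\<close>.\<close>

interpretation cnj: plane_symmetry cnj "\<lambda>s. 1 - s" "-1"
proof (rule plane_symmetry.intro)
  show "(\<lambda>z. cnj (F (cnj z))) holomorphic_on cnj ` U" if "F holomorphic_on U" "open U" for F and U :: "complex set"
  proof -
    have "open (cnj ` U)" unfolding image_cnj_conv_vimage_cnj using that by (intro open_vimage) auto
    then show ?thesis
      using holomorphic_on_compose_cnj_cnj[of F "cnj ` U"] that by (simp add: image_image o_def)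
  qed
  show "bounded_linear cnj" by (rule bounded_linear_cnj)
qed auto

lemma neg_arcs_eq: "neg_arcs \<Gamma> = (\<lambda>\<gamma> s. - \<gamma> s) ` \<Gamma>"
  by (simp add: neg_arcs_def)

lemma conj_arcs_eq: "conj_arcs \<Gamma> = (\<lambda>\<gamma> s. cnj (\<gamma> (1 - s))) ` \<Gamma>"
  by (simp add: conj_arcs_def reversepath_def o_def)

text \<open>The definite description is resolved because an interior point lies on one arc only, for
  one parameter, and one-sided limits are unique.\<close>

lemma jump_across_eq:
  assumes \<Gamma>: "arc_system \<Gamma>" "\<gamma> \<in> \<Gamma>" "s \<in> {0<..<1}"
    and lr: "has_left_value F \<gamma> s l" "has_right_value F \<gamma> s r"
  shows "jump_across \<Gamma> F (\<gamma> s) = r - l"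
  unfolding jump_across_def
proof (rule the_equality)
  show "\<exists>\<gamma>'\<in>\<Gamma>. \<exists>s'\<in>{0<..<1}. \<exists>l' r'. \<gamma> s = \<gamma>' s' \<and> has_left_value F \<gamma>' s' l' \<and> has_right_value F \<gamma>' s' r' \<and> r - l = r' - l'"
    using assms by blast
next
  fix d
  assume "\<exists>\<gamma>'\<in>\<Gamma>. \<exists>s'\<in>{0<..<1}. \<exists>l' r'. \<gamma> s = \<gamma>' s' \<and> has_left_value F \<gamma>' s' l' \<and> has_right_value F \<gamma>' s' r' \<and> d = r' - l'"
  then obtain \<gamma>' s' l' r' where *: "\<gamma>' \<in> \<Gamma>" "s' \<in> {0<..<1}" "\<gamma> s = \<gamma>' s'"
    "has_left_value F \<gamma>' s' l'" "has_right_value F \<gamma>' s' r'" "d = r' - l'" by blast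
  have "s' \<in> {0..1}" using *(2) by auto
  then have "\<gamma>' = \<gamma>" "s' = s" using arc_system_meet[OF \<Gamma>(1,2) *(1) \<Gamma>(3) _ *(3)] by auto
  then have "l' = l" "r' = r"
    using * lr side_value_unique(1)[of F \<gamma> s l' l] side_value_unique(2)[of F \<gamma> s r' r] by auto
  then show "d = r - l" using * by simp
qed

subsection \<open>Expansion at infinity\<close>

text \<open>With \<open>H w = g (1/w)\<close> extended holomorphically by \<open>H 0 = 0\<close>, the coefficient is \<open>H' 0\<close>.\<close>

lemma inv_z_coeff_exists:
  fixes g :: "complex \<Rightarrow> complex"
  assumes diff: "\<And>z. norm z > B \<Longrightarrow> g field_differentiable at z" and g: "g \<in> O[at_infinity](\<lambda>z. 1 / z)"
  shows "\<exists>a. (\<lambda>z. g z - a / z) \<in> O[at_infinity](\<lambda>z. 1 / z ^ 2)"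
proof -
  obtain C where "eventually (\<lambda>z. norm (g z) \<le> C * norm (1 / z)) at_infinity"
    using g by (elim landau_o.bigE)
  then obtain b where b: "\<And>z. b \<le> norm z \<Longrightarrow> norm (g z) \<le> C * norm (1 / z)"
    unfolding eventually_at_infinity by auto
  \<comment> \<open>Beyond \<open>R\<close> both differentiability and the decay estimate hold;
    inversion maps the punctured disc of radius 1 / R there.\<close>
  define R where "R = max (max B b) 0 + 1"
  have R: "R > 0" "R > B" "R > b" by (auto simp: R_def)
  define r where "r = 1 / R"
  have r: "r > 0" using R by (simp add: r_def)
  have big: "norm (inverse w) > R" if "w \<in> ball 0 r - {0}" for w :: complex
  proof -
    have "R < inverse (norm w)" using that R by (simp add: r_def field_simps)
    then show ?thesis by (simp add: norm_inverse)
  qed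
  define h where "h w = g (inverse w)" for w
  have h_hol: "h holomorphic_on (ball 0 r - {0})"
    unfolding holomorphic_on_def
  proof
    fix w :: complex assume w: "w \<in> ball 0 r - {0}"
    have "g field_differentiable at (inverse w)" using big[OF w] R by (intro diff) auto
    moreover have "inverse field_differentiable at w"
      using w by (intro field_differentiable_inverse field_differentiable_ident) auto
    ultimately have "(g \<circ> inverse) field_differentiable at w" by (rule field_differentiable_compose[rotated])
    then show "h field_differentiable at w within ball 0 r - {0}"
      by (intro field_differentiable_at_within[where S = "ball 0 r - {0}"]) (simp add: h_def[abs_def] o_def)
  qed
  have hb: "norm (h w) \<le> C * norm w" if "w \<in> ball 0 r - {0}" for w
    using b[of "inverse w"] big[OF that] R by (simp add: h_def divide_inverse)
  have "eventually (\<lambda>w. w \<in> ball 0 r - {0}) (at 0)"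
    using r by (auto simp: eventually_at dist_commute)
  then have hb': "eventually (\<lambda>w. norm (h w) \<le> C * norm w) (at 0)"
    by eventually_elim (rule hb)
  have "isCont (\<lambda>w::complex. C * norm w) 0" by (intro continuous_intros)
  then have "((\<lambda>w::complex. C * norm w) \<longlongrightarrow> C * norm (0::complex)) (at 0)" by (simp add: isCont_def)
  then have h0: "(h \<longlongrightarrow> 0) (at 0)" using Lim_null_comparison[OF hb'] by simp
  then have "((\<lambda>w. (w - 0) * h w) \<longlongrightarrow> (0 - 0) * 0) (at 0)" by (intro tendsto_intros)
  then obtain H where H: "H holomorphic_on ball 0 r" "\<forall>w\<in>ball 0 r - {0}. H w = h w"
    using holomorphic_on_extend_lim[OF h_hol] r by auto
  have "isCont H 0" using holomorphic_isCont[OF H(1)] r by simp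
  then have "(H \<longlongrightarrow> H 0) (at 0)" by (simp add: isCont_def)
  moreover have "eventually (\<lambda>w. h w = H w) (at 0)"
    using \<open>eventually (\<lambda>w. w \<in> ball 0 r - {0}) (at 0)\<close> by eventually_elim (use H in simp)
  then have "(H \<longlongrightarrow> 0) (at 0)" using h0 Lim_transform_eventually by blast
  ultimately have H0: "H 0 = 0" using LIM_unique by blast
  \<comment> \<open>Two successive divided differences at 0 give
    \<open>H w = K1 0 * w + K2 w * w ^ 2\<close>. The coefficient \<open>K1 0\<close> is the
    derivative of \<open>H\<close>, and boundedness of \<open>K2\<close> near 0 is the remainder
    estimate.\<close>
  define K1 where "K1 = (\<lambda>w. if w = 0 then deriv H 0 else (H w - H 0) / (w - 0))"
  have K1: "K1 holomorphic_on ball 0 r" unfolding K1_def using H(1) r by (intro pole_lemma) auto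
  define K2 where "K2 = (\<lambda>w. if w = 0 then deriv K1 0 else (K1 w - K1 0) / (w - 0))"
  have K2: "K2 holomorphic_on ball 0 r" unfolding K2_def using K1 r by (intro pole_lemma) auto
  have HK: "H w = K1 0 * w + K2 w * w ^ 2" if "w \<noteq> 0" for w
    using that H0 by (simp add: K1_def K2_def power2_eq_square field_simps)
  have "isCont K2 0" using holomorphic_isCont[OF K2] r by simp
  then have "eventually (\<lambda>w. dist (K2 w) (K2 0) < 1) (at 0)" by (intro tendstoD) (auto simp: isCont_def)
  then obtain d where d: "d > 0" "\<And>w. w \<noteq> 0 \<Longrightarrow> norm w < d \<Longrightarrow> dist (K2 w) (K2 0) < 1"
    unfolding eventually_at by (auto simp: dist_norm)
  have "norm (g z - K1 0 / z) \<le> (norm (K2 0) + 1) * norm (1 / z ^ 2)" if z: "norm z \<ge> max R (1 / d) + 1" for z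
  proof -
    have z0: "z \<noteq> 0" using z R by auto
    have zR: "norm z > R" and zd: "norm z > 1 / d" using z by auto
    have w: "inverse z \<in> ball 0 r - {0}" using zR R z0 by (simp add: r_def norm_divide inverse_eq_divide field_simps)
    have wd: "norm (inverse z) < d" using zd d(1) z0 by (simp add: norm_divide inverse_eq_divide field_simps)
    have "g z = K1 0 * inverse z + K2 (inverse z) * (inverse z) ^ 2"
      using HK[of "inverse z"] H(2) w z0 by (simp add: h_def)
    then have "norm (g z - K1 0 / z) = norm (K2 (inverse z)) * norm (1 / z ^ 2)"
      by (simp add: divide_inverse norm_mult power_inverse)
    moreover have "norm (K2 (inverse z)) \<le> norm (K2 0) + 1"
      using d(2)[of "inverse z"] z0 wd norm_triangle_ineq2[of "K2 (inverse z)" "K2 0"] by (simp add: dist_norm)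
    ultimately show ?thesis by (simp add: mult_right_mono)
  qed
  then have "eventually (\<lambda>z. norm (g z - K1 0 / z) \<le> (norm (K2 0) + 1) * norm (1 / z ^ 2)) at_infinity"
    unfolding eventually_at_infinity by (intro exI[of _ "max R (1 / d) + 1"]) simp
  then show ?thesis by (intro exI[of _ "K1 0"]) (rule bigoI)
qed

lemma has_inv_z_coeff_exists:
  fixes m :: "complex \<Rightarrow> cmat2"
  assumes diff: "\<And>z (i::2) (j::2). norm z > B \<Longrightarrow> (\<lambda>w. m w $ i $ j) field_differentiable at z"
    and m: "normalized_at_infinity m"
  shows "\<exists>A. has_inv_z_coeff m A"
proof -
  have "\<exists>a. (\<lambda>z. m z $ i $ j - (mat 1 :: cmat2) $ i $ j - a / z) \<in> O[at_infinity](\<lambda>z. 1 / z ^ 2)" for i j :: 2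
  proof (rule inv_z_coeff_exists)
    show "(\<lambda>z. m z $ i $ j - (mat 1 :: cmat2) $ i $ j) field_differentiable at z" if "norm z > B" for z
      using diff[OF that] by (intro field_differentiable_diff) auto
    show "(\<lambda>z. m z $ i $ j - (mat 1 :: cmat2) $ i $ j) \<in> O[at_infinity](\<lambda>z. 1 / z)"
      using m by (simp add: normalized_at_infinity_def)
  qed
  note ex = this
  define a where "a i j = (SOME a. (\<lambda>z. m z $ i $ j - (mat 1 :: cmat2) $ i $ j - a / z) \<in> O[at_infinity](\<lambda>z. 1 / z ^ 2))"
    for i j :: 2
  have "(\<lambda>z. m z $ i $ j - (mat 1 :: cmat2) $ i $ j - a i j / z) \<in> O[at_infinity](\<lambda>z. 1 / z ^ 2)" for i j :: 2
    unfolding a_def using ex[of i j] by (rule someI_ex)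
  then show ?thesis
    unfolding has_inv_z_coeff_def by (intro exI[of _ "\<chi> i j. a i j"]) simp
qed

text \<open>The (1,2) entry of the identity is zero, so multiplication by \<open>z\<close> leaves
  the entry of \<open>A\<close> and a remainder of order 1 / z.\<close>

lemma has_inv_z_coeff_imp_potential:
  fixes m :: "complex \<Rightarrow> cmat2" and A :: cmat2
  assumes "has_inv_z_coeff m A"
  shows "has_potential m (2 * \<i> * A $ 1 $ 2)"
proof -
  have "(\<lambda>z. m z $ 1 $ 2 - (mat 1 :: cmat2) $ 1 $ 2 - A $ 1 $ 2 / z) \<in> O[at_infinity](\<lambda>z. 1 / z ^ 2)"
    using assms unfolding has_inv_z_coeff_def by blast
  then have "(\<lambda>z. m z $ 1 $ 2 - A $ 1 $ 2 / z) \<in> O[at_infinity](\<lambda>z. 1 / z ^ 2)"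
    by (simp add: mat_def)
  then obtain C where C: "eventually (\<lambda>z. norm (m z $ 1 $ 2 - A $ 1 $ 2 / z) \<le> C * norm (1 / z ^ 2)) at_infinity"
    by (elim landau_o.bigE)
  have "eventually (\<lambda>z::complex. 1 \<le> norm z) at_infinity"
    unfolding eventually_at_infinity by auto
  with C have ev: "eventually (\<lambda>z. norm (z * m z $ 1 $ 2 - A $ 1 $ 2) \<le> C * norm (1 / z)) at_infinity"
  proof eventually_elim
    case (elim z)
    then have z: "z \<noteq> 0" by auto
    have "norm (z * m z $ 1 $ 2 - A $ 1 $ 2) = norm z * norm (m z $ 1 $ 2 - A $ 1 $ 2 / z)"
      using z by (simp add: right_diff_distrib flip: norm_mult)
    also have "\<dots> \<le> norm z * (C * norm (1 / z ^ 2))"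
      using elim by (intro mult_left_mono) auto
    also have "\<dots> = C * norm (1 / z)"
      using z by (simp add: norm_divide norm_mult power2_eq_square field_simps)
    finally show ?case .
  qed
  have "((\<lambda>z. 1 / z) \<longlongrightarrow> (0::complex)) at_infinity"
    by (rule tendsto_divide_0[OF tendsto_const filterlim_ident])
  then have "((\<lambda>z. C * norm (1 / z :: complex)) \<longlongrightarrow> 0) at_infinity"
    by (intro tendsto_mult_right_zero tendsto_norm_zero)
  with ev have "((\<lambda>z. z * m z $ 1 $ 2 - A $ 1 $ 2) \<longlongrightarrow> 0) at_infinity"
    by (rule Lim_null_comparison)
  then have "((\<lambda>z. z * m z $ 1 $ 2) \<longlongrightarrow> A $ 1 $ 2) at_infinity" by (rule Lim_null[THEN iffD2])
  then show ?thesis unfolding has_potential_def by blast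
qed

lemma at_infinity_cong:
  fixes m m' :: "complex \<Rightarrow> cmat2"
  assumes "eventually (\<lambda>z. m z = m' z) at_infinity"
  shows "normalized_at_infinity m \<longleftrightarrow> normalized_at_infinity m'"
    and "has_inv_z_coeff m A \<longleftrightarrow> has_inv_z_coeff m' A"
proof -
  have *: "(\<lambda>z. m z $ i $ j - a z) \<in> O[at_infinity](h) \<longleftrightarrow> (\<lambda>z. m' z $ i $ j - a z) \<in> O[at_infinity](h)"
    for i j :: 2 and a h :: "complex \<Rightarrow> complex"
    by (rule landau_o.big.in_cong) (use assms in eventually_elim, simp)
  show "normalized_at_infinity m \<longleftrightarrow> normalized_at_infinity m'"
    unfolding normalized_at_infinity_def by (simp only: *)
  show "has_inv_z_coeff m A \<longleftrightarrow> has_inv_z_coeff m' A"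
    unfolding has_inv_z_coeff_def diff_diff_eq by (simp only: *)
qed

section \<open>Entries of the jump matrix and the column form of the equation\<close>

lemma mat2_nth [simp]:
  "mat2 a b c d $ 1 $ 1 = a" "mat2 a b c d $ 1 $ 2 = b" "mat2 a b c d $ 2 $ 1 = c" "mat2 a b c d $ 2 $ 2 = d"
  by (simp_all add: mat2_def)

text \<open>Conjugation by the diagonal exponential doubles the phase in the off-diagonal entries,
  which yields the exponentials of \<open>dbar_matrix\<close>.\<close>

lemma jump_matrix_nth:
  "jump_matrix f S \<Gamma> x t z $ 1 $ 1 = 1" "jump_matrix f S \<Gamma> x t z $ 2 $ 2 = 1"
  "jump_matrix f S \<Gamma> x t z $ 1 $ 2 = schwarz_conj (varrho f S \<Gamma>) z * exp (- 2 * \<i> * theta x t z) *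
     indicator (support (conj_arcs \<Gamma>) \<union> support (conj_arcs (neg_arcs \<Gamma>))) z"
  "jump_matrix f S \<Gamma> x t z $ 2 $ 1 = - varrho f S \<Gamma> z * exp (2 * \<i> * theta x t z) *
     indicator (support \<Gamma> \<union> support (neg_arcs \<Gamma>)) z"
proof -
  have c: "(1::2) \<noteq> 2" by simp
  have e: "exp (- (\<i> * u)) * exp (- (\<i> * u)) = exp (- (\<i> * (2 * u)))"
    "exp (\<i> * u) * exp (\<i> * u) = exp (\<i> * (2 * u))" for u :: complex
    by (simp_all add: mult_exp_exp algebra_simps)
  show "jump_matrix f S \<Gamma> x t z $ 1 $ 1 = 1" "jump_matrix f S \<Gamma> x t z $ 2 $ 2 = 1"
    "jump_matrix f S \<Gamma> x t z $ 1 $ 2 = schwarz_conj (varrho f S \<Gamma>) z * exp (- 2 * \<i> * theta x t z) *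
     indicator (support (conj_arcs \<Gamma>) \<union> support (conj_arcs (neg_arcs \<Gamma>))) z"
    "jump_matrix f S \<Gamma> x t z $ 2 $ 1 = - varrho f S \<Gamma> z * exp (2 * \<i> * theta x t z) *
     indicator (support \<Gamma> \<union> support (neg_arcs \<Gamma>)) z"
    by (simp_all add: jump_matrix_def exp_sigma3_def mat2_mult_nth[OF c] mat_def mult_ac e)
qed

text \<open>On \<open>W\<close> the matrix \<open>N\<close> can be nonzero only in position (c', c).
  Hence column \<open>c'\<close> of \<open>M ** N\<close> vanishes and column \<open>c\<close> is,
  inside \<open>D\<close>, \<open>p\<close> times column \<open>c'\<close> of \<open>M\<close>: the
  matrix equation splits into the column conditions of the locale.\<close>

lemma dressed_pieceI:
  fixes M m N J :: "complex \<Rightarrow> cmat2" and c c' :: 2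
  assumes sd: "schwarz_data D S \<Gamma>" and W: "open W" "closure D \<subseteq> W" and \<Sigma>: "\<Gamma> \<subseteq> \<Sigma>" "W \<inter> support \<Sigma> = support \<Gamma>"
    and cols: "c \<noteq> c'" and p: "p analytic_on closure D" and M: "continuous_on UNIV M"
    and eq: "\<And>z (i::2) (j::2). z \<in> W - frontier D \<Longrightarrow>
      (\<lambda>w. M w $ i $ j) differentiable (at z) \<and> dbar (\<lambda>w. M w $ i $ j) z = (M z ** N z) $ i $ j"
    and N: "\<And>z. z \<in> W \<Longrightarrow> N z $ c $ c = 0 \<and> N z $ c' $ c' = 0 \<and> N z $ c $ c' = 0 \<and>
      N z $ c' $ c = (if z \<in> D then p z else 0)"
    and J: "\<And>\<gamma> s l r. \<gamma> \<in> \<Gamma> \<Longrightarrow> s \<in> {0<..<1} \<Longrightarrow> has_left_value S \<gamma> s l \<Longrightarrow> has_right_value S \<gamma> s r \<Longrightarrow>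
      J (\<gamma> s) $ c $ c = 1 \<and> J (\<gamma> s) $ c' $ c' = 1 \<and> J (\<gamma> s) $ c $ c' = 0 \<and> J (\<gamma> s) $ c' $ c = p (\<gamma> s) * (l - r)"
    and m: "\<And>z (i::2). z \<in> W \<Longrightarrow> m z $ i $ c' = M z $ i $ c' \<and>
      m z $ i $ c = M z $ i $ c - (if z \<in> D then p z * (cnj z - S z) * M z $ i $ c' else 0)"
  shows "dressed_piece \<Sigma> \<Gamma> J D S p c c' W M m"
proof -
  have D: "open D" and \<Gamma>: "arc_system \<Gamma>" and sD: "support \<Gamma> \<subseteq> D" and S: "S analytic_on (closure D - support \<Gamma>)"
    and fr: "\<And>z. z \<in> frontier D \<Longrightarrow> S z = cnj z"
    and sides: "\<And>\<gamma> s. \<gamma> \<in> \<Gamma> \<Longrightarrow> s \<in> {0<..<1} \<Longrightarrow> (\<exists>v. has_left_value S \<gamma> s v) \<and> (\<exists>v. has_right_value S \<gamma> s v)"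
    and ends: "\<And>\<gamma> a. \<gamma> \<in> \<Gamma> \<Longrightarrow> a \<in> {\<gamma> 0, \<gamma> 1} \<Longrightarrow> S \<in> o[at a within - support \<Gamma>](\<lambda>z. 1 / (z - a))"
    using sd unfolding schwarz_data_def by auto
  have DW: "D \<subseteq> W" using W closure_subset by blast
  have Dfr: "D \<inter> frontier D = {}" using D frontier_disjoint_eq by blast
  have col: "(M z ** N z) $ i $ c' = 0" "(M z ** N z) $ i $ c = (if z \<in> D then M z $ i $ c' * p z else 0)"
    if "z \<in> W" for z and i :: 2
    using N[OF that] by (simp_all add: mat2_mult_nth[OF cols])
  show ?thesis
  proof (unfold_locales)
    show "D \<inter> support \<Sigma> = support \<Gamma>" using DW \<Sigma>(2) sD by blast
    show "S holomorphic_on D - support \<Gamma>"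
      using analytic_imp_holomorphic[OF S] by (rule holomorphic_on_subset) (use closure_subset in blast)
    show "p holomorphic_on D"
      using analytic_imp_holomorphic[OF p] by (rule holomorphic_on_subset) (use closure_subset in blast)
    show "\<exists>l r. has_left_value S \<gamma> s l \<and> has_right_value S \<gamma> s r \<and>
      J (\<gamma> s) $ c $ c = 1 \<and> J (\<gamma> s) $ c' $ c' = 1 \<and> J (\<gamma> s) $ c $ c' = 0 \<and> J (\<gamma> s) $ c' $ c = p (\<gamma> s) * (l - r)"
      if "\<gamma> \<in> \<Gamma>" "s \<in> {0<..<1}" for \<gamma> s
      using sides[OF that] J[OF that] by metis
    show "(\<lambda>w. M w $ i $ c') field_differentiable at z" if "z \<in> W - frontier D" for z and i :: 2
      using eq[OF that, of i c'] col(1)[of z i] that by (intro dbar_eq_0_imp_field_differentiable) auto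
    show "(\<lambda>w. M w $ i $ c) field_differentiable at z" if "z \<in> W - closure D" for z and i :: 2
    proof -
      have "z \<in> W - frontier D" "z \<notin> D" using that closure_subset[of D] by (auto simp: frontier_def)
      then show ?thesis using eq[of z i c] col(2)[of z i] that
        by (intro dbar_eq_0_imp_field_differentiable) auto
    qed
    show "\<exists>q. ((\<lambda>w. M w $ i $ c) has_derivative (\<lambda>h. q * h + p z * M z $ i $ c' * cnj h)) (at z)" if "z \<in> D" for z and i :: 2
    proof -
      have z: "z \<in> W - frontier D" "z \<in> W" using that DW Dfr by auto
      have "dbar (\<lambda>w. M w $ i $ c) z = p z * M z $ i $ c'"
        using eq[OF z(1), of i c] col(2)[OF z(2), of i] that by (simp add: mult.commute)
      then show ?thesis using dbar_has_derivative[of "\<lambda>w. M w $ i $ c" z] eq[OF z(1), of i c] by metis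
    qed
    show "m z $ i $ c' = M z $ i $ c'" if "z \<in> W" for z and i :: 2 using m[OF that] by blast
    show "m z $ i $ c = M z $ i $ c - p z * (cnj z - S z) * M z $ i $ c'" if "z \<in> D" for z and i :: 2
      using m[of z i] that DW by auto
    show "m z $ i $ c = M z $ i $ c" if "z \<in> W - D" for z and i :: 2
      using m[of z i] that by auto
  qed (use D \<Gamma> \<Sigma> cols ends W p S fr M in auto)
qed

subsection \<open>The four quadrants\<close>

lemma support_Un: "support (A \<union> B) = support A \<union> support B"
  by (simp add: support_def)

lemma arc_point_in_support: "\<gamma> \<in> \<Gamma> \<Longrightarrow> s \<in> {0..1} \<Longrightarrow> \<gamma> s \<in> support \<Gamma>"
  unfolding support_def path_image_def by blast

lemma schwarz_data_neg:
  "schwarz_data D S \<Gamma> \<Longrightarrow> schwarz_data (uminus ` D) (\<lambda>z. - S (- z)) (neg_arcs \<Gamma>)"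
  unfolding neg_arcs_eq by (rule neg.schwarz_data_T)

lemma schwarz_data_cnj:
  "schwarz_data D S \<Gamma> \<Longrightarrow> schwarz_data (cnj ` D) (schwarz_conj S) (conj_arcs \<Gamma>)"
  unfolding conj_arcs_eq schwarz_conj_def[abs_def] by (rule cnj.schwarz_data_T)

lemma schwarz_conj_analytic:
  assumes "f analytic_on X"
  shows "schwarz_conj f analytic_on cnj ` X"
proof -
  obtain U where "open U" "X \<subseteq> U" "f holomorphic_on U" using assms unfolding analytic_on_holomorphic by blast
  then show ?thesis
    unfolding analytic_on_holomorphic schwarz_conj_def[abs_def]
    by (intro exI[of _ "cnj ` U"] conjI cnj.open_T_image cnj.T_hol image_mono)
qed

lemma schwarz_data_jump:
  assumes "schwarz_data D S \<Gamma>" "\<gamma> \<in> \<Gamma>" "s \<in> {0<..<1}" "has_left_value S \<gamma> s l" "has_right_value S \<gamma> s r"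
  shows "jump_across \<Gamma> S (\<gamma> s) = r - l"
  using assms unfolding schwarz_data_def by (intro jump_across_eq) auto

text \<open>Conjugation exchanges the sides of an arc and the reversal of the arc restores them, so the
  jump of the conjugate Schwarz function is the conjugate jump.\<close>

lemma schwarz_data_jump_cnj:
  assumes sd: "schwarz_data D S \<Gamma>" and \<delta>: "\<delta> \<in> conj_arcs \<Gamma>" and s: "s \<in> {0<..<1}"
    and lr: "has_left_value (schwarz_conj S) \<delta> s l" "has_right_value (schwarz_conj S) \<delta> s r"
  shows "cnj (jump_across \<Gamma> S (cnj (\<delta> s))) = r - l" "cnj (\<delta> s) \<in> support \<Gamma>"
proof -
  obtain \<gamma> where \<gamma>: "\<gamma> \<in> \<Gamma>" and \<delta>: "\<delta> = (\<lambda>s. cnj (\<gamma> (1 - s)))" using \<delta> by (auto simp: conj_arcs_eq)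
  have s': "1 - s \<in> {0<..<1}" using s by auto
  have \<Gamma>: "arc_system \<Gamma>" using sd by (simp add: schwarz_data_def)
  obtain v w where vw: "has_left_value S \<gamma> (1 - s) v" "has_right_value S \<gamma> (1 - s) w"
    using sd \<gamma> s' unfolding schwarz_data_def by blast
  note C1 = arc_systemD(2)[OF \<Gamma> \<gamma>]
  have "l = cnj v" "r = cnj w"
    using side_value_unique(1)[OF lr(1)] side_value_unique(2)[OF lr(2)]
      cnj.side_values_T(1)[OF C1 s vw(1)] cnj.side_values_T(2)[OF C1 s vw(2)]
    unfolding \<delta> schwarz_conj_def[abs_def] by blast+
  then show "cnj (jump_across \<Gamma> S (cnj (\<delta> s))) = r - l"
    using schwarz_data_jump[OF sd \<gamma> s' vw] by (simp add: \<delta>)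
  show "cnj (\<delta> s) \<in> support \<Gamma>" using arc_point_in_support[OF \<gamma>, of "1 - s"] s' by (simp add: \<delta>)
qed

text \<open>The signs \<open>a\<close> and \<open>b\<close> choose the quadrant. Each open quadrant
  serves as the neighbourhood \<open>W\<close> of one of the four domains and contains nothing of
  the other three.\<close>

definition quadrant :: "real \<Rightarrow> real \<Rightarrow> complex set" where
  "quadrant a b = {z. 0 < a * Re z \<and> 0 < b * Im z}"

lemma open_quadrant: "open (quadrant a b)"
  unfolding quadrant_def by (intro open_Collect_conj open_Collect_less continuous_intros)

lemma quadrant_images: "uminus ` quadrant a b = quadrant (- a) (- b)" "cnj ` quadrant a b = quadrant a (- b)"
proof -
  show "uminus ` quadrant a b = quadrant (- a) (- b)"
    by (rule set_eqI) (simp add: neg.mem_T_image quadrant_def)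
  show "cnj ` quadrant a b = quadrant a (- b)"
    by (rule set_eqI) (simp add: cnj.mem_T_image quadrant_def)
qed

lemma quadrant_disjoint: "z \<in> quadrant a b \<Longrightarrow> z \<in> quadrant c d \<Longrightarrow> 0 < a * c \<and> 0 < b * d"
  by (auto simp: quadrant_def zero_less_mult_iff)

text \<open>Four dressed pieces, one in each open quadrant, are put together with \<open>M\<close>
  itself outside the closures. Near every point of the contour a jump piece is returned as well,
  which is the form that uniqueness asks for.\<close>

lemma dressed_solution:
  fixes Dp :: "complex set" and S f :: "complex \<Rightarrow> complex"
    and \<Gamma> :: "(real \<Rightarrow> complex) set" and x t :: real and M :: "complex \<Rightarrow> cmat2"
  assumes sd: "schwarz_data Dp S \<Gamma>" and bd: "bounded Dp"
    and fq: "closure Dp \<subseteq> first_quadrant"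
    and f: "f analytic_on (closure Dp \<union> closure (uminus ` Dp))"
    and dbs: "dbar_solution Dp f x t M"
  defines "\<Sigma> \<equiv> four_arcs \<Gamma>" and "J \<equiv> jump_matrix f S \<Gamma> x t"
  shows "\<exists>m B. rhp_solution \<Sigma> J m \<and> (\<forall>z. norm z > B \<longrightarrow> m z = M z \<and> z \<notin> support \<Sigma>) \<and>
    closed (support \<Sigma>) \<and> compact (support \<Sigma>) \<and> interior (support \<Sigma>) = {} \<and>
    (\<forall>z\<in>support \<Sigma>. \<exists>\<Gamma> D S p c c'. z \<in> D \<and> jump_piece \<Sigma> \<Gamma> J D S p c c')"
proof -
  define D2 D3 D4 where D_defs: "D2 = uminus ` Dp" "D3 = cnj ` Dp" "D4 = cnj ` uminus ` Dp"
  define S2 where "S2 = (\<lambda>z. - S (- z))"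
  define G2 G3 G4 where G_defs: "G2 = neg_arcs \<Gamma>" "G3 = conj_arcs \<Gamma>" "G4 = conj_arcs (neg_arcs \<Gamma>)"
  have sd2: "schwarz_data D2 S2 G2" unfolding D_defs S2_def G_defs by (rule schwarz_data_neg[OF sd])
  have sd3: "schwarz_data D3 (schwarz_conj S) G3" unfolding D_defs G_defs by (rule schwarz_data_cnj[OF sd])
  have sd4: "schwarz_data D4 (schwarz_conj S2) G4"
    using schwarz_data_cnj[OF sd2] unfolding D_defs G_defs .
  have cl1: "closure Dp \<subseteq> quadrant 1 1" using fq by (auto simp: first_quadrant_def quadrant_def)
  have cl2: "closure D2 \<subseteq> quadrant (-1) (-1)"
    unfolding D_defs neg.closure_T_image using image_mono[OF cl1, of uminus] by (simp add: quadrant_images)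
  have cl3: "closure D3 \<subseteq> quadrant 1 (-1)"
    unfolding D_defs cnj.closure_T_image using image_mono[OF cl1, of cnj] by (simp add: quadrant_images)
  have cl4: "closure D4 \<subseteq> quadrant (-1) 1"
    using image_mono[OF cl2, of cnj] unfolding D_defs cnj.closure_T_image[of "uminus ` Dp"] by (simp add: quadrant_images)
  have sub: "D \<subseteq> quadrant a b \<and> support G \<subseteq> quadrant a b \<and> frontier D \<subseteq> quadrant a b \<and> support G \<subseteq> D"
    if "schwarz_data D S' G" "closure D \<subseteq> quadrant a b" for D S' G a b
    using that closure_subset[of D] by (auto simp: schwarz_data_def frontier_def)
  have away: "z \<notin> D \<and> z \<notin> frontier D \<and> z \<notin> support G"
    if "schwarz_data D S' G" "closure D \<subseteq> quadrant a' b'" "z \<in> quadrant a b" "a * a' < 0 \<or> b * b' < 0"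
    for D S' G a a' b b' z
  proof -
    have "z \<notin> quadrant a' b'" using quadrant_disjoint[OF that(3), of a' b'] that(4) by auto
    then show ?thesis using sub[OF that(1,2)] by (meson subsetD)
  qed
  note sub1 = sub[OF sd cl1] and sub2 = sub[OF sd2 cl2] and sub3 = sub[OF sd3 cl3] and sub4 = sub[OF sd4 cl4]
  have dis: "quadrant 1 1 \<inter> quadrant (-1) (-1) = {}" "quadrant 1 1 \<inter> quadrant 1 (-1) = {}"
    "quadrant 1 1 \<inter> quadrant (-1) 1 = {}" "quadrant (-1) (-1) \<inter> quadrant 1 (-1) = {}"
    "quadrant (-1) (-1) \<inter> quadrant (-1) 1 = {}" "quadrant 1 (-1) \<inter> quadrant (-1) 1 = {}"
    by (auto dest: quadrant_disjoint)
  have supp: "support \<Sigma> = support \<Gamma> \<union> support G2 \<union> support G3 \<union> support G4"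
    by (simp add: \<Sigma>_def four_arcs_def G_defs support_Un Un_ac)
  have arcs: "\<Gamma> \<subseteq> \<Sigma>" "G2 \<subseteq> \<Sigma>" "G3 \<subseteq> \<Sigma>" "G4 \<subseteq> \<Sigma>" and \<Sigma>_cases: "\<Sigma> \<subseteq> \<Gamma> \<union> G2 \<union> G3 \<union> G4"
    by (auto simp: \<Sigma>_def four_arcs_def G_defs)
  have arcsys: "arc_system \<Gamma>" "arc_system G2" "arc_system G3" "arc_system G4"
    using sd sd2 sd3 sd4 by (auto simp: schwarz_data_def)
  define N where "N = dbar_matrix Dp f x t"
  have M_cont: "continuous_on UNIV M" and M_norm: "normalized_at_infinity M"
    using dbs by (auto simp: dbar_solution_def)
  have eq: "(\<lambda>w. M w $ i $ j) differentiable (at z) \<and> dbar (\<lambda>w. M w $ i $ j) z = (M z ** N z) $ i $ j"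
    if "z \<notin> frontier Dp \<union> frontier D2 \<union> frontier D3 \<union> frontier D4" for z and i j :: 2
    using dbs that unfolding dbar_solution_def N_def D_defs by blast
  \<comment> \<open>The lower and the upper entry of the dbar matrix, without indicator. The minus
    sign in \<open>pu\<close> matches the signs with which \<open>varrho\<close> and its conjugate
    enter the jump matrix: in both triangles the entry becomes \<open>p * (l - r)\<close>, the jump
    of \<open>S\<close> being right minus left.\<close>
  define pl where "pl z = f z * exp (2 * \<i> * theta x t z)" for z
  define pu where "pu z = - schwarz_conj f z * exp (- 2 * \<i> * theta x t z)" for z
  have th: "(\<lambda>z. exp (c * theta x t z)) analytic_on X" for c X
    unfolding theta_def by (intro analytic_intros)
  have pl_an: "pl analytic_on closure Dp" "pl analytic_on closure D2"
    unfolding pl_def D_defs by (intro analytic_intros th analytic_on_subset[OF f]; simp)+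
  have pu_an: "pu analytic_on closure D3" "pu analytic_on closure D4"
    unfolding pu_def D_defs using cnj.closure_T_image[of "Dp"] cnj.closure_T_image[of "uminus ` Dp"]
    by (intro analytic_intros th analytic_on_subset[OF schwarz_conj_analytic[OF f]]; auto)+
  have N: "N z $ 1 $ 1 = 0" "N z $ 2 $ 2 = 0" "N z $ 2 $ 1 = (if z \<in> Dp \<union> D2 then pl z else 0)"
    "N z $ 1 $ 2 = (if z \<in> D3 \<union> D4 then pu z else 0)" for z
    by (auto simp: N_def dbar_matrix_def pl_def pu_def D_defs indicator_def)
  define q1 where "q1 z = (if z \<in> Dp then pl z * (cnj z - S z) else if z \<in> D2 then pl z * (cnj z - S2 z) else 0)" for z
  define q2 where "q2 z = (if z \<in> D3 then pu z * (cnj z - schwarz_conj S z)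
    else if z \<in> D4 then pu z * (cnj z - schwarz_conj S2 z) else 0)" for z
  \<comment> \<open>At each point at most one of \<open>q1\<close> and \<open>q2\<close> is nonzero,
    since the domains lie in different quadrants; the dressing factor is therefore triangular with
    determinant 1.\<close>
  define m :: "complex \<Rightarrow> cmat2" where "m z = M z ** mat2 1 (- q2 z) (- q1 z) 1" for z
  have c12: "(1::2) \<noteq> 2" by simp
  have m: "m z $ i $ 1 = M z $ i $ 1 - q1 z * M z $ i $ 2" "m z $ i $ 2 = M z $ i $ 2 - q2 z * M z $ i $ 1"
    for z and i :: 2
    by (simp_all add: m_def mat2_mult_nth[OF c12])
  have J: "J z $ 1 $ 1 = 1" "J z $ 2 $ 2 = 1"
    "J z $ 1 $ 2 = schwarz_conj (varrho f S \<Gamma>) z * exp (- 2 * \<i> * theta x t z) * indicator (support G3 \<union> support G4) z"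
    "J z $ 2 $ 1 = - varrho f S \<Gamma> z * exp (2 * \<i> * theta x t z) * indicator (support \<Gamma> \<union> support G2) z" for z
    by (simp_all add: J_def jump_matrix_nth G_defs)
  have on: "\<gamma> s \<in> support G" if "\<gamma> \<in> G" "s \<in> {0<..<1}" for \<gamma> s G
    using arc_point_in_support[OF that(1), of s] that(2) by simp
  have rho1: "varrho f S \<Gamma> z = f z * jump_across \<Gamma> S z" if "z \<in> support \<Gamma>" for z
    using that by (simp add: varrho_def)
  \<comment> \<open>\<open>varrho\<close> tests membership in the support of \<Gamma> first; its
    second branch is reached because the quadrants are disjoint.\<close>
  have rho2: "varrho f S \<Gamma> z = f z * jump_across G2 S2 z" if "z \<in> support G2" for z
  proof -
    have "z \<notin> support \<Gamma>" using that sub1 sub2 dis by blast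
    then show ?thesis using that by (simp add: varrho_def G_defs S2_def)
  qed
  have d1: "dressed_piece \<Sigma> \<Gamma> J Dp S pl 1 2 (quadrant 1 1) M m"
  proof (rule dressed_pieceI[OF sd open_quadrant cl1 arcs(1) _ _ pl_an(1) M_cont, where N = N])
    have off: "z \<notin> D2" "z \<notin> D3" "z \<notin> D4" "z \<notin> frontier D2" "z \<notin> frontier D3" "z \<notin> frontier D4"
      "z \<notin> support G2" "z \<notin> support G3" "z \<notin> support G4" if "z \<in> quadrant 1 1" for z
      using away[OF sd2 cl2 that] away[OF sd3 cl3 that] away[OF sd4 cl4 that] by simp_all
    show "quadrant 1 1 \<inter> support \<Sigma> = support \<Gamma>"
      by (rule set_eqI) (use off sub1 in \<open>auto simp: supp\<close>)
    show "(\<lambda>w. M w $ i $ j) differentiable (at z) \<and> dbar (\<lambda>w. M w $ i $ j) z = (M z ** N z) $ i $ j"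
      if "z \<in> quadrant 1 1 - frontier Dp" for z and i j :: 2
      using that off[of z] by (intro eq) auto
    show "N z $ 1 $ 1 = 0 \<and> N z $ 2 $ 2 = 0 \<and> N z $ 1 $ 2 = 0 \<and> N z $ 2 $ 1 = (if z \<in> Dp then pl z else 0)"
      if "z \<in> quadrant 1 1" for z
      using off[OF that] by (simp add: N)
    show "m z $ i $ 2 = M z $ i $ 2 \<and>
       m z $ i $ 1 = M z $ i $ 1 - (if z \<in> Dp then pl z * (cnj z - S z) * M z $ i $ 2 else 0)"
      if "z \<in> quadrant 1 1" for z and i :: 2
      using off[OF that] by (simp add: m q1_def q2_def)
    show "J (\<gamma> s) $ 1 $ 1 = 1 \<and> J (\<gamma> s) $ 2 $ 2 = 1 \<and> J (\<gamma> s) $ 1 $ 2 = 0 \<and> J (\<gamma> s) $ 2 $ 1 = pl (\<gamma> s) * (l - r)"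
      if \<gamma>: "\<gamma> \<in> \<Gamma>" "s \<in> {0<..<1}" "has_left_value S \<gamma> s l" "has_right_value S \<gamma> s r" for \<gamma> s l r
    proof -
      have z: "\<gamma> s \<in> support \<Gamma>" "\<gamma> s \<in> quadrant 1 1" using on[OF \<gamma>(1,2)] sub1 by blast+
      have rho: "varrho f S \<Gamma> (\<gamma> s) = f (\<gamma> s) * (r - l)"
        using rho1[OF z(1)] schwarz_data_jump[OF sd \<gamma>] by simp
      show ?thesis using z off[OF z(2)] by (simp add: J pl_def rho algebra_simps)
    qed
  qed simp
  have d2: "dressed_piece \<Sigma> G2 J D2 S2 pl 1 2 (quadrant (-1) (-1)) M m"
  proof (rule dressed_pieceI[OF sd2 open_quadrant cl2 arcs(2) _ _ pl_an(2) M_cont, where N = N])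
    have off: "z \<notin> Dp" "z \<notin> D3" "z \<notin> D4" "z \<notin> frontier Dp" "z \<notin> frontier D3" "z \<notin> frontier D4"
      "z \<notin> support \<Gamma>" "z \<notin> support G3" "z \<notin> support G4" if "z \<in> quadrant (-1) (-1)" for z
      using away[OF sd cl1 that] away[OF sd3 cl3 that] away[OF sd4 cl4 that] by simp_all
    show "quadrant (-1) (-1) \<inter> support \<Sigma> = support G2"
      by (rule set_eqI) (use off sub2 in \<open>auto simp: supp\<close>)
    show "(\<lambda>w. M w $ i $ j) differentiable (at z) \<and> dbar (\<lambda>w. M w $ i $ j) z = (M z ** N z) $ i $ j"
      if "z \<in> quadrant (-1) (-1) - frontier D2" for z and i j :: 2
      using that off[of z] by (intro eq) auto
    show "N z $ 1 $ 1 = 0 \<and> N z $ 2 $ 2 = 0 \<and> N z $ 1 $ 2 = 0 \<and> N z $ 2 $ 1 = (if z \<in> D2 then pl z else 0)"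
      if "z \<in> quadrant (-1) (-1)" for z
      using off[OF that] by (simp add: N)
    show "m z $ i $ 2 = M z $ i $ 2 \<and>
       m z $ i $ 1 = M z $ i $ 1 - (if z \<in> D2 then pl z * (cnj z - S2 z) * M z $ i $ 2 else 0)"
      if "z \<in> quadrant (-1) (-1)" for z and i :: 2
      using off[OF that] by (simp add: m q1_def q2_def)
    show "J (\<gamma> s) $ 1 $ 1 = 1 \<and> J (\<gamma> s) $ 2 $ 2 = 1 \<and> J (\<gamma> s) $ 1 $ 2 = 0 \<and> J (\<gamma> s) $ 2 $ 1 = pl (\<gamma> s) * (l - r)"
      if \<gamma>: "\<gamma> \<in> G2" "s \<in> {0<..<1}" "has_left_value S2 \<gamma> s l" "has_right_value S2 \<gamma> s r" for \<gamma> s l r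
    proof -
      have z: "\<gamma> s \<in> support G2" "\<gamma> s \<in> quadrant (-1) (-1)" using on[OF \<gamma>(1,2)] sub2 by blast+
      have rho: "varrho f S \<Gamma> (\<gamma> s) = f (\<gamma> s) * (r - l)"
        using rho2[OF z(1)] schwarz_data_jump[OF sd2 \<gamma>] by simp
      show ?thesis using z off[OF z(2)] by (simp add: J pl_def rho algebra_simps)
    qed
  qed simp
  have d3: "dressed_piece \<Sigma> G3 J D3 (schwarz_conj S) pu 2 1 (quadrant 1 (-1)) M m"
  proof (rule dressed_pieceI[OF sd3 open_quadrant cl3 arcs(3) _ _ pu_an(1) M_cont, where N = N])
    have off: "z \<notin> Dp" "z \<notin> D2" "z \<notin> D4" "z \<notin> frontier Dp" "z \<notin> frontier D2" "z \<notin> frontier D4"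
      "z \<notin> support \<Gamma>" "z \<notin> support G2" "z \<notin> support G4" if "z \<in> quadrant 1 (-1)" for z
      using away[OF sd cl1 that] away[OF sd2 cl2 that] away[OF sd4 cl4 that] by simp_all
    show "quadrant 1 (-1) \<inter> support \<Sigma> = support G3"
      by (rule set_eqI) (use off sub3 in \<open>auto simp: supp\<close>)
    show "(\<lambda>w. M w $ i $ j) differentiable (at z) \<and> dbar (\<lambda>w. M w $ i $ j) z = (M z ** N z) $ i $ j"
      if "z \<in> quadrant 1 (-1) - frontier D3" for z and i j :: 2
      using that off[of z] by (intro eq) auto
    show "N z $ 2 $ 2 = 0 \<and> N z $ 1 $ 1 = 0 \<and> N z $ 2 $ 1 = 0 \<and> N z $ 1 $ 2 = (if z \<in> D3 then pu z else 0)"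
      if "z \<in> quadrant 1 (-1)" for z
      using off[OF that] by (simp add: N)
    show "m z $ i $ 1 = M z $ i $ 1 \<and>
       m z $ i $ 2 = M z $ i $ 2 - (if z \<in> D3 then pu z * (cnj z - schwarz_conj S z) * M z $ i $ 1 else 0)"
      if "z \<in> quadrant 1 (-1)" for z and i :: 2
      using off[OF that] by (simp add: m q1_def q2_def)
    show "J (\<gamma> s) $ 2 $ 2 = 1 \<and> J (\<gamma> s) $ 1 $ 1 = 1 \<and> J (\<gamma> s) $ 2 $ 1 = 0 \<and> J (\<gamma> s) $ 1 $ 2 = pu (\<gamma> s) * (l - r)"
      if \<gamma>: "\<gamma> \<in> G3" "s \<in> {0<..<1}" "has_left_value (schwarz_conj S) \<gamma> s l" "has_right_value (schwarz_conj S) \<gamma> s r" for \<gamma> s l r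
    proof -
      have z: "\<gamma> s \<in> support G3" "\<gamma> s \<in> quadrant 1 (-1)" using on[OF \<gamma>(1,2)] sub3 by blast+
      note jc = schwarz_data_jump_cnj[OF sd \<gamma>[unfolded G_defs]]
      have rho: "schwarz_conj (varrho f S \<Gamma>) (\<gamma> s) = schwarz_conj f (\<gamma> s) * (r - l)"
        using rho1[OF jc(2)] jc(1) by (simp add: schwarz_conj_def)
      show ?thesis using z off[OF z(2)] by (simp add: J pu_def rho algebra_simps)
    qed
  qed simp
  have d4: "dressed_piece \<Sigma> G4 J D4 (schwarz_conj S2) pu 2 1 (quadrant (-1) 1) M m"
  proof (rule dressed_pieceI[OF sd4 open_quadrant cl4 arcs(4) _ _ pu_an(2) M_cont, where N = N])
    have off: "z \<notin> Dp" "z \<notin> D2" "z \<notin> D3" "z \<notin> frontier Dp" "z \<notin> frontier D2" "z \<notin> frontier D3"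
      "z \<notin> support \<Gamma>" "z \<notin> support G2" "z \<notin> support G3" if "z \<in> quadrant (-1) 1" for z
      using away[OF sd cl1 that] away[OF sd2 cl2 that] away[OF sd3 cl3 that] by simp_all
    show "quadrant (-1) 1 \<inter> support \<Sigma> = support G4"
      by (rule set_eqI) (use off sub4 in \<open>auto simp: supp\<close>)
    show "(\<lambda>w. M w $ i $ j) differentiable (at z) \<and> dbar (\<lambda>w. M w $ i $ j) z = (M z ** N z) $ i $ j"
      if "z \<in> quadrant (-1) 1 - frontier D4" for z and i j :: 2
      using that off[of z] by (intro eq) auto
    show "N z $ 2 $ 2 = 0 \<and> N z $ 1 $ 1 = 0 \<and> N z $ 2 $ 1 = 0 \<and> N z $ 1 $ 2 = (if z \<in> D4 then pu z else 0)"
      if "z \<in> quadrant (-1) 1" for z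
      using off[OF that] by (simp add: N)
    show "m z $ i $ 1 = M z $ i $ 1 \<and>
       m z $ i $ 2 = M z $ i $ 2 - (if z \<in> D4 then pu z * (cnj z - schwarz_conj S2 z) * M z $ i $ 1 else 0)"
      if "z \<in> quadrant (-1) 1" for z and i :: 2
      using off[OF that] by (simp add: m q1_def q2_def)
    show "J (\<gamma> s) $ 2 $ 2 = 1 \<and> J (\<gamma> s) $ 1 $ 1 = 1 \<and> J (\<gamma> s) $ 2 $ 1 = 0 \<and> J (\<gamma> s) $ 1 $ 2 = pu (\<gamma> s) * (l - r)"
      if \<gamma>: "\<gamma> \<in> G4" "s \<in> {0<..<1}" "has_left_value (schwarz_conj S2) \<gamma> s l" "has_right_value (schwarz_conj S2) \<gamma> s r" for \<gamma> s l r
    proof -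
      have z: "\<gamma> s \<in> support G4" "\<gamma> s \<in> quadrant (-1) 1" using on[OF \<gamma>(1,2)] sub4 by blast+
      have "\<gamma> \<in> conj_arcs G2" using \<gamma>(1) by (simp add: G_defs)
      note jc = schwarz_data_jump_cnj[OF sd2 this \<gamma>(2-4)]
      have rho: "schwarz_conj (varrho f S \<Gamma>) (\<gamma> s) = schwarz_conj f (\<gamma> s) * (r - l)"
        using rho2[OF jc(2)] jc(1) by (simp add: schwarz_conj_def)
      show ?thesis using z off[OF z(2)] by (simp add: J pu_def rho algebra_simps)
    qed
  qed simp
  \<comment> \<open>The coordinate axes belong to no open quadrant, but they avoid all four
    closures, outside of which \<open>m\<close> is \<open>M\<close>.\<close>
  have cover: "z \<in> quadrant 1 1 \<or> z \<in> quadrant (-1) (-1) \<or> z \<in> quadrant 1 (-1) \<or> z \<in> quadrant (-1) 1 \<or>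
      z \<in> - (closure Dp \<union> closure D2 \<union> closure D3 \<union> closure D4)" for z
    using cl1 cl2 cl3 cl4 by blast
  have m_diff: "(\<lambda>w. m w $ i $ j) field_differentiable at z" if z: "z \<notin> support \<Sigma>" for z and i j :: 2
  proof -
    have zG: "z \<notin> support \<Gamma>" "z \<notin> support G2" "z \<notin> support G3" "z \<notin> support G4" using z supp by auto
    let ?V = "- (closure Dp \<union> closure D2 \<union> closure D3 \<union> closure D4)"
    have "(\<lambda>w. m w $ i $ j) field_differentiable at z" if V: "z \<in> ?V"
    proof -
      have off: "w \<notin> Dp" "w \<notin> D2" "w \<notin> D3" "w \<notin> D4" if "w \<in> ?V" for w
        using that closure_subset[of Dp] closure_subset[of D2] closure_subset[of D3] closure_subset[of D4] by auto
      have "z \<notin> frontier Dp \<union> frontier D2 \<union> frontier D3 \<union> frontier D4" using V by (auto simp: frontier_def)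
      moreover have "(M z ** N z) $ i $ j = 0"
        using off[OF V] exhaust_2[of j] by (auto simp: mat2_mult_nth[OF c12] N)
      ultimately have "(\<lambda>w. M w $ i $ j) field_differentiable at z"
        using eq[of z i j] by (intro dbar_eq_0_imp_field_differentiable) auto
      then show ?thesis
      proof (rule field_differentiable_cong_open)
        show "open ?V" by (intro open_Compl closed_Un closed_closure)
        show "z \<in> ?V" by (rule V)
        show "M w $ i $ j = m w $ i $ j" if "w \<in> ?V" for w
          using off[OF that] exhaust_2[of j] by (auto simp: m q1_def q2_def)
      qed
    qed
    note far = this
    from cover[of z] show ?thesis
      using far dressed_piece.m_field_differentiable[OF d1, of z i j] dressed_piece.m_field_differentiable[OF d2, of z i j]
        dressed_piece.m_field_differentiable[OF d3, of z i j] dressed_piece.m_field_differentiable[OF d4, of z i j] zG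
      by blast
  qed
  have cl\<Sigma>: "compact (support \<Sigma>)"
    unfolding supp using arcsys by (intro compact_Un compact_support)
  have int\<Sigma>: "interior (support \<Sigma>) = {}"
    unfolding supp using arcsys
    by (simp add: interior_closed_Un_empty_interior interior_support closed_support closed_Un)
  \<comment> \<open>The reflections preserve the modulus, so one bound for \<open>Dp\<close> serves
    all four domains.\<close>
  obtain B where B: "\<And>z. z \<in> Dp \<Longrightarrow> norm z \<le> B" using bd by (auto simp: bounded_iff)
  have far: "m z = M z \<and> z \<notin> support \<Sigma>" if z: "norm z > B" for z
  proof -
    have off: "z \<notin> Dp" "z \<notin> D2" "z \<notin> D3" "z \<notin> D4"
      using z B[of z] B[of "- z"] B[of "cnj z"] B[of "- cnj z"]
      by (auto simp: D_defs neg.mem_T_image cnj.mem_T_image)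
    have "m z $ i $ j = M z $ i $ j" for i j :: 2
      using off exhaust_2[of j] by (auto simp: m q1_def q2_def)
    moreover have "z \<notin> support \<Sigma>" using off sub1 sub2 sub3 sub4 unfolding supp by blast
    ultimately show ?thesis by (simp add: vec_eq_iff)
  qed
  then have "eventually (\<lambda>z. m z = M z) at_infinity"
    unfolding eventually_at_infinity by (intro exI[of _ "B + 1"]) auto
  then have m_norm: "normalized_at_infinity m" using M_norm at_infinity_cong(1) by blast
  have m_hol: "(\<lambda>z. m z $ i $ j) holomorphic_on - support \<Sigma>" for i j :: 2
    unfolding holomorphic_on_def
    by (rule ballI, rule field_differentiable_at_within, rule m_diff) simp
  have m_jump: "\<exists>mp mm. has_left_value m \<gamma> s mp \<and> has_right_value m \<gamma> s mm \<and> mp = mm ** J (\<gamma> s)"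
    if "\<gamma> \<in> \<Sigma>" "s \<in> {0<..<1}" for \<gamma> s
  proof -
    have "\<gamma> \<in> \<Gamma> \<or> \<gamma> \<in> G2 \<or> \<gamma> \<in> G3 \<or> \<gamma> \<in> G4" using that \<Sigma>_cases by blast
    then show ?thesis
      using dressed_piece.m_jump[OF d1 _ that(2)] dressed_piece.m_jump[OF d2 _ that(2)]
        dressed_piece.m_jump[OF d3 _ that(2)] dressed_piece.m_jump[OF d4 _ that(2)] by (elim disjE)
  qed
  have m_ends: "(\<lambda>z. m z $ i $ j) \<in> o[at a within - support \<Sigma>](\<lambda>z. 1 / (z - a))"
    if "\<gamma> \<in> \<Sigma>" "a \<in> {\<gamma> 0, \<gamma> 1}" for \<gamma> a and i j :: 2
  proof -
    have "\<gamma> \<in> \<Gamma> \<or> \<gamma> \<in> G2 \<or> \<gamma> \<in> G3 \<or> \<gamma> \<in> G4" using that \<Sigma>_cases by blast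
    then show ?thesis
      using dressed_piece.m_ends[OF d1 _ that(2)] dressed_piece.m_ends[OF d2 _ that(2)]
        dressed_piece.m_ends[OF d3 _ that(2)] dressed_piece.m_ends[OF d4 _ that(2)] by (elim disjE)
  qed
  have rhp: "rhp_solution \<Sigma> J m"
    unfolding rhp_solution_def by (intro conjI allI ballI m_hol m_jump m_ends m_norm)
  have jp: "\<exists>G D S p c c'. z \<in> D \<and> jump_piece \<Sigma> G J D S p c c'" if z: "z \<in> support \<Sigma>" for z
  proof -
    have "z \<in> Dp \<or> z \<in> D2 \<or> z \<in> D3 \<or> z \<in> D4" using z sub1 sub2 sub3 sub4 unfolding supp by blast
    moreover note dressed_piece.axioms(1)[OF d1] dressed_piece.axioms(1)[OF d2]
      dressed_piece.axioms(1)[OF d3] dressed_piece.axioms(1)[OF d4]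
    ultimately show ?thesis by (elim disjE) (intro exI conjI; assumption)+
  qed
  show ?thesis
    by (intro exI[of _ m] exI[of _ B] conjI rhp allI impI ballI)
      (use far cl\<Sigma> compact_imp_closed int\<Sigma> jp in auto)
qed

section \<open>Comparison of the coefficients at infinity\<close>

theorem proposition2p5:
  fixes Dp :: "complex set" and S f :: "complex \<Rightarrow> complex"
    and \<Gamma> :: "(real \<Rightarrow> complex) set" and x t :: real and M2 :: "complex \<Rightarrow> complex^2^2"
  assumes "quadrature_domain Dp S \<Gamma>"
    and "closure Dp \<subseteq> first_quadrant"
    and "f analytic_on (closure Dp \<union> closure (uminus ` Dp))"
    and "\<forall>z\<in>Dp. f (- z) = f z"
    and "dbar_solution Dp f x t M2"
  shows "\<exists>A u. has_inv_z_coeff M2 A \<and> has_potential M2 u \<and>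
           (\<exists>m. rhp_solution (four_arcs \<Gamma>) (jump_matrix f S \<Gamma> x t) m) \<and>
           (\<forall>m. rhp_solution (four_arcs \<Gamma>) (jump_matrix f S \<Gamma> x t) m \<longrightarrow>
                  has_inv_z_coeff m A \<and> has_potential m u)"
proof -
  let ?\<Sigma> = "four_arcs \<Gamma>" and ?J = "jump_matrix f S \<Gamma> x t"
  have sd: "schwarz_data Dp S \<Gamma>" and bd: "bounded Dp"
    using assms(1) unfolding quadrature_domain_def mother_body_def schwarz_data_def by auto
  obtain m B where *: "rhp_solution ?\<Sigma> ?J m \<and> (\<forall>z. norm z > B \<longrightarrow> m z = M2 z \<and> z \<notin> support ?\<Sigma>) \<and>
    closed (support ?\<Sigma>) \<and> compact (support ?\<Sigma>) \<and> interior (support ?\<Sigma>) = {} \<and>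
    (\<forall>z\<in>support ?\<Sigma>. \<exists>\<Gamma> D S p c c'. z \<in> D \<and> jump_piece ?\<Sigma> \<Gamma> ?J D S p c c')"
    using dressed_solution[OF sd bd assms(2,3,5)] by (elim exE)
  then have m: "rhp_solution ?\<Sigma> ?J m" and far: "\<And>z. norm z > B \<Longrightarrow> m z = M2 z \<and> z \<notin> support ?\<Sigma>"
    and E: "closed (support ?\<Sigma>)" "compact (support ?\<Sigma>)" "interior (support ?\<Sigma>) = {}"
    by blast+
  from * have pieces: "\<exists>\<Gamma> D S p c c'. z \<in> D \<and> jump_piece ?\<Sigma> \<Gamma> ?J D S p c c'" if "z \<in> support ?\<Sigma>" for z
    using that by (elim conjE) (erule (1) bspec)
  have far_ev: "eventually (\<lambda>z. m' z = m z) at_infinity" if "\<And>z. norm z > B \<Longrightarrow> m' z = m z" for m'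
    unfolding eventually_at_infinity using that by (intro exI[of _ "B + 1"]) auto
  have "(\<lambda>w. m w $ i $ j) field_differentiable at z" if "norm z > B" for z and i j :: 2
    using m far[OF that] E(1) unfolding rhp_solution_def
    by (intro holomorphic_on_imp_differentiable_at[of _ "- support ?\<Sigma>"]) auto
  \<comment> \<open>The coefficient is read off from the dressed solution, which is holomorphic near
    infinity; \<open>M2\<close> and every other solution coincide with it for
    \<open>norm z > B\<close> and inherit the coefficient.\<close>
  then obtain A where A: "has_inv_z_coeff m A"
    using has_inv_z_coeff_exists[of B m] m unfolding rhp_solution_def by blast
  have agree: "has_inv_z_coeff m' A" if "\<And>z. norm z > B \<Longrightarrow> m' z = m z" for m'
    using at_infinity_cong(2)[OF far_ev[OF that]] A by blast
  have M2A: "has_inv_z_coeff M2 A" by (rule agree) (simp add: far)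
  have uniq: "has_inv_z_coeff m' A" if "rhp_solution ?\<Sigma> ?J m'" for m'
    by (rule agree) (use rhp_unique[OF E pieces m that] far in blast)
  show ?thesis
    by (intro exI[of _ A] exI[of _ "2 * \<i> * A $ 1 $ 2"] conjI allI impI has_inv_z_coeff_imp_potential M2A uniq)
      (use m in blast)+
qed

end
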